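(* Let $\gamma>1$ and $K>1$. There is a constant $M>0$ depending only on $\gamma$ and $K$ such that the following holds. Let $U$ be a steady self-similar entropy solution of the two-dimensional full Euler equations for a polytropic gas with exponent $\gamma$, with values in the phase space $\mathcal P_K$, and without stagnation points ($\vec u(\theta)\neq 0$ for every $\theta$). Then $U$ is of bounded variation on $[0,2\pi[$. Moreover $U$ can be decomposed on $[0,2\pi[$ as $$U=U_L+U_S,$$ where $U_L$ is Lipschitz with Lipschitz constant at most $M$, and $U_S$ is a saltus function of bounded variation with total variation at most $M$. In particular $U$ is a special function of bounded variation (the Cantor part of its derivative vanishes), and its absolutely continuous part is Lipschitz.
   Context: Notation: $\rho$ density, $\vec u=(u,v)$ velocity, $p$ pressure, $e$ specific internal energy, $S$ specific entropy, $E=\rho\left(\frac{u^2+v^2}{2}+e\right)$, $U=(\rho,\rho u,\rho v,E)^T$. Polytropic gas: $e=\frac{p}{(\gamma-1)\rho}$ with $\gamma>1$, sound speed $c=\sqrt{\gamma p/\rho}$, and $S=c_v\ln(p\rho^{-\gamma})+\text{const}$ with $c_v>0$ constant. Phase space: $\mathcal P_K$ is the set of $U$ with $K^{-1}\le\rho\le K$, $K^{-1}\le e\le K$, $|U|\le K$. Fluxes: $f^x(U)=(\rho u,\rho u^2+p,\rho uv,u(E+p))^T$, $f^y(U)=(\rho v,\rho uv,\rho v^2+p,v(E+p))^T$, $\psi^x=\rho uS$, $\psi^y=\rho vS$. A steady self-similar entropy solution is a $2\pi$-periodic function $\theta\mapsto U(\theta)\in\mathcal P_K$ in $L^\infty$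 ($\theta$ is the polar angle) such that in the sense of distributions $$(\sin\theta f^x(U)-\cos\theta f^y(U))_\theta=\cos\theta f^x(U)+\sin\theta f^y(U),$$ $$(\sin\theta\psi^x(U)-\cos\theta\psi^y(U))_\theta\le\cos\theta\psi^x(U)+\sin\theta\psi^y(U).$$ The version of $U$ is chosen so that the integrated forms of these relations over $[\theta_1,\theta_2]$ hold for all $\theta_1<\theta_2$. In the absence of stagnation points $U$ has one-sided limits at every discontinuity, and $U$ is normalised to be right-continuous. A saltus (pure jump) function is one of the form $\theta\mapsto\sum_{\phi\in D,\ \phi\le\theta}a_\phi$ with $D$ countable and $\sum_{\phi\in D}|a_\phi|<\infty$. *)

theory Defs
  imports "HOL-Analysis.Analysis"
begin

section \<open>Polytropic gas in conserved variables\<close>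

text \<open>A state is \<open>U = (\<rho>, \<rho>u, \<rho>v, E)\<close> in \<open>real^4\<close>; all other quantities are functions of \<open>U\<close>,
  obtained by inverting \<open>E = \<rho>((u^2 + v^2)/2 + e)\<close> and \<open>e = p/((\<gamma> - 1)\<rho>)\<close>.\<close>

definition density :: "real^4 \<Rightarrow> real"
  where "density U = U $ 1"

definition vel_x :: "real^4 \<Rightarrow> real"
  where "vel_x U = U $ 2 / U $ 1"

definition vel_y :: "real^4 \<Rightarrow> real"
  where "vel_y U = U $ 3 / U $ 1"

definition energy :: "real^4 \<Rightarrow> real"
  where "energy U = U $ 4"

definition internal_energy :: "real^4 \<Rightarrow> real"
  where "internal_energy U = energy U / density U - ((vel_x U)\<^sup>2 + (vel_y U)\<^sup>2) / 2"

definition pressure :: "real \<Rightarrow> real^4 \<Rightarrow> real"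
  where "pressure \<gamma> U = (\<gamma> - 1) * density U * internal_energy U"

definition entropy :: "real \<Rightarrow> real \<Rightarrow> real \<Rightarrow> real^4 \<Rightarrow> real"
  where "entropy \<gamma> c\<^sub>v S\<^sub>0 U = c\<^sub>v * ln (pressure \<gamma> U * density U powr (-\<gamma>)) + S\<^sub>0"

definition phase_space :: "real \<Rightarrow> (real^4) set"
  where "phase_space K =
    {U. inverse K \<le> density U \<and> density U \<le> K \<and>
        inverse K \<le> internal_energy U \<and> internal_energy U \<le> K \<and> norm U \<le> K}"

definition flux_x :: "real \<Rightarrow> real^4 \<Rightarrow> real^4"
  where "flux_x \<gamma> U = vector
    [density U * vel_x U,
     density U * (vel_x U)\<^sup>2 + pressure \<gamma> U,
     density U * vel_x U * vel_y U,
     vel_x U * (energy U + pressure \<gamma> U)]"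

definition flux_y :: "real \<Rightarrow> real^4 \<Rightarrow> real^4"
  where "flux_y \<gamma> U = vector
    [density U * vel_y U,
     density U * vel_x U * vel_y U,
     density U * (vel_y U)\<^sup>2 + pressure \<gamma> U,
     vel_y U * (energy U + pressure \<gamma> U)]"

definition entropy_flux_x :: "real \<Rightarrow> real \<Rightarrow> real \<Rightarrow> real^4 \<Rightarrow> real"
  where "entropy_flux_x \<gamma> c\<^sub>v S\<^sub>0 U = density U * vel_x U * entropy \<gamma> c\<^sub>v S\<^sub>0 U"

definition entropy_flux_y :: "real \<Rightarrow> real \<Rightarrow> real \<Rightarrow> real^4 \<Rightarrow> real"
  where "entropy_flux_y \<gamma> c\<^sub>v S\<^sub>0 U = density U * vel_y U * entropy \<gamma> c\<^sub>v S\<^sub>0 U"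


section \<open>Steady self-similar entropy solutions\<close>

text \<open>For a pair of flux functions \<open>(f, g)\<close> (of \<open>x\<close> and \<open>y\<close>), the combinations
  \<open>sin \<theta> f - cos \<theta> g\<close> and \<open>cos \<theta> f + sin \<theta> g\<close>.\<close>

definition angular_part :: "('s \<Rightarrow> 'b::real_vector) \<Rightarrow> ('s \<Rightarrow> 'b) \<Rightarrow> (real \<Rightarrow> 's) \<Rightarrow> real \<Rightarrow> 'b"
  where "angular_part f g U \<theta> = sin \<theta> *\<^sub>R f (U \<theta>) - cos \<theta> *\<^sub>R g (U \<theta>)"

definition radial_part :: "('s \<Rightarrow> 'b::real_vector) \<Rightarrow> ('s \<Rightarrow> 'b) \<Rightarrow> (real \<Rightarrow> 's) \<Rightarrow> real \<Rightarrow> 'b"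
  where "radial_part f g U \<theta> = cos \<theta> *\<^sub>R f (U \<theta>) + sin \<theta> *\<^sub>R g (U \<theta>)"

definition test_function :: "(real \<Rightarrow> real) \<Rightarrow> bool"
  where "test_function \<phi> \<longleftrightarrow>
    (\<forall>n. (deriv ^^ n) \<phi> differentiable_on UNIV) \<and> bounded {x. \<phi> x \<noteq> 0}"

text \<open>\<open>g' = h\<close> and \<open>g' \<le> h\<close> in the sense of distributions on the real line.\<close>

definition distr_deriv_eq :: "(real \<Rightarrow> 'b::euclidean_space) \<Rightarrow> (real \<Rightarrow> 'b) \<Rightarrow> bool"
  where "distr_deriv_eq g h \<longleftrightarrow>
    (\<forall>\<phi>. test_function \<phi> \<longrightarrow>
      - (LINT \<theta>|lebesgue. deriv \<phi> \<theta> *\<^sub>R g \<theta>) = (LINT \<theta>|lebesgue. \<phi> \<theta> *\<^sub>R h \<theta>))"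

definition distr_deriv_le :: "(real \<Rightarrow> real) \<Rightarrow> (real \<Rightarrow> real) \<Rightarrow> bool"
  where "distr_deriv_le g h \<longleftrightarrow>
    (\<forall>\<phi>. test_function \<phi> \<and> (\<forall>\<theta>. 0 \<le> \<phi> \<theta>) \<longrightarrow>
      - (LINT \<theta>|lebesgue. deriv \<phi> \<theta> * g \<theta>) \<le> (LINT \<theta>|lebesgue. \<phi> \<theta> * h \<theta>))"

definition steady_selfsimilar_entropy_solution ::
    "real \<Rightarrow> real \<Rightarrow> real \<Rightarrow> real \<Rightarrow> (real \<Rightarrow> real^4) \<Rightarrow> bool"
  where "steady_selfsimilar_entropy_solution \<gamma> K c\<^sub>v S\<^sub>0 U \<longleftrightarrow>
    U \<in> borel_measurable lebesgue \<and>
    (\<forall>\<theta>. U (\<theta> + 2 * pi) = U \<theta>) \<and>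
    (\<forall>\<theta>. U \<theta> \<in> phase_space K) \<and>
    distr_deriv_eq (angular_part (flux_x \<gamma>) (flux_y \<gamma>) U) (radial_part (flux_x \<gamma>) (flux_y \<gamma>) U) \<and>
    distr_deriv_le
      (angular_part (entropy_flux_x \<gamma> c\<^sub>v S\<^sub>0) (entropy_flux_y \<gamma> c\<^sub>v S\<^sub>0) U)
      (radial_part (entropy_flux_x \<gamma> c\<^sub>v S\<^sub>0) (entropy_flux_y \<gamma> c\<^sub>v S\<^sub>0) U)"

text \<open>The distributional relations only determine \<open>U\<close> almost everywhere. The following two
  predicates fix the representative: the relations hold in integrated form between any two
  angles, and \<open>U\<close> is right-continuous.\<close>

definition integrated_version :: "real \<Rightarrow> real \<Rightarrow> real \<Rightarrow> (real \<Rightarrow> real^4) \<Rightarrow> bool"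
  where "integrated_version \<gamma> c\<^sub>v S\<^sub>0 U \<longleftrightarrow>
    (\<forall>\<theta>\<^sub>1 \<theta>\<^sub>2. \<theta>\<^sub>1 < \<theta>\<^sub>2 \<longrightarrow>
      angular_part (flux_x \<gamma>) (flux_y \<gamma>) U \<theta>\<^sub>2 - angular_part (flux_x \<gamma>) (flux_y \<gamma>) U \<theta>\<^sub>1
        = (LINT \<theta>:{\<theta>\<^sub>1..\<theta>\<^sub>2}|lebesgue. radial_part (flux_x \<gamma>) (flux_y \<gamma>) U \<theta>) \<and>
      angular_part (entropy_flux_x \<gamma> c\<^sub>v S\<^sub>0) (entropy_flux_y \<gamma> c\<^sub>v S\<^sub>0) U \<theta>\<^sub>2
          - angular_part (entropy_flux_x \<gamma> c\<^sub>v S\<^sub>0) (entropy_flux_y \<gamma> c\<^sub>v S\<^sub>0) U \<theta>\<^sub>1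
        \<le> (LINT \<theta>:{\<theta>\<^sub>1..\<theta>\<^sub>2}|lebesgue.
              radial_part (entropy_flux_x \<gamma> c\<^sub>v S\<^sub>0) (entropy_flux_y \<gamma> c\<^sub>v S\<^sub>0) U \<theta>))"

definition right_continuous :: "(real \<Rightarrow> 'b::topological_space) \<Rightarrow> bool"
  where "right_continuous f \<longleftrightarrow> (\<forall>x. continuous (at_right x) f)"

definition no_stagnation_points :: "(real \<Rightarrow> real^4) \<Rightarrow> bool"
  where "no_stagnation_points U \<longleftrightarrow> (\<forall>\<theta>. (vel_x (U \<theta>), vel_y (U \<theta>)) \<noteq> (0, 0))"


section \<open>Functions of bounded variation of one variable\<close>

definition total_variation :: "real set \<Rightarrow> (real \<Rightarrow> 'b::real_normed_vector) \<Rightarrow> ennreal"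
  where "total_variation A f =
    (SUP xs \<in> {xs. sorted xs \<and> set xs \<subseteq> A}.
      ennreal (\<Sum>i<length xs - 1. norm (f (xs ! Suc i) - f (xs ! i))))"

definition bounded_variation_on :: "real set \<Rightarrow> (real \<Rightarrow> 'b::real_normed_vector) \<Rightarrow> bool"
  where "bounded_variation_on A f \<longleftrightarrow> total_variation A f < \<infinity>"

definition saltus_on :: "real set \<Rightarrow> (real \<Rightarrow> 'b::real_normed_vector) \<Rightarrow> bool"
  where "saltus_on A f \<longleftrightarrow>
    (\<exists>D a. countable D \<and> D \<subseteq> A \<and> a abs_summable_on D \<and>
      (\<forall>\<theta>\<in>A. f \<theta> = (\<Sum>\<^sub>\<infinity>\<phi>\<in>{\<phi>\<in>D. \<phi> \<le> \<theta>}. a \<phi>)))"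

definition absolutely_continuous_on :: "real set \<Rightarrow> (real \<Rightarrow> 'b::real_normed_vector) \<Rightarrow> bool"
  where "absolutely_continuous_on A f \<longleftrightarrow>
    (\<forall>\<epsilon>>0. \<exists>\<delta>>0. \<forall>P :: (real \<times> real) set.
      finite P \<and> (\<forall>(s, t)\<in>P. s \<le> t \<and> {s..t} \<subseteq> A) \<and>
      pairwise (\<lambda>(s, t) (s', t'). {s<..<t} \<inter> {s'<..<t'} = {}) P \<and>
      (\<Sum>(s, t)\<in>P. t - s) < \<delta> \<longrightarrow>
      (\<Sum>(s, t)\<in>P. norm (f t - f s)) < \<epsilon>)"

text \<open>Continuous functions of bounded variation whose derivative is singular to Lebesgue
  measure, i.e. whose pointwise derivative vanishes almost everywhere: the distributional
  derivative of such a function is its own Cantor part.\<close>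

definition cantor_type_on :: "real set \<Rightarrow> (real \<Rightarrow> 'b::real_normed_vector) \<Rightarrow> bool"
  where "cantor_type_on A f \<longleftrightarrow>
    continuous_on A f \<and> bounded_variation_on A f \<and>
    (\<exists>N \<in> null_sets lebesgue. \<forall>x \<in> A - N. (f has_vector_derivative 0) (at x within A))"

text \<open>Lebesgue decomposition of a right-continuous BV function into its absolutely continuous
  part, its jump part and its Cantor part; on an interval the parts are unique up to additive
  constants.\<close>

definition bv_decomposition ::
    "real set \<Rightarrow> (real \<Rightarrow> 'b::real_normed_vector) \<Rightarrow>
      (real \<Rightarrow> 'b) \<Rightarrow> (real \<Rightarrow> 'b) \<Rightarrow> (real \<Rightarrow> 'b) \<Rightarrow> bool"
  where "bv_decomposition A f f\<^sub>a f\<^sub>j f\<^sub>c \<longleftrightarrow>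
    (\<forall>x\<in>A. f x = f\<^sub>a x + f\<^sub>j x + f\<^sub>c x) \<and>
    absolutely_continuous_on A f\<^sub>a \<and> saltus_on A f\<^sub>j \<and> cantor_type_on A f\<^sub>c"

text \<open>The derivative of the Cantor part vanishes iff the Cantor part is constant. The middle
  conjunct keeps the last one from holding vacuously.\<close>

definition special_bounded_variation_on :: "real set \<Rightarrow> (real \<Rightarrow> 'b::real_normed_vector) \<Rightarrow> bool"
  where "special_bounded_variation_on A f \<longleftrightarrow>
    bounded_variation_on A f \<and>
    (\<exists>f\<^sub>a f\<^sub>j f\<^sub>c. bv_decomposition A f f\<^sub>a f\<^sub>j f\<^sub>c) \<and>
    (\<forall>f\<^sub>a f\<^sub>j f\<^sub>c. bv_decomposition A f f\<^sub>a f\<^sub>j f\<^sub>c \<longrightarrow> f\<^sub>c constant_on A)"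

end

theory Submission
  imports Defs
begin

text \<open>In the frame of the ray at angle \<open>\<theta>\<close>, with radial velocity \<open>L\<close> and normal velocity \<open>N\<close>, the balance
  laws say that the mass flux \<open>m = \<rho> N\<close>, the impulse \<open>\<rho> N\<^sup>2 + p\<close>, and the products of \<open>m\<close> with \<open>L\<close> and with
  the total enthalpy are continuous, with right derivatives given by bounded expressions in the state. Where
  \<open>m\<close> is not zero the enthalpy is constant and \<open>L' = - N\<close>, and these quantities determine the state
  up to one sign: the sign of the sonic defect \<open>V = \<rho> (N\<^sup>2 - c\<^sup>2)\<close>, whose square is a polynomial in the
  fluxes. The whole question is how often this sign can jump.

  Three observations answer it. First, \<open>(V\<^sup>2)' = 4 m L V\<close>, so \<open>\<bar>V\<bar>\<close> is Lipschitz with a constant that depends on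
  \<open>K\<close> only (\<open>abs_sonic_defect_lipschitz\<close>). Second, a change of sign is a shock, and the entropy condition
  admits only one direction: \<open>m V\<close> jumps from negative to positive (\<open>sonic_defect_jumps_up\<close>). So
  between two shocks the flow has to pass a sonic point, and the strength of a shock is at most
  proportional to the distance to this point. Shock strengths are therefore summable, and over a step that
  contains a sonic point both the change of the state and the sum of all shocks are of the order of the
  step (\<open>lipschitz_plus_saltus_if_upward_jumps\<close>). This gives a Lipschitz function plus a saltus function on
  each sector where \<open>m\<close> does not vanish; the Lipschitz constant survives near the ends of
  the sector since the state is recovered from the fluxes without dividing by \<open>m\<close> (\<open>ex_controls_states\<close>).

  Third, zeros of \<open>m\<close>, where contact discontinuities sit, are at least \<open>1 / K\<close> apart in the absence of
  stagnation points (\<open>mass_flux_zero_gap\<close>), so there are finitely many sectors, with a bound on their number,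
  and each contact discontinuity adds one bounded jump. The remaining assertions hold for every
  function with such a decomposition (\<open>lipschitz_plus_saltus_consequences\<close>).\<close>

section \<open>One-sided calculus\<close>

text \<open>A continuous function that satisfies a slope bound up to some point keeps it a little beyond,
  because of the right derivative there; hence the set of good points is the whole interval. Right
  derivatives suffice and are what right-continuous flows provide at every angle.\<close>

lemma increment_le_of_right_derivative_le:
  fixes f :: "real \<Rightarrow> real"
  assumes cont: "continuous_on {a..b} f" and "a \<le> b"
    and der: "\<And>x. a < x \<Longrightarrow> x < b \<Longrightarrow> \<exists>y\<le>C. (f has_real_derivative y) (at_right x)"
  shows "f b - f a \<le> C * (b - a)"
proof -
  have strict: "f b - f c \<le> (C + e) * (b - c)" if "a < c" "c < b" "e > 0" for c e
  proof -
    define G where "G = {t\<in>{c..b}. f t - f c \<le> (C + e) * (t - c)}"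
    have cont': "continuous_on {c..b} f" using cont that by (auto intro: continuous_on_subset)
    have "closed G" unfolding G_def
      by (intro continuous_on_closed_Collect_le continuous_intros cont')
    have "c \<in> G" using that by (auto simp: G_def)
    have bdd: "bdd_above G" by (auto simp: G_def intro!: bdd_aboveI[of _ b])
    define s where "s = Sup G"
    have "s \<in> G" unfolding s_def
      using \<open>closed G\<close> \<open>c \<in> G\<close> bdd by (intro closed_contains_Sup) auto
    have "s = b"
    proof (rule ccontr)
      assume "s \<noteq> b"
      then have "s < b" "c \<le> s" using \<open>s \<in> G\<close> by (auto simp: G_def)
      then obtain y where y: "y \<le> C" "(f has_real_derivative y) (at_right s)"
        using der[of s] \<open>a < c\<close> by auto
      then have "((\<lambda>t. (f t - f s) / (t - s)) \<longlongrightarrow> y) (at_right s)"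
        by (simp add: has_field_derivative_iff)
      then have "\<forall>\<^sub>F t in at_right s. (f t - f s) / (t - s) < C + e"
        using y that by (intro order_tendstoD) auto
      moreover have "\<forall>\<^sub>F t in at_right s. t \<in> {s<..<b}"
        using \<open>s < b\<close> by (rule eventually_at_right_real)
      ultimately have "\<forall>\<^sub>F t in at_right s. (f t - f s) / (t - s) < C + e \<and> t \<in> {s<..<b}"
        by (rule eventually_conj)
      then obtain t where t: "(f t - f s) / (t - s) < C + e" "s < t" "t < b"
        using eventually_happens[of _ "at_right s"] by (auto simp: trivial_limit_at_right_real)
      then have "f t - f s \<le> (C + e) * (t - s)" by (simp add: field_simps)
      moreover have "f s - f c \<le> (C + e) * (s - c)" using \<open>s \<in> G\<close> by (simp add: G_def)
      ultimately have "f t - f c \<le> (C + e) * (t - c)" by (simp add: algebra_simps)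
      then have "t \<in> G" using t \<open>c \<le> s\<close> by (auto simp: G_def)
      then have "t \<le> s" unfolding s_def using bdd by (rule cSup_upper)
      then show False using t by simp
    qed
    then show ?thesis using \<open>s \<in> G\<close> by (simp add: G_def)
  qed
  show ?thesis
  proof (cases "a = b")
    case False
    then have "a < b" using \<open>a \<le> b\<close> by simp
    have step: "f b - f c \<le> C * (b - c)" if "a < c" "c < b" for c
    proof (rule field_le_epsilon)
      fix e :: real assume "e > 0"
      moreover have "(C + e / (b - c)) * (b - c) = C * (b - c) + e"
        using that by (simp add: field_simps)
      ultimately show "f b - f c \<le> C * (b - c) + e"
        using strict[of c "e / (b - c)"] that by simp
    qed
    have lim: "(f \<longlongrightarrow> f a) (at_right a)"
      using cont \<open>a < b\<close> by (simp add: continuous_on_Icc_at_rightD)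
    have ev: "\<forall>\<^sub>F c in at_right a. f b - f c \<le> C * (b - c)"
      using eventually_at_right_real[OF \<open>a < b\<close>] by eventually_elim (use step in auto)
    show ?thesis
      by (rule tendsto_le[OF _ _ _ ev]) (auto intro!: tendsto_intros lim)
  qed auto
qed

lemma abs_increment_le_of_right_derivative_le:
  fixes f :: "real \<Rightarrow> real"
  assumes cont: "continuous_on {a..b} f" and "a \<le> b"
    and der: "\<And>x. a < x \<Longrightarrow> x < b \<Longrightarrow> \<exists>y. \<bar>y\<bar> \<le> C \<and> (f has_real_derivative y) (at_right x)"
  shows "\<bar>f b - f a\<bar> \<le> C * (b - a)"
proof -
  have "f b - f a \<le> C * (b - a)"
    by (rule increment_le_of_right_derivative_le[OF cont \<open>a \<le> b\<close>]) (use der abs_le_D1 in blast)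
  moreover have "- f b - - f a \<le> C * (b - a)"
  proof (rule increment_le_of_right_derivative_le[OF _ \<open>a \<le> b\<close>, of "\<lambda>x. - f x"])
    show "continuous_on {a..b} (\<lambda>x. - f x)" by (intro continuous_intros cont)
    fix x assume "a < x" "x < b"
    then obtain y where "\<bar>y\<bar> \<le> C" "(f has_real_derivative y) (at_right x)" using der by blast
    then show "\<exists>y\<le>C. ((\<lambda>x. - f x) has_real_derivative y) (at_right x)"
      by (intro exI[of _ "-y"]) (auto intro!: derivative_eq_intros)
  qed
  ultimately show ?thesis by linarith
qed

section \<open>Saltus functions and bounded variation\<close>

text \<open>Against a monotone majorant \<open>\<mu>\<close> of the increments the variation sums telescope.\<close>

lemma total_variation_le:
  fixes f :: "real \<Rightarrow> 'b::real_normed_vector"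
  assumes inc: "\<And>s t. s \<in> A \<Longrightarrow> t \<in> A \<Longrightarrow> s \<le> t \<Longrightarrow> norm (f t - f s) \<le> \<mu> t - \<mu> s"
    and bounds: "\<And>s. s \<in> A \<Longrightarrow> lo \<le> \<mu> s \<and> \<mu> s \<le> hi" and "lo \<le> hi"
  shows "total_variation A f \<le> ennreal (hi - lo)"
  unfolding total_variation_def
proof (rule SUP_least, rule ennreal_leI)
  fix xs assume "xs \<in> {xs. sorted xs \<and> set xs \<subseteq> A}"
  then have xs: "sorted xs" "set xs \<subseteq> A" by auto
  show "(\<Sum>i<length xs - 1. norm (f (xs ! Suc i) - f (xs ! i))) \<le> hi - lo"
  proof (cases "xs = []")
    case False
    have mem: "xs ! i \<in> A" if "i < length xs" for i using xs that by auto
    have "(\<Sum>i<length xs - 1. norm (f (xs ! Suc i) - f (xs ! i)))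
        \<le> (\<Sum>i<length xs - 1. \<mu> (xs ! Suc i) - \<mu> (xs ! i))"
      using xs by (intro sum_mono inc mem sorted_nth_mono) auto
    also have "\<dots> = \<mu> (xs ! (length xs - 1)) - \<mu> (xs ! 0)"
      by (rule sum_lessThan_telescope)
    also have "\<dots> \<le> hi - lo"
      using bounds[OF mem[of "length xs - 1"]] bounds[OF mem[of 0]] False by (auto intro: diff_mono)
    finally show ?thesis .
  qed (use \<open>lo \<le> hi\<close> in auto)
qed

definition saltus_function :: "(real \<Rightarrow> 'b::real_normed_vector) \<Rightarrow> real set \<Rightarrow> real \<Rightarrow> 'b"
  where "saltus_function a D \<theta> = (\<Sum>\<^sub>\<infinity>\<phi>\<in>{\<phi>\<in>D. \<phi> \<le> \<theta>}. a \<phi>)"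

lemma saltus_function_increment:
  fixes a :: "real \<Rightarrow> 'b::banach"
  assumes "a abs_summable_on D" "s \<le> t"
  shows "saltus_function a D t - saltus_function a D s = infsum a (D \<inter> {s<..t})"
proof -
  have sub: "a summable_on X" if "X \<subseteq> D" for X
    using abs_summable_summable[OF assms(1)] that by (rule summable_on_subset_banach)
  have "{\<phi>\<in>D. \<phi> \<le> t} = {\<phi>\<in>D. \<phi> \<le> s} \<union> D \<inter> {s<..t}" using \<open>s \<le> t\<close> by auto
  then have "saltus_function a D t = infsum a ({\<phi>\<in>D. \<phi> \<le> s} \<union> D \<inter> {s<..t})"
    unfolding saltus_function_def by simp
  also have "\<dots> = saltus_function a D s + infsum a (D \<inter> {s<..t})"
    unfolding saltus_function_def by (rule infsum_Un_disjoint) (auto intro: sub)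
  finally show ?thesis by simp
qed

lemma abs_summable_on_subset_real:
  fixes a :: "'a \<Rightarrow> 'b::real_normed_vector"
  assumes "a abs_summable_on D" "X \<subseteq> D"
  shows "a abs_summable_on X"
  using summable_on_subset_banach[OF assms] .

lemma norm_infsum_le_of_finite_sums:
  fixes a :: "'a \<Rightarrow> 'b::real_normed_vector"
  assumes "\<And>F. finite F \<Longrightarrow> F \<subseteq> D \<Longrightarrow> (\<Sum>x\<in>F. norm (a x)) \<le> N"
  shows "a abs_summable_on D" "norm (infsum a D) \<le> N" "infsum (\<lambda>x. norm (a x)) D \<le> N"
proof -
  show summ: "a abs_summable_on D"
    by (rule nonneg_bdd_above_summable_on) (auto intro!: bdd_aboveI[of _ N] assms)
  show le: "infsum (\<lambda>x. norm (a x)) D \<le> N"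
    by (rule infsum_le_finite_sums[OF summ]) (rule assms)
  show "norm (infsum a D) \<le> N"
    using norm_infsum_bound[OF summ] le by linarith
qed

lemma saltus_function_increment_norm:
  fixes a :: "real \<Rightarrow> 'b::banach"
  assumes "a abs_summable_on D" "s \<le> t"
  shows "norm (saltus_function a D t - saltus_function a D s)
    \<le> saltus_function (\<lambda>\<phi>. norm (a \<phi>)) D t - saltus_function (\<lambda>\<phi>. norm (a \<phi>)) D s"
proof -
  have "(\<lambda>\<phi>. norm (norm (a \<phi>))) summable_on D" using assms by simp
  then show ?thesis
    using assms norm_infsum_bound[OF abs_summable_on_subset_real[OF assms(1)], of "D \<inter> {s<..t}"]
    by (simp add: saltus_function_increment)
qed

lemma saltus_function_norm_bounds:
  fixes a :: "real \<Rightarrow> 'b::banach"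
  assumes "\<And>F. finite F \<Longrightarrow> F \<subseteq> D \<Longrightarrow> (\<Sum>x\<in>F. norm (a x)) \<le> N"
  shows "0 \<le> saltus_function (\<lambda>\<phi>. norm (a \<phi>)) D t"
    "saltus_function (\<lambda>\<phi>. norm (a \<phi>)) D t \<le> N"
proof -
  show "0 \<le> saltus_function (\<lambda>\<phi>. norm (a \<phi>)) D t"
    unfolding saltus_function_def by (rule infsum_nonneg) auto
  show "saltus_function (\<lambda>\<phi>. norm (a \<phi>)) D t \<le> N"
    unfolding saltus_function_def
    by (rule norm_infsum_le_of_finite_sums(3)) (rule assms, auto)
qed

text \<open>The two constants of the final decomposition: the slope \<open>M\<close> and the total jump size \<open>N\<close>. Jumps lie
  in the open interval, so the saltus part vanishes at \<open>a\<close>, and \<open>b\<close> is excluded so that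
  neighbouring intervals can be joined by one further jump at their common end point.\<close>

definition lipschitz_plus_saltus ::
    "real \<Rightarrow> real \<Rightarrow> (real \<Rightarrow> 'b::banach) \<Rightarrow> real \<Rightarrow> real \<Rightarrow> bool"
  where "lipschitz_plus_saltus M N f a b \<longleftrightarrow>
    (\<exists>D j g. D \<subseteq> {a<..<b} \<and> (\<forall>F. finite F \<longrightarrow> F \<subseteq> D \<longrightarrow> (\<Sum>x\<in>F. norm (j x)) \<le> N) \<and>
      M-lipschitz_on {a..<b} g \<and> (\<forall>\<theta>\<in>{a..<b}. f \<theta> = g \<theta> + saltus_function j D \<theta>))"

lemma saltus_function_glue:
  fixes j1 j2 :: "real \<Rightarrow> 'b::banach"
  assumes D: "D1 \<subseteq> {a<..<b}" "D2 \<subseteq> {b<..<c}" and "a < b"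
    and summ: "j1 abs_summable_on D1" "j2 abs_summable_on D2"
    and j: "\<And>x. x < b \<Longrightarrow> j x = j1 x" "\<And>x. x > b \<Longrightarrow> j x = j2 x"
  shows "\<theta> < b \<Longrightarrow> saltus_function j (D1 \<union> {b} \<union> D2) \<theta> = saltus_function j1 D1 \<theta>"
    "b \<le> \<theta> \<Longrightarrow> saltus_function j (D1 \<union> {b} \<union> D2) \<theta>
      = infsum j1 D1 + j b + saltus_function j2 D2 \<theta>"
proof -
  assume "\<theta> < b"
  then show "saltus_function j (D1 \<union> {b} \<union> D2) \<theta> = saltus_function j1 D1 \<theta>"
    unfolding saltus_function_def using D by (intro infsum_cong_neutral) (auto simp: j)
next
  assume "b \<le> \<theta>"
  define X where "X = {\<phi>\<in>D2. \<phi> \<le> \<theta>}"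
  have "j summable_on D1" 
    using abs_summable_summable[OF summ(1)] by (subst summable_on_cong[of _ _ j1]) (use D j in auto)
  moreover have "j summable_on X"
    using abs_summable_summable[OF summ(2)]
    by (subst summable_on_cong[of _ _ j2]) (use D j in \<open>auto simp: X_def intro: summable_on_subset_banach\<close>)
  moreover have "D1 \<inter> {b} = {}" "(D1 \<union> {b}) \<inter> X = {}" using D by (auto simp: X_def, force)
  ultimately have "infsum j ((D1 \<union> {b}) \<union> X) = infsum j (D1 \<union> {b}) + infsum j X"
    by (intro infsum_Un_disjoint summable_on_Un_disjoint) auto
  also have "infsum j (D1 \<union> {b}) = infsum j D1 + infsum j {b}"
    using \<open>j summable_on D1\<close> \<open>D1 \<inter> {b} = {}\<close> by (intro infsum_Un_disjoint) auto
  also have "infsum j {b} = j b" by simp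
  also have "infsum j D1 = infsum j1 D1" using D j by (intro infsum_cong) auto
  also have "infsum j X = infsum j2 X" using D j by (intro infsum_cong) (auto simp: X_def)
  also have "D1 \<union> {b} \<union> X = {\<phi> \<in> D1 \<union> {b} \<union> D2. \<phi> \<le> \<theta>}"
    using D \<open>b \<le> \<theta>\<close> by (auto simp: X_def)
  finally show "saltus_function j (D1 \<union> {b} \<union> D2) \<theta>
      = infsum j1 D1 + j b + saltus_function j2 D2 \<theta>"
    by (simp add: saltus_function_def X_def)
qed

text \<open>Joining two intervals does not increase the slope \<open>M\<close>; it only costs one jump, at \<open>b\<close>, whose size
  is bounded by the increment of \<open>f\<close> from \<open>a\<close> to \<open>b\<close> and the variation in between.\<close>

lemma lipschitz_plus_saltus_glue:
  fixes f :: "real \<Rightarrow> 'b::banach"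
  assumes left: "lipschitz_plus_saltus M N1 f a b" and right: "lipschitz_plus_saltus M N2 f b c"
    and "a < b" "b < c" and bnd: "\<And>x. norm (f x) \<le> R"
  shows "lipschitz_plus_saltus M (2 * N1 + N2 + 2 * R + M * (b - a)) f a c"
proof -
  obtain D1 j1 g1 where 1: "D1 \<subseteq> {a<..<b}"
      "\<And>F. finite F \<Longrightarrow> F \<subseteq> D1 \<Longrightarrow> (\<Sum>x\<in>F. norm (j1 x)) \<le> N1"
      "M-lipschitz_on {a..<b} g1" "\<And>\<theta>. \<theta> \<in> {a..<b} \<Longrightarrow> f \<theta> = g1 \<theta> + saltus_function j1 D1 \<theta>"
    using left unfolding lipschitz_plus_saltus_def by metis
  obtain D2 j2 g2 where 2: "D2 \<subseteq> {b<..<c}"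
      "\<And>F. finite F \<Longrightarrow> F \<subseteq> D2 \<Longrightarrow> (\<Sum>x\<in>F. norm (j2 x)) \<le> N2"
      "M-lipschitz_on {b..<c} g2" "\<And>\<theta>. \<theta> \<in> {b..<c} \<Longrightarrow> f \<theta> = g2 \<theta> + saltus_function j2 D2 \<theta>"
    using right unfolding lipschitz_plus_saltus_def by metis
  note s1 = norm_infsum_le_of_finite_sums[of D1 j1, OF 1(2)]
  note s2 = norm_infsum_le_of_finite_sums[of D2 j2, OF 2(2)]
  have M0: "0 \<le> M" using 1(3) by (rule lipschitz_on_nonneg)
  have N0: "0 \<le> N1" "0 \<le> N2" using 1(2)[of "{}"] 2(2)[of "{}"] by auto
  obtain l where l: "(g1 \<longlongrightarrow> l) (at b within {a..<b})"
    using uniformly_continuous_on_extension_at_closure[OF lipschitz_on_uniformly_continuous[OF 1(3)], of b]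
      \<open>a < b\<close> by auto
  have near: "norm (l - g1 s) \<le> M * (b - s)" if "s \<in> {a..<b}" for s
  proof (rule tendsto_le)
    show "at b within {a..<b} \<noteq> bot"
      using \<open>a < b\<close> by (simp add: trivial_limit_within islimpt_Ico)
    show "((\<lambda>t. norm (g1 t - g1 s)) \<longlongrightarrow> norm (l - g1 s)) (at b within {a..<b})"
      by (intro tendsto_intros l)
    show "((\<lambda>t. M * (\<bar>t - s\<bar>)) \<longlongrightarrow> M * (b - s)) (at b within {a..<b})"
      using that by (auto intro!: tendsto_eq_intros)
    show "\<forall>\<^sub>F t in at b within {a..<b}. norm (g1 t - g1 s) \<le> M * \<bar>t - s\<bar>"
      using lipschitz_onD[OF 1(3) _ that] by (auto simp: eventually_at_filter dist_norm)
  qed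
  \<comment> \<open>The jump at \<open>b\<close> is whatever makes the Lipschitz part continuous there.\<close>
  define D where "D = D1 \<union> {b} \<union> D2"
  define j where "j x = (if x < b then j1 x else if x = b then f b - l - infsum j1 D1 else j2 x)" for x
  define g where "g x = (if x < b then g1 x else g2 x - g2 b + l)" for x
  have glue: "\<theta> < b \<Longrightarrow> saltus_function j D \<theta> = saltus_function j1 D1 \<theta>"
    "b \<le> \<theta> \<Longrightarrow> saltus_function j D \<theta> = infsum j1 D1 + j b + saltus_function j2 D2 \<theta>" for \<theta>
    unfolding D_def by (rule saltus_function_glue[OF 1(1) 2(1) \<open>a < b\<close> s1(1) s2(1)]; simp add: j_def)+
  have sa: "saltus_function j1 D1 a = 0" unfolding saltus_function_def
    using 1(1) by (intro infsum_0) auto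
  have sb: "saltus_function j2 D2 b = 0" unfolding saltus_function_def
    using 2(1) by (intro infsum_0) auto
  have jb: "norm (j b) \<le> 2 * R + M * (b - a) + N1"
  proof -
    have "j b = f b - f a - (l - g1 a) - infsum j1 D1"
      using 1(4)[of a] \<open>a < b\<close> sa by (simp add: j_def)
    also have "norm \<dots> \<le> norm (f b) + norm (f a) + norm (l - g1 a) + norm (infsum j1 D1)"
      by (meson norm_triangle_ineq4 order_trans add_mono order_refl)
    finally show ?thesis using bnd[of a] bnd[of b] near[of a] s1(2) \<open>a < b\<close> by auto
  qed
  have "(\<Sum>x\<in>F. norm (j x)) \<le> 2 * N1 + N2 + 2 * R + M * (b - a)" if F: "finite F" "F \<subseteq> D" for F
  proof -
    have "(\<Sum>x\<in>F. norm (j x)) \<le> (\<Sum>x\<in>(F \<inter> D1) \<union> {b} \<union> (F \<inter> D2). norm (j x))"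
      using F by (intro sum_mono2) (auto simp: D_def)
    also have "\<dots> = (\<Sum>x\<in>(F \<inter> D1) \<union> {b}. norm (j x)) + (\<Sum>x\<in>F \<inter> D2. norm (j x))"
      using F 1(1) 2(1) by (intro sum.union_disjoint) (auto, force)
    also have "(\<Sum>x\<in>(F \<inter> D1) \<union> {b}. norm (j x)) = (\<Sum>x\<in>F \<inter> D1. norm (j x)) + (\<Sum>x\<in>{b}. norm (j x))"
      using F 1(1) by (intro sum.union_disjoint) auto
    also have "(\<Sum>x\<in>F \<inter> D1. norm (j x)) = (\<Sum>x\<in>F \<inter> D1. norm (j1 x))"
      using 1(1) by (intro sum.cong) (auto simp: j_def)
    also have "(\<Sum>x\<in>F \<inter> D2. norm (j x)) = (\<Sum>x\<in>F \<inter> D2. norm (j2 x))"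
      using 2(1) by (intro sum.cong) (auto simp: j_def)
    finally show ?thesis using 1(2)[of "F \<inter> D1"] 2(2)[of "F \<inter> D2"] F jb by simp
  qed
  moreover have "M-lipschitz_on {a..<c} g"
  proof (rule lipschitz_onI)
    have ordered: "dist (g s) (g t) \<le> M * (t - s)" if "s \<in> {a..<c}" "t \<in> {a..<c}" "s \<le> t" for s t
    proof -
      consider "t < b" | "b \<le> s" | "s < b" "b \<le> t" by linarith
      then show ?thesis
      proof cases
        case 1
        then show ?thesis using that lipschitz_onD[OF \<open>M-lipschitz_on {a..<b} g1\<close>, of s t]
          by (auto simp: g_def dist_real_def)
      next
        case 2
        then show ?thesis using that lipschitz_onD[OF \<open>M-lipschitz_on {b..<c} g2\<close>, of s t]
          by (auto simp: g_def dist_norm)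
      next
        case 3
        have "g t - g s = (g2 t - g2 b) + (l - g1 s)" using 3 by (simp add: g_def)
        then have "norm (g t - g s) \<le> norm (g2 t - g2 b) + norm (l - g1 s)"
          by (metis norm_triangle_ineq)
        also have "\<dots> \<le> M * (t - b) + M * (b - s)"
          using near[of s] 3 that lipschitz_onD[OF \<open>M-lipschitz_on {b..<c} g2\<close>, of t b]
          by (intro add_mono) (auto simp: dist_norm)
        finally show ?thesis by (simp add: dist_norm norm_minus_commute algebra_simps)
      qed
    qed
    fix s t assume "s \<in> {a..<c}" "t \<in> {a..<c}"
    then show "dist (g s) (g t) \<le> M * dist s t"
      using ordered[of s t] ordered[of t s] by (cases "s \<le> t") (auto simp: dist_real_def dist_commute)
  qed (rule M0)
  moreover have "f \<theta> = g \<theta> + saltus_function j D \<theta>" if "\<theta> \<in> {a..<c}" for \<theta>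
  proof (cases "\<theta> < b")
    case True
    then show ?thesis using 1(4) that by (simp add: glue g_def)
  next
    case False
    then show ?thesis using 2(4)[of \<theta>] 2(4)[of b] that \<open>b < c\<close> sb by (simp add: glue g_def j_def)
  qed
  moreover have "D \<subseteq> {a<..<c}"
    using 1(1) 2(1) \<open>a < b\<close> \<open>b < c\<close> by (auto simp: D_def)
  ultimately show ?thesis unfolding lipschitz_plus_saltus_def by blast
qed

lemma lipschitz_plus_saltus_mono:
  assumes "lipschitz_plus_saltus M N f a b" "M \<le> M'" "N \<le> N'"
  shows "lipschitz_plus_saltus M' N' f a b"
proof -
  obtain D j g where *: "D \<subseteq> {a<..<b}"
      "\<And>F. finite F \<Longrightarrow> F \<subseteq> D \<Longrightarrow> (\<Sum>x\<in>F. norm (j x)) \<le> N"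
      "M-lipschitz_on {a..<b} g" "\<forall>\<theta>\<in>{a..<b}. f \<theta> = g \<theta> + saltus_function j D \<theta>"
    using assms(1) unfolding lipschitz_plus_saltus_def by metis
  have "M'-lipschitz_on {a..<b} g" using lipschitz_on_mono[OF *(3)] assms(2) by auto
  moreover have "\<forall>F. finite F \<longrightarrow> F \<subseteq> D \<longrightarrow> (\<Sum>x\<in>F. norm (j x)) \<le> N'"
    using *(2) assms(3) by (meson order_trans)
  ultimately show ?thesis unfolding lipschitz_plus_saltus_def using * by blast
qed

lemma saltus_on_saltus_function:
  fixes a :: "real \<Rightarrow> 'b::banach"
  assumes "(\<lambda>x. norm (a x)) summable_on D" "D \<subseteq> A"
  shows "saltus_on A (saltus_function a D)"
proof -
  define D' where "D' = {x\<in>D. a x \<noteq> 0}"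
  have "countable D'" unfolding D'_def using assms(1) by (rule abs_summable_countable)
  moreover have "(\<lambda>x. norm (a x)) summable_on D'"
    using assms(1) by (rule summable_on_subset_banach) (auto simp: D'_def)
  moreover have "saltus_function a D \<theta> = (\<Sum>\<^sub>\<infinity>\<phi>\<in>{\<phi>\<in>D'. \<phi> \<le> \<theta>}. a \<phi>)" for \<theta>
    unfolding saltus_function_def by (intro infsum_cong_neutral) (auto simp: D'_def)
  ultimately show ?thesis unfolding saltus_on_def using assms(2)
    by (intro exI[of _ D'] exI[of _ a]) (auto simp: D'_def)
qed

lemma saltus_on_cong:
  assumes "saltus_on A f" "\<And>x. x \<in> A \<Longrightarrow> f x = g x"
  shows "saltus_on A g"
  using assms unfolding saltus_on_def by metis

text \<open>Coefficients extended by zero allow all saltus functions on \<open>A\<close> to be indexed by \<open>A\<close> itself, which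
  makes them a vector space; countability is recovered from summability.\<close>

lemma saltus_on_iff:
  fixes f :: "real \<Rightarrow> 'b::banach"
  shows "saltus_on A f \<longleftrightarrow> (\<exists>a. (\<lambda>x. norm (a x)) summable_on A \<and> (\<forall>\<theta>\<in>A. f \<theta> = saltus_function a A \<theta>))"
proof
  assume "saltus_on A f"
  then obtain D a where D: "D \<subseteq> A" "(\<lambda>x. norm (a x)) summable_on D"
      "\<And>\<theta>. \<theta> \<in> A \<Longrightarrow> f \<theta> = (\<Sum>\<^sub>\<infinity>\<phi>\<in>{\<phi>\<in>D. \<phi> \<le> \<theta>}. a \<phi>)"
    unfolding saltus_on_def by blast
  define a' where "a' x = (if x \<in> D then a x else 0)" for x
  have "(\<lambda>x. norm (a' x)) summable_on A \<longleftrightarrow> (\<lambda>x. norm (a x)) summable_on D"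
    using D(1) by (intro summable_on_cong_neutral) (auto simp: a'_def)
  moreover have "saltus_function a' A \<theta> = (\<Sum>\<^sub>\<infinity>\<phi>\<in>{\<phi>\<in>D. \<phi> \<le> \<theta>}. a \<phi>)" for \<theta>
    unfolding saltus_function_def using D(1) by (intro infsum_cong_neutral) (auto simp: a'_def)
  ultimately show "\<exists>a. (\<lambda>x. norm (a x)) summable_on A \<and> (\<forall>\<theta>\<in>A. f \<theta> = saltus_function a A \<theta>)"
    using D by (intro exI[of _ a']) auto
next
  assume "\<exists>a. (\<lambda>x. norm (a x)) summable_on A \<and> (\<forall>\<theta>\<in>A. f \<theta> = saltus_function a A \<theta>)"
  then show "saltus_on A f"
    using saltus_on_cong[OF saltus_on_saltus_function[OF _ order_refl]] by metis
qed

lemma saltus_on_diff: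
  fixes f g :: "real \<Rightarrow> 'b::banach"
  assumes "saltus_on A f" "saltus_on A g"
  shows "saltus_on A (\<lambda>x. f x - g x)"
proof -
  obtain a b where ab: "(\<lambda>x. norm (a x)) summable_on A" "\<And>\<theta>. \<theta> \<in> A \<Longrightarrow> f \<theta> = saltus_function a A \<theta>"
      "(\<lambda>x. norm (b x)) summable_on A" "\<And>\<theta>. \<theta> \<in> A \<Longrightarrow> g \<theta> = saltus_function b A \<theta>"
    using assms unfolding saltus_on_iff by blast
  have sub: "a summable_on {\<phi>\<in>A. \<phi> \<le> \<theta>}" "b summable_on {\<phi>\<in>A. \<phi> \<le> \<theta>}" for \<theta>
    using abs_summable_summable[OF ab(1)] abs_summable_summable[OF ab(3)]
    by (auto intro: summable_on_subset_banach)
  have "(\<lambda>x. norm (a x - b x)) summable_on A"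
  proof (rule Infinite_Sum.abs_summable_on_comparison_test[where g = "\<lambda>x. norm (a x) + norm (b x)"])
    show "(\<lambda>x. norm (norm (a x) + norm (b x))) summable_on A"
      using summable_on_add[OF ab(1,3)] by simp
  qed (simp add: norm_triangle_ineq4)
  moreover have "f \<theta> - g \<theta> = saltus_function (\<lambda>x. a x - b x) A \<theta>" if "\<theta> \<in> A" for \<theta>
    using that sub unfolding ab(2)[OF that] ab(4)[OF that] saltus_function_def
    using infsum_add[of a "{\<phi>\<in>A. \<phi> \<le> \<theta>}" "\<lambda>x. - b x"] by (simp add: infsum_uminus summable_on_uminus)
  ultimately show ?thesis unfolding saltus_on_iff
    by (intro exI[of _ "\<lambda>x. a x - b x"]) simp
qed

text \<open>The jump at each interior point is the difference of the value and the left limit, since the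
  remaining terms just to the left form a small tail of an absolutely convergent sum.\<close>

lemma continuous_saltus_constant:
  fixes f :: "real \<Rightarrow> 'b::banach"
  assumes "saltus_on {l..<r} f" "continuous_on {l..<r} f"
  shows "f constant_on {l..<r}"
proof -
  obtain a where a: "(\<lambda>x. norm (a x)) summable_on {l..<r}"
      "\<And>\<theta>. \<theta> \<in> {l..<r} \<Longrightarrow> f \<theta> = saltus_function a {l..<r} \<theta>"
    using assms(1) unfolding saltus_on_iff by blast
  have summ: "a summable_on X" if "X \<subseteq> {l..<r}" for X
    using abs_summable_summable[OF a(1)] that by (rule summable_on_subset_banach)
  have zero: "a \<phi> = 0" if "l < \<phi>" "\<phi> < r" for \<phi>
  proof -
    have "norm (a \<phi>) \<le> e + e" if "e > 0" for e
    proof -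
      obtain F where F: "finite F" "F \<subseteq> {l..<r}"
          "dist (\<Sum>x\<in>F. norm (a x)) (infsum (\<lambda>x. norm (a x)) {l..<r}) \<le> e"
        using infsum_finite_approximation[OF a(1) \<open>e > 0\<close>] by blast
      have tail: "infsum (\<lambda>x. norm (a x)) ({l..<r} - F) \<le> e"
        using F infsum_Diff[OF a(1) summable_on_finite[OF F(1)] F(2)]
        by (simp add: dist_real_def infsum_finite)
      have "(f \<longlongrightarrow> f \<phi>) (at_left \<phi>)"
      proof -
        have "(f \<longlongrightarrow> f \<phi>) (at \<phi> within {l..<r})"
          using assms(2) \<open>l < \<phi>\<close> \<open>\<phi> < r\<close> by (auto simp: continuous_on_def)
        moreover have "at \<phi> within {l..<r} = at \<phi>"
          using \<open>l < \<phi>\<close> \<open>\<phi> < r\<close> by (intro at_within_interior) auto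
        ultimately show ?thesis by (auto intro: tendsto_within_subset)
      qed
      then have "\<forall>\<^sub>F t in at_left \<phi>. dist (f t) (f \<phi>) < e" using \<open>e > 0\<close> by (rule tendstoD)
      moreover have "\<forall>\<^sub>F t in at_left \<phi>. t \<in> {l<..<\<phi>}"
        using \<open>l < \<phi>\<close> by (rule eventually_at_left_real)
      moreover have "\<forall>\<^sub>F t in at_left \<phi>. \<forall>x\<in>F. x \<noteq> \<phi> \<longrightarrow> \<not> (t < x \<and> x < \<phi>)"
      proof (rule eventually_ball_finite[OF F(1)], rule ballI)
        fix x
        show "\<forall>\<^sub>F t in at_left \<phi>. x \<noteq> \<phi> \<longrightarrow> \<not> (t < x \<and> x < \<phi>)"
        proof (cases "x < \<phi>")
          case True
          then show ?thesis using eventually_at_left_real[OF True]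
            by (auto elim: eventually_mono)
        qed auto
      qed
      ultimately have "\<forall>\<^sub>F t in at_left \<phi>. dist (f t) (f \<phi>) < e \<and> t \<in> {l<..<\<phi>} \<and>
          (\<forall>x\<in>F. x \<noteq> \<phi> \<longrightarrow> \<not> (t < x \<and> x < \<phi>))"
        by eventually_elim auto
      then have "\<exists>t. dist (f t) (f \<phi>) < e \<and> t \<in> {l<..<\<phi>} \<and>
          (\<forall>x\<in>F. x \<noteq> \<phi> \<longrightarrow> \<not> (t < x \<and> x < \<phi>))"
        by (rule eventually_happens'[OF trivial_limit_at_left_real])
      then obtain t where t: "dist (f t) (f \<phi>) < e" "l < t" "t < \<phi>"
          "\<forall>x\<in>F. x \<noteq> \<phi> \<longrightarrow> \<not> (t < x \<and> x < \<phi>)"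
        by auto
      have "f \<phi> - f t = infsum a ({l..<r} \<inter> {t<..\<phi>})"
        using saltus_function_increment[OF a(1), of t \<phi>] t \<open>\<phi> < r\<close> a(2) by auto
      also have "{l..<r} \<inter> {t<..\<phi>} = {t<..<\<phi>} \<union> {\<phi>}" using t \<open>\<phi> < r\<close> by auto
      also have "infsum a \<dots> = infsum a {t<..<\<phi>} + infsum a {\<phi>}"
        using t \<open>\<phi> < r\<close> by (intro infsum_Un_disjoint summ) auto
      finally have eq: "a \<phi> = f \<phi> - f t - infsum a {t<..<\<phi>}" by simp
      have "norm (infsum a {t<..<\<phi>}) \<le> infsum (\<lambda>x. norm (a x)) {t<..<\<phi>}"
        using t \<open>\<phi> < r\<close> by (intro norm_infsum_bound summable_on_subset_banach[OF a(1)]) auto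
      also have "\<dots> \<le> infsum (\<lambda>x. norm (a x)) ({l..<r} - F)"
        using t \<open>\<phi> < r\<close> by (intro infsum_mono2 summable_on_subset_banach[OF a(1)]) auto
      finally have "norm (infsum a {t<..<\<phi>}) \<le> e" using tail by linarith
      then show ?thesis unfolding eq using t(1) norm_triangle_ineq4[of "f \<phi> - f t" "infsum a {t<..<\<phi>}"]
        by (simp add: dist_norm norm_minus_commute)
    qed
    from this[of "norm (a \<phi>) / 3"] show ?thesis by auto
  qed
  have "f \<theta> = a l" if "\<theta> \<in> {l..<r}" for \<theta>
  proof -
    have "f \<theta> = infsum a {l}" unfolding a(2)[OF that] saltus_function_def
      using that zero by (intro infsum_cong_neutral) (auto simp: order_less_le)
    then show ?thesis by simp
  qed
  then show ?thesis unfolding constant_on_def by blast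
qed

section \<open>Absolutely continuous functions\<close>

definition nonoverlapping_in :: "real set \<Rightarrow> (real \<times> real) set \<Rightarrow> bool"
  where "nonoverlapping_in A P \<longleftrightarrow> finite P \<and> (\<forall>(s, t)\<in>P. s \<le> t \<and> {s..t} \<subseteq> A) \<and>
    pairwise (\<lambda>(s, t) (s', t'). {s<..<t} \<inter> {s'<..<t'} = {}) P"

lemma absolutely_continuous_on_iff:
  fixes f :: "real \<Rightarrow> 'b::real_normed_vector"
  shows "absolutely_continuous_on A f \<longleftrightarrow> (\<forall>e>0. \<exists>d>0. \<forall>P. nonoverlapping_in A P \<and>
    (\<Sum>(s, t)\<in>P. t - s) < d \<longrightarrow> (\<Sum>(s, t)\<in>P. norm (f t - f s)) < e)"
  by (simp only: absolutely_continuous_on_def nonoverlapping_in_def conj_assoc)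

lemma absolutely_continuous_on_if_increments_le:
  fixes f :: "real \<Rightarrow> 'b::real_normed_vector" and g :: "real \<Rightarrow> 'c::real_normed_vector"
  assumes f: "absolutely_continuous_on A f" and "C \<ge> 0"
    and le: "\<And>s t. s \<in> A \<Longrightarrow> t \<in> A \<Longrightarrow> s \<le> t \<Longrightarrow> norm (g t - g s) \<le> norm (f t - f s) + C * (t - s)"
  shows "absolutely_continuous_on A g"
  unfolding absolutely_continuous_on_iff
proof (intro allI impI)
  fix e :: real assume "e > 0"
  then have "e / 2 > 0" by simp
  then obtain d where d: "d > 0" "\<And>P. nonoverlapping_in A P \<Longrightarrow> (\<Sum>(s, t)\<in>P. t - s) < d \<Longrightarrow>
      (\<Sum>(s, t)\<in>P. norm (f t - f s)) < e / 2"
    using f unfolding absolutely_continuous_on_iff by blast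
  define d' where "d' = min d (e / 2 / (C + 1))"
  have "(\<Sum>(s, t)\<in>P. norm (g t - g s)) < e"
    if P: "nonoverlapping_in A P" "(\<Sum>(s, t)\<in>P. t - s) < d'" for P
  proof -
    have "(\<Sum>(s, t)\<in>P. norm (g t - g s)) \<le> (\<Sum>(s, t)\<in>P. norm (f t - f s) + C * (t - s))"
    proof (rule sum_mono, clarify)
      fix s t assume "(s, t) \<in> P"
      then have "s \<le> t \<and> {s..t} \<subseteq> A" using P(1) unfolding nonoverlapping_in_def by fast
      then show "norm (g t - g s) \<le> norm (f t - f s) + C * (t - s)" by (intro le) auto
    qed
    also have "\<dots> = (\<Sum>(s, t)\<in>P. norm (f t - f s)) + C * (\<Sum>(s, t)\<in>P. t - s)"
      by (simp add: sum.distrib sum_distrib_left split_def)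
    also have "\<dots> < e / 2 + e / 2"
    proof (rule add_less_le_mono)
      show "(\<Sum>(s, t)\<in>P. norm (f t - f s)) < e / 2" using P by (intro d) (auto simp: d'_def)
      have "C * (\<Sum>(s, t)\<in>P. t - s) \<le> C * (e / 2 / (C + 1))"
        using P(2) \<open>C \<ge> 0\<close> by (intro mult_left_mono) (auto simp: d'_def)
      also have "\<dots> \<le> e / 2" using \<open>C \<ge> 0\<close> \<open>e > 0\<close> by (simp add: field_simps)
      finally show "C * (\<Sum>(s, t)\<in>P. t - s) \<le> e / 2" .
    qed
    finally show ?thesis by simp
  qed
  moreover have "d' > 0" using d(1) \<open>C \<ge> 0\<close> \<open>e > 0\<close> by (simp add: d'_def)
  ultimately show "\<exists>d>0. \<forall>P. nonoverlapping_in A P \<and> (\<Sum>(s, t)\<in>P. t - s) < d \<longrightarrow>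
      (\<Sum>(s, t)\<in>P. norm (g t - g s)) < e" by blast
qed

lemma lipschitz_on_imp_absolutely_continuous_on:
  fixes f :: "real \<Rightarrow> 'b::real_normed_vector"
  assumes "C-lipschitz_on A f"
  shows "absolutely_continuous_on A f"
proof (rule absolutely_continuous_on_if_increments_le)
  show "absolutely_continuous_on A (\<lambda>_. 0 :: real)"
    unfolding absolutely_continuous_on_iff by (auto intro: exI[of _ 1])
  show "norm (f t - f s) \<le> norm ((0::real) - 0) + C * (t - s)" if "s \<in> A" "t \<in> A" "s \<le> t" for s t
    using lipschitz_onD[OF assms that(2,1)] that(3) by (simp add: dist_norm)
qed (rule lipschitz_on_nonneg[OF assms])

text \<open>The argument is a direct one with a fine tagged division. Points of the exceptional set are tagged
  inside an open set of small measure, where absolute continuity makes the sum of increments small;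
  at all other tags the increments are small relative to the length of the cell.\<close>

lemma absolutely_continuous_deriv_zero_constant:
  fixes f :: "real \<Rightarrow> 'b::real_normed_vector"
  assumes ac: "absolutely_continuous_on {l..<r} f" and N: "N \<in> null_sets lebesgue"
    and der: "\<And>x. x \<in> {l..<r} - N \<Longrightarrow> (f has_vector_derivative 0) (at x within {l..<r})"
  shows "f constant_on {l..<r}"
proof -
  have main: "norm (f b - f a) \<le> e + e * (b - a)" if ab: "l \<le> a" "a \<le> b" "b < r" and "e > 0" for a b e
  proof -
    obtain d where d: "d > 0" and d_ac: "\<And>P. nonoverlapping_in {l..<r} P \<Longrightarrow>
        (\<Sum>(s, t)\<in>P. t - s) < d \<Longrightarrow> (\<Sum>(s, t)\<in>P. norm (f t - f s)) < e"
      using ac \<open>e > 0\<close> unfolding absolutely_continuous_on_iff by blast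
    obtain T where T: "open T" "N \<subseteq> T" "(T - N) \<in> lmeasurable" "emeasure lebesgue (T - N) < ennreal d"
      using sets_lebesgue_outer_open[of N d] N d by blast
    have eT: "emeasure lebesgue T < ennreal d"
    proof -
      have "emeasure lebesgue T = emeasure lebesgue (T - N)"
        using N T(1) by (intro emeasure_Diff_null_set[symmetric]) auto
      then show ?thesis using T by simp
    qed
    have "\<exists>\<eta>>0. \<forall>y\<in>{l..<r}. \<bar>y - x\<bar> < \<eta> \<longrightarrow> norm (f y - f x) \<le> e * \<bar>y - x\<bar>" if "x \<in> {l..<r} - N" for x
      using der[OF that] \<open>e > 0\<close> unfolding has_vector_derivative_def has_derivative_within_alt
      by auto
    then obtain \<eta> where \<eta>: "\<And>x. x \<in> {l..<r} - N \<Longrightarrow> \<eta> x > 0"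
        "\<And>x y. x \<in> {l..<r} - N \<Longrightarrow> y \<in> {l..<r} \<Longrightarrow> \<bar>y - x\<bar> < \<eta> x \<Longrightarrow> norm (f y - f x) \<le> e * \<bar>y - x\<bar>"
      by metis
    \<comment> \<open>Cells tagged in \<open>N\<close> have small total length; on all others \<open>f\<close> has slope at most \<open>e\<close>.\<close>
    define \<gamma> where "\<gamma> x = (if x \<in> N then T else if x \<in> {l..<r} then ball x (\<eta> x) else ball x 1)" for x
    have "gauge \<gamma>" unfolding gauge_def \<gamma>_def using T \<eta> by auto
    then obtain p where p: "p tagged_division_of {a..b}" "\<gamma> fine p"
      by (rule fine_division_exists_real)
    note pt = p(1)[unfolded tagged_division_of]
    have K: "\<exists>s t. K = {s..t} \<and> a \<le> s \<and> s \<le> x \<and> x \<le> t \<and> t \<le> b \<and> Inf K = s \<and> Sup K = t" if "(x, K) \<in> p" for x K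
    proof -
      have "x \<in> K" "K \<subseteq> {a..b}" "\<exists>c d. K = cbox c d" using pt that by blast+
      then obtain c d where "K = {c..d}" "x \<in> {c..d}" "{c..d} \<subseteq> {a..b}" by auto
      then show ?thesis by auto
    qed
    \<comment> \<open>Degenerate cells are dropped, so that a cell is determined by its end points.\<close>
    define pN where "pN = {(x, K)\<in>p. x \<in> N \<and> Inf K < Sup K}"
    have finp: "finite p" and finN: "finite pN" using pt finite_subset[of pN p] by (auto simp: pN_def)
    have disj: "interior K \<inter> interior K' = {}" if "(x, K) \<in> p" "(x', K') \<in> p" "(x, K) \<noteq> (x', K')" for x K x' K'
      using pt that by blast
    define h where "h = (\<lambda>(x::real, K::real set). (Inf K, Sup K))"
    have inj: "inj_on h pN"
    proof (rule inj_onI)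
      fix z z' assume z: "z \<in> pN" "z' \<in> pN" "h z = h z'"
      obtain x K x' K' where zz: "z = (x, K)" "z' = (x', K')" by (meson surj_pair)
      obtain s t where s: "K = {s..t}" "Inf K = s" "Sup K = t" using K[of x K] z zz by (auto simp: pN_def)
      obtain s' t' where s': "K' = {s'..t'}" "Inf K' = s'" "Sup K' = t'" using K[of x' K'] z zz by (auto simp: pN_def)
      have "s = s'" "t = t'" "s < t" using z zz s s' by (auto simp: h_def pN_def)
      show "z = z'"
      proof (rule ccontr)
        assume "z \<noteq> z'"
        then have "interior K \<inter> interior K' = {}" using disj[of x K x' K'] z zz by (auto simp: pN_def)
        then show False using s s' \<open>s = s'\<close> \<open>t = t'\<close> \<open>s < t\<close> by (auto simp: interior_atLeastAtMost_real)
      qed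
    qed
    have pw: "pairwise (\<lambda>(s, t) (s', t'). {s<..<t} \<inter> {s'<..<t'} = {}) (h ` pN)"
    proof (rule pairwiseI)
      fix y y' assume y: "y \<in> h ` pN" "y' \<in> h ` pN" "y \<noteq> y'"
      then obtain x K x' K' where z: "(x, K) \<in> pN" "(x', K') \<in> pN" "y = h (x, K)" "y' = h (x', K')" by auto
      then have "interior K \<inter> interior K' = {}" using disj[of x K x' K'] y by (auto simp: pN_def)
      moreover obtain s t where "K = {s..t}" "Inf K = s" "Sup K = t" using K[of x K] z by (auto simp: pN_def)
      moreover obtain s' t' where "K' = {s'..t'}" "Inf K' = s'" "Sup K' = t'" using K[of x' K'] z by (auto simp: pN_def)
      ultimately show "(case y of (s, t) \<Rightarrow> \<lambda>(s', t'). {s<..<t} \<inter> {s'<..<t'} = {}) y'"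
        using z by (auto simp: h_def interior_atLeastAtMost_real)
    qed
    have sum_h: "(\<Sum>(s, t)\<in>h ` pN. G s t) = (\<Sum>(x, K)\<in>pN. G (Inf K) (Sup K))" for G :: "real \<Rightarrow> real \<Rightarrow> real"
      by (subst sum.reindex[OF inj]) (simp add: h_def split_def)
    have "ennreal (\<Sum>(s, t)\<in>h ` pN. t - s) = (\<Sum>y\<in>h ` pN. ennreal (snd y - fst y))"
      by (subst sum_ennreal) (auto simp: h_def pN_def split_def)
    also have "\<dots> = (\<Sum>y\<in>h ` pN. emeasure lebesgue {fst y<..<snd y})"
      by (intro sum.cong refl) (auto simp: h_def pN_def)
    also have "\<dots> = emeasure lebesgue (\<Union>y\<in>h ` pN. {fst y<..<snd y})"
      using finN pw by (intro sum_emeasure) (auto simp: disjoint_family_on_def pairwise_def split_def)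
    also have "\<dots> \<le> emeasure lebesgue T"
    proof (rule emeasure_mono)
      show "(\<Union>y\<in>h ` pN. {fst y<..<snd y}) \<subseteq> T"
      proof (rule UN_least, rule subsetI)
        fix y z assume "y \<in> h ` pN" "z \<in> {fst y<..<snd y}"
        then obtain x K where xK: "(x, K) \<in> pN" and "fst (h (x, K)) < z" "z < snd (h (x, K))" by auto
        have xp: "(x, K) \<in> p" "x \<in> N" using xK by (auto simp: pN_def)
        obtain s t where "K = {s..t}" "Inf K = s" "Sup K = t" using K[OF xp(1)] by blast
        then have "z \<in> K"
          using \<open>fst (h (x, K)) < z\<close> \<open>z < snd (h (x, K))\<close> by (simp add: h_def)
        moreover have "K \<subseteq> \<gamma> x" using p(2) xp(1) by (rule fineD)
        ultimately show "z \<in> T" using xp(2) by (auto simp: \<gamma>_def)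
      qed
    qed (use T in auto)
    finally have "ennreal (\<Sum>(s, t)\<in>h ` pN. t - s) < ennreal d" using eT by simp
    then have "(\<Sum>(s, t)\<in>h ` pN. t - s) < d" by (rule ennreal_less_iff[THEN iffD1, rotated])
      (auto intro!: sum_nonneg simp: h_def pN_def)
    moreover have "\<forall>(s, t)\<in>h ` pN. s \<le> t \<and> {s..t} \<subseteq> {l..<r}"
    proof (rule ballI)
      fix y assume "y \<in> h ` pN"
      then obtain x K where y: "y = h (x, K)" and "(x, K) \<in> p" by (auto simp: pN_def)
      then obtain s t where st: "a \<le> s" "s \<le> x" "x \<le> t" "t \<le> b" "Inf K = s" "Sup K = t"
        using K by blast
      then show "case y of (s, t) \<Rightarrow> s \<le> t \<and> {s..t} \<subseteq> {l..<r}" using ab by (auto simp: y h_def)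
    qed
    ultimately have "(\<Sum>(s, t)\<in>h ` pN. norm (f t - f s)) < e"
      using finN pw by (intro d_ac) (auto simp: nonoverlapping_in_def)
    then have N_part: "(\<Sum>(x, K)\<in>pN. norm (f (Sup K) - f (Inf K))) < e" by (simp add: sum_h)
    let ?v = "\<lambda>z. norm (f (Sup (snd z)) - f (Inf (snd z)))"
    have "norm (f b - f a) = norm (\<Sum>(x, K)\<in>p. f (Sup K) - f (Inf K))"
      using additive_tagged_division_1[OF \<open>a \<le> b\<close> p(1), of f] by simp
    also have "\<dots> \<le> (\<Sum>(x, K)\<in>p. norm (f (Sup K) - f (Inf K)))"
      using norm_sum[of "\<lambda>z. f (Sup (snd z)) - f (Inf (snd z))" p] by (simp add: split_def)
    also have "\<dots> \<le> (\<Sum>z\<in>p. (if z \<in> pN then ?v z else 0) + e * (Sup (snd z) - Inf (snd z)))"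
      unfolding split_def
    proof (rule sum_mono)
      fix z assume "z \<in> p"
      obtain x K where z: "z = (x, K)" by (meson surj_pair)
      obtain s t where st: "K = {s..t}" "a \<le> s" "s \<le> x" "x \<le> t" "t \<le> b" "Inf K = s" "Sup K = t"
        using K[of x K] \<open>z \<in> p\<close> z by blast
      show "?v z \<le> (if z \<in> pN then ?v z else 0) + e * (Sup (snd z) - Inf (snd z))"
      proof (cases "x \<in> N")
        case True
        show ?thesis
        proof (cases "s < t")
          case True
          then show ?thesis using z st \<open>x \<in> N\<close> \<open>z \<in> p\<close> \<open>e > 0\<close> by (auto simp: pN_def)
        next
          case False
          then have "s = t" using st by simp
          then show ?thesis using z st by auto
        qed
      next
        case False
        then have x: "x \<in> {l..<r} - N" using st ab by auto
        have "K \<subseteq> \<gamma> x" using p(2) \<open>z \<in> p\<close> z by (auto intro: fineD)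
        then have "K \<subseteq> ball x (\<eta> x)" using x by (simp add: \<gamma>_def)
        moreover have "s \<in> K" "t \<in> K" using st by auto
        ultimately have "\<bar>s - x\<bar> < \<eta> x" "\<bar>t - x\<bar> < \<eta> x" by (auto simp: dist_real_def)
        then have "norm (f s - f x) \<le> e * (x - s)" "norm (f t - f x) \<le> e * (t - x)"
          using \<eta>(2)[OF x, of s] \<eta>(2)[OF x, of t] st ab by auto
        then have "norm (f t - f s) \<le> e * (t - s)"
          using norm_triangle_ineq4[of "f t - f x" "f s - f x"] by (simp add: algebra_simps)
        then show ?thesis using z st False by (auto simp: pN_def)
      qed
    qed
    also have "\<dots> = (\<Sum>z\<in>p. if z \<in> pN then ?v z else 0)
        + e * (\<Sum>z\<in>p. Sup (snd z) - Inf (snd z))"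
      by (simp add: sum.distrib sum_distrib_left)
    also have "(\<Sum>z\<in>p. Sup (snd z) - Inf (snd z)) = b - a"
      using additive_tagged_division_1[OF \<open>a \<le> b\<close> p(1), of "\<lambda>x. x"] by (simp add: split_def)
    also have "(\<Sum>z\<in>p. if z \<in> pN then ?v z else 0)
        = (\<Sum>z\<in>pN. ?v z)"
      using finp by (intro sum.mono_neutral_cong_right) (auto simp: pN_def)
    finally show ?thesis using N_part by (simp add: split_def)
  qed
  have eq: "f b = f a" if ab: "l \<le> a" "a \<le> b" "b < r" for a b
  proof -
    have "norm (f b - f a) \<le> 0"
    proof (rule field_le_epsilon)
      fix e :: real assume "e > 0"
      define q where "q = 1 + (b - a)"
      have "q > 0" using ab by (simp add: q_def)
      have "norm (f b - f a) \<le> e / q + e / q * (b - a)"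
        using \<open>e > 0\<close> \<open>q > 0\<close> by (intro main ab) simp
      also have "\<dots> = e / q * q" by (simp add: q_def distrib_left)
      finally show "norm (f b - f a) \<le> 0 + e" using \<open>q > 0\<close> by simp
    qed
    then show ?thesis by simp
  qed
  show ?thesis unfolding constant_on_def
  proof (intro exI[of _ "f l"] ballI)
    fix x assume "x \<in> {l..<r}" then show "f x = f l" using eq[of l x] by auto
  qed
qed

lemma absolutely_continuous_on_imp_continuous_on:
  fixes f :: "real \<Rightarrow> 'b::real_normed_vector"
  assumes "absolutely_continuous_on {l..<r} f"
  shows "continuous_on {l..<r} f"
  unfolding continuous_on_iff
proof (intro ballI allI impI)
  fix x e :: real assume x: "x \<in> {l..<r}" and "e > 0"
  obtain d where d: "d > 0" and d_ac: "\<And>P. nonoverlapping_in {l..<r} P \<Longrightarrow>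
      (\<Sum>(s, t)\<in>P. t - s) < d \<Longrightarrow> (\<Sum>(s, t)\<in>P. norm (f t - f s)) < e"
    using assms \<open>e > 0\<close> unfolding absolutely_continuous_on_iff by blast
  have "dist (f y) (f x) < e" if "y \<in> {l..<r}" "dist y x < d" for y
  proof (cases "x \<le> y")
    case True
    then show ?thesis using d_ac[of "{(x, y)}"] that x subsetI[of "{x..y}" "{l..<r}"]
      by (force simp: nonoverlapping_in_def dist_real_def dist_norm)
  next
    case False
    then show ?thesis using d_ac[of "{(y, x)}"] that x subsetI[of "{y..x}" "{l..<r}"]
      by (force simp: nonoverlapping_in_def dist_real_def dist_norm norm_minus_commute)
  qed
  then show "\<exists>d>0. \<forall>x'\<in>{l..<r}. dist x' x < d \<longrightarrow> dist (f x') (f x) < e" using d by blast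
qed

lemma bounded_variation_if_total_variation_le:
  assumes "total_variation A f \<le> ennreal M"
  shows "bounded_variation_on A f"
  using assms unfolding bounded_variation_on_def by (simp add: order_le_less_trans)

text \<open>Everything that is claimed about the flow is a consequence of one quantitative decomposition. For
  an arbitrary decomposition into absolutely continuous, jump and Cantor parts, comparison with the
  given one first identifies the jump parts up to a constant; then the Cantor part is absolutely
  continuous with zero derivative almost everywhere, so it is constant too.\<close>

theorem lipschitz_plus_saltus_consequences:
  fixes f :: "real \<Rightarrow> 'b::banach"
  assumes dec: "lipschitz_plus_saltus M N f l r" and "l < r" and "M \<le> M'" and "N \<le> M'"
  shows "bounded_variation_on {l..<r} f \<and>
      (\<exists>f\<^sub>L f\<^sub>S.
        (\<forall>\<theta>\<in>{l..<r}. f \<theta> = f\<^sub>L \<theta> + f\<^sub>S \<theta>) \<and>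
        M'-lipschitz_on {l..<r} f\<^sub>L \<and>
        saltus_on {l..<r} f\<^sub>S \<and>
        bounded_variation_on {l..<r} f\<^sub>S \<and>
        total_variation {l..<r} f\<^sub>S \<le> ennreal M') \<and>
      special_bounded_variation_on {l..<r} f \<and>
      (\<forall>f\<^sub>a f\<^sub>j f\<^sub>c. bv_decomposition {l..<r} f f\<^sub>a f\<^sub>j f\<^sub>c \<longrightarrow>
        (\<exists>L. L-lipschitz_on {l..<r} f\<^sub>a))"
proof -
  let ?A = "{l..<r}"
  obtain D j g where D: "D \<subseteq> {l<..<r}"
      "\<And>F. finite F \<Longrightarrow> F \<subseteq> D \<Longrightarrow> (\<Sum>x\<in>F. norm (j x)) \<le> N"
      "M-lipschitz_on ?A g" "\<And>\<theta>. \<theta> \<in> ?A \<Longrightarrow> f \<theta> = g \<theta> + saltus_function j D \<theta>"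
    using dec unfolding lipschitz_plus_saltus_def by metis
  note summ = norm_infsum_le_of_finite_sums[of D j, OF D(2)]
  let ?S = "saltus_function j D" and ?T = "saltus_function (\<lambda>x. norm (j x)) D"
  have saltus: "saltus_on ?A ?S"
    using D(1) by (intro saltus_on_saltus_function summ(1)) auto
  have N0: "0 \<le> N" using D(2)[of "{}"] by simp
  have M0: "0 \<le> M" using D(3) by (rule lipschitz_on_nonneg)
  have tvS: "total_variation ?A ?S \<le> ennreal (N - 0)"
    by (rule total_variation_le[where \<mu> = "?T"])
      (use saltus_function_increment_norm[OF summ(1)] saltus_function_norm_bounds[of D j, OF D(2)] N0 in auto)
  then have bvS: "bounded_variation_on ?A ?S" by (rule bounded_variation_if_total_variation_le)
  have lipg: "norm (g t - g s) \<le> M * t - M * s" if "s \<in> ?A" "t \<in> ?A" "s \<le> t" for s t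
    using lipschitz_onD[OF D(3) that(2,1)] that(3) by (simp add: dist_norm algebra_simps)
  have "total_variation ?A f \<le> ennreal ((M * r + N) - M * l)"
  proof (rule total_variation_le[where \<mu> = "\<lambda>\<theta>. M * \<theta> + ?T \<theta>"])
    fix s t assume st: "s \<in> ?A" "t \<in> ?A" "s \<le> t"
    have "norm (f t - f s) = norm ((g t - g s) + (?S t - ?S s))" using D(4) st by (simp add: algebra_simps)
    also have "\<dots> \<le> norm (g t - g s) + norm (?S t - ?S s)" by (rule norm_triangle_ineq)
    finally show "norm (f t - f s) \<le> M * t + ?T t - (M * s + ?T s)"
      using lipg[OF st] saltus_function_increment_norm[OF summ(1) st(3)] by linarith
  next
    fix s assume "s \<in> ?A"
    then have "M * l \<le> M * s" "M * s \<le> M * r" using M0 by (auto intro: mult_left_mono)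
    then show "M * l \<le> M * s + ?T s \<and> M * s + ?T s \<le> M * r + N"
      using saltus_function_norm_bounds[of D j N s, OF D(2)] by linarith
  next
    show "M * l \<le> M * r + N" using mult_left_mono[OF _ M0, of l r] \<open>l < r\<close> N0 by linarith
  qed
  then have bv: "bounded_variation_on ?A f" by (rule bounded_variation_if_total_variation_le)
  have trivial_dec: "bv_decomposition ?A f g ?S (\<lambda>_. 0)"
  proof -
    have "total_variation ?A (\<lambda>_. 0::'b) \<le> ennreal (0 - 0)"
      by (rule total_variation_le[where \<mu> = "\<lambda>_. 0"]) auto
    then have "bounded_variation_on ?A (\<lambda>_. 0::'b)" by (rule bounded_variation_if_total_variation_le)
    then have "cantor_type_on ?A (\<lambda>_. 0::'b)" unfolding cantor_type_on_def
      by (auto intro!: bexI[of _ "{}"])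
    then show ?thesis
      unfolding bv_decomposition_def
      using D(4) lipschitz_on_imp_absolutely_continuous_on[OF D(3)] saltus by auto
  qed
  have any_dec: "f\<^sub>c constant_on ?A \<and> M-lipschitz_on ?A f\<^sub>a" if "bv_decomposition ?A f f\<^sub>a f\<^sub>j f\<^sub>c" for f\<^sub>a f\<^sub>j f\<^sub>c
  proof -
    have dec: "\<And>x. x \<in> ?A \<Longrightarrow> f x = f\<^sub>a x + f\<^sub>j x + f\<^sub>c x" "absolutely_continuous_on ?A f\<^sub>a"
        "saltus_on ?A f\<^sub>j" "continuous_on ?A f\<^sub>c"
        "\<exists>Z \<in> null_sets lebesgue. \<forall>x \<in> ?A - Z. (f\<^sub>c has_vector_derivative 0) (at x within ?A)"
      using that unfolding bv_decomposition_def cantor_type_on_def by auto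
    \<comment> \<open>The two jump parts differ by a continuous saltus function, hence by a constant.\<close>
    have "continuous_on ?A (\<lambda>x. g x - f\<^sub>a x - f\<^sub>c x)"
      using lipschitz_on_continuous_on[OF D(3)] absolutely_continuous_on_imp_continuous_on[OF dec(2)] dec(4)
      by (intro continuous_intros)
    moreover have "g x - f\<^sub>a x - f\<^sub>c x = f\<^sub>j x - ?S x" if "x \<in> ?A" for x
    proof -
      have "f\<^sub>a x + f\<^sub>j x + f\<^sub>c x = g x + ?S x" using dec(1)[OF that] D(4)[OF that] by simp
      then show ?thesis by (simp add: algebra_simps)
    qed
    ultimately have "continuous_on ?A (\<lambda>x. f\<^sub>j x - ?S x)" by (rule continuous_on_eq)
    then obtain k where k: "\<And>x. x \<in> ?A \<Longrightarrow> f\<^sub>j x - ?S x = k"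
      using continuous_saltus_constant[OF saltus_on_diff[OF dec(3) saltus]] unfolding constant_on_def by blast
    have fc: "(g x - k) - f\<^sub>a x = f\<^sub>c x" if "x \<in> ?A" for x
      using k[OF that] dec(1)[OF that] D(4)[OF that] by (auto simp: algebra_simps)
    have "absolutely_continuous_on ?A f\<^sub>c"
    proof (rule absolutely_continuous_on_if_increments_le[OF dec(2) M0])
      fix s t assume st: "s \<in> ?A" "t \<in> ?A" "s \<le> t"
      have eq: "f\<^sub>c t - f\<^sub>c s = (g t - g s) - (f\<^sub>a t - f\<^sub>a s)"
        using fc[OF st(1)] fc[OF st(2)] by (auto simp: algebra_simps)
      show "norm (f\<^sub>c t - f\<^sub>c s) \<le> norm (f\<^sub>a t - f\<^sub>a s) + M * (t - s)"
        unfolding eq right_diff_distrib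
        using norm_triangle_ineq4[of "g t - g s" "f\<^sub>a t - f\<^sub>a s"] lipg[OF st] by linarith
    qed
    then have const: "f\<^sub>c constant_on ?A"
      using dec(5) absolutely_continuous_deriv_zero_constant by blast
    then obtain k' where k': "\<And>x. x \<in> ?A \<Longrightarrow> f\<^sub>c x = k'" unfolding constant_on_def by blast
    have fa: "f\<^sub>a x = g x - (k + k')" if "x \<in> ?A" for x
      using fc[OF that] k'[OF that] by (auto simp: algebra_simps)
    have "M-lipschitz_on ?A f\<^sub>a"
      using D(3) fa by (simp add: lipschitz_on_def dist_norm)
    then show ?thesis using const by blast
  qed
  have "M'-lipschitz_on ?A g" using lipschitz_on_mono[OF D(3)] \<open>M \<le> M'\<close> by auto
  moreover have "total_variation ?A ?S \<le> ennreal M'"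
    using tvS ennreal_leI[OF \<open>N \<le> M'\<close>] by simp
  ultimately have "\<exists>f\<^sub>L f\<^sub>S. (\<forall>\<theta>\<in>?A. f \<theta> = f\<^sub>L \<theta> + f\<^sub>S \<theta>) \<and> M'-lipschitz_on ?A f\<^sub>L \<and>
      saltus_on ?A f\<^sub>S \<and> bounded_variation_on ?A f\<^sub>S \<and> total_variation ?A f\<^sub>S \<le> ennreal M'"
    using D(4) saltus bvS by blast
  moreover have "special_bounded_variation_on ?A f"
    unfolding special_bounded_variation_on_def using bv trivial_dec any_dec by blast
  ultimately show ?thesis using bv any_dec by blast
qed

section \<open>Functions with jumps in one direction only\<close>

text \<open>If each weight is dominated by the distance to any later point, the weights add up to at most the
  total distance. For shocks the weight is the strength, and the bound expresses that the flow
  has to relax to the sonic state before it can jump again.\<close>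

lemma chain_sum_le:
  fixes w :: "real \<Rightarrow> real"
  assumes "finite F" "C \<ge> 0" "p \<le> q"
    and "\<And>d d'. d \<in> F \<Longrightarrow> d' \<in> F \<Longrightarrow> d < d' \<Longrightarrow> w d \<le> C * (d' - d)"
    and "\<And>d. d \<in> F \<Longrightarrow> p \<le> d \<and> w d \<le> C * (q - d)"
  shows "sum w F \<le> C * (q - p)"
  using assms
proof (induction F arbitrary: q rule: finite_linorder_max_induct)
  case empty
  then show ?case by simp
next
  case (insert b F)
  have "sum w F \<le> C * (b - p)"
    by (rule insert.IH) (use insert.hyps insert.prems in auto)
  moreover have "w b \<le> C * (q - b)" using insert.prems by auto
  moreover have "b \<notin> F" using insert.hyps by auto
  ultimately show ?case using insert.hyps by (simp add: algebra_simps)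
qed

lemma tendsto_at_left_if_lipschitz:
  fixes U :: "real \<Rightarrow> 'b::banach"
  assumes "c < d" "\<And>s t. c \<le> s \<Longrightarrow> s \<le> t \<Longrightarrow> t < d \<Longrightarrow> norm (U t - U s) \<le> C * (t - s)" "C \<ge> 0"
  obtains l where "(U \<longlongrightarrow> l) (at_left d)"
proof -
  have "C-lipschitz_on {c..<d} U"
  proof (rule lipschitz_onI)
    fix s t assume "s \<in> {c..<d}" "t \<in> {c..<d}"
    then show "dist (U s) (U t) \<le> C * dist s t"
      using assms(2)[of s t] assms(2)[of t s]
      by (cases "s \<le> t") (auto simp: dist_norm norm_minus_commute)
  qed (rule assms)
  then obtain l where "(U \<longlongrightarrow> l) (at d within {c..<d})"
    using uniformly_continuous_on_extension_at_closure[OF lipschitz_on_uniformly_continuous, of C "{c..<d}" U d]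
      \<open>c < d\<close> by auto
  moreover have "at d within {c..<d} = at_left d"
    by (rule at_within_nhd[of _ "{c<..}"]) (use \<open>c < d\<close> in auto)
  ultimately show thesis using that by simp
qed

text \<open>By right continuity the change of sign happens by a jump from the left at a point where the new sign
  is already attained.\<close>

lemma first_sign_change:
  fixes f :: "real \<Rightarrow> real"
  assumes "s < t" "f s < 0" "f t > 0" and nz: "\<And>x. s \<le> x \<Longrightarrow> x \<le> t \<Longrightarrow> f x \<noteq> 0"
    and rc: "\<And>x. s \<le> x \<Longrightarrow> x \<le> t \<Longrightarrow> (f \<longlongrightarrow> f x) (at_right x)"
  obtains d where "s < d" "d \<le> t" "f d > 0" "\<And>x. s \<le> x \<Longrightarrow> x < d \<Longrightarrow> f x < 0"
proof -
  define P where "P = {x\<in>{s..t}. f x > 0}"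
  define d where "d = Inf P"
  have "t \<in> P" using assms by (auto simp: P_def)
  have bdd: "bdd_below P" by (auto simp: P_def intro!: bdd_belowI[of _ s])
  have d_le: "d \<le> x" if "x \<in> P" for x unfolding d_def using that bdd by (rule cInf_lower)
  have s_le_d: "s \<le> d" unfolding d_def using \<open>t \<in> P\<close> by (intro cInf_greatest) (auto simp: P_def)
  have d_le_t: "d \<le> t" using d_le \<open>t \<in> P\<close> by simp
  have before: "f x < 0" if "s \<le> x" "x < d" for x
    using nz[of x] d_le[of x] that d_le_t by (force simp: P_def)
  have "f d > 0"
  proof (rule ccontr)
    assume "\<not> f d > 0"
    then have "f d < 0" using nz[of d] s_le_d d_le_t by auto
    have "d < t" using assms(3) \<open>f d < 0\<close> d_le_t by (cases "d = t") auto
    have "\<forall>\<^sub>F x in at_right d. f x < 0"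
      using order_tendstoD(2)[OF rc \<open>f d < 0\<close>] s_le_d d_le_t by auto
    then obtain e where e: "e > d" "\<And>x. d < x \<Longrightarrow> x < e \<Longrightarrow> f x < 0"
      by (auto simp: eventually_at_right_field)
    have "min e t \<le> x" if "x \<in> P" for x
    proof (rule ccontr)
      assume "\<not> min e t \<le> x"
      moreover have "d \<le> x" using d_le that by simp
      ultimately have "f x < 0" using e(2)[of x] \<open>f d < 0\<close> by (cases "x = d") auto
      then show False using that by (auto simp: P_def)
    qed
    then have "min e t \<le> d" unfolding d_def using \<open>t \<in> P\<close> by (intro cInf_greatest) auto
    then show False using e(1) \<open>d < t\<close> by auto
  qed
  moreover from this have "s < d" using assms(2) s_le_d by (cases "s = d") auto
  ultimately show thesis using that d_le_t before by blast
qed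

text \<open>The scalar \<open>V\<close> stands for the sonic defect. Its absolute value is Lipschitz, so that it can only
  jump from \<open>- w\<close> to \<open>w\<close>, and once it is positive it stays positive until it passes through zero. Hence
  two jumps are separated by a zero of \<open>V\<close>, the jump at \<open>d\<close> is at most of the order of the distance
  to the next zero, and jumps are summable. On a step without a zero there is at most one jump; on a
  step with a zero, \<open>V\<close> and the sum of all jumps are of the order of the step. In both cases the
  increment of \<open>U\<close> minus its jumps is of the order of the step.\<close>

theorem lipschitz_plus_saltus_if_upward_jumps:
  fixes U :: "real \<Rightarrow> 'b::banach" and V :: "real \<Rightarrow> real"
  assumes C: "C > 0" and "a < b"
    and U: "\<And>s t. a \<le> s \<Longrightarrow> s \<le> t \<Longrightarrow> t < b \<Longrightarrow> norm (U t - U s) \<le> C * ((t - s) + \<bar>V t - V s\<bar>)"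
    and lip: "\<And>s t. a \<le> s \<Longrightarrow> s \<le> t \<Longrightarrow> t < b \<Longrightarrow> \<bar>\<bar>V t\<bar> - \<bar>V s\<bar>\<bar> \<le> C * (t - s)"
    and up: "\<And>s t. a \<le> s \<Longrightarrow> s < t \<Longrightarrow> t < b \<Longrightarrow> (\<And>x. s \<le> x \<Longrightarrow> x \<le> t \<Longrightarrow> V x \<noteq> 0) \<Longrightarrow> V s > 0 \<Longrightarrow> V t > 0"
    and bound: "\<And>x. a \<le> x \<Longrightarrow> x < b \<Longrightarrow> \<bar>V x\<bar> \<le> B"
    and rc: "\<And>x. a \<le> x \<Longrightarrow> x < b \<Longrightarrow> (V \<longlongrightarrow> V x) (at_right x)"
  shows "lipschitz_plus_saltus (C * (1 + C) + 4 * C\<^sup>2) (2 * C * (C * (b - a) + B)) U a b"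
proof -
  define M where "M = C * (1 + C) + 4 * C\<^sup>2"
  have C0: "C \<ge> 0" using C by simp
  define D where "D = {d\<in>{a<..<b}. V d > 0 \<and> (\<exists>c\<ge>a. c < d \<and> (\<forall>s. c \<le> s \<longrightarrow> s < d \<longrightarrow> V s < 0))}"
  have same_sign: "norm (U t - U s) \<le> C * (1 + C) * (t - s)"
    if "a \<le> s" "s \<le> t" "t < b" "V s \<le> 0 \<and> V t \<le> 0 \<or> V s \<ge> 0 \<and> V t \<ge> 0" for s t
  proof -
    have "norm (U t - U s) \<le> C * ((t - s) + \<bar>V t - V s\<bar>)" by (rule U[OF that(1-3)])
    also have "\<dots> \<le> C * ((t - s) + C * (t - s))"
      using lip[OF that(1-3)] that(4) C by (intro mult_left_mono add_mono) auto
    finally show ?thesis by (simp add: algebra_simps)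
  qed
  have "\<exists>L. (U \<longlongrightarrow> L) (at_left d)" if d: "d \<in> D" for d
  proof -
    obtain c where c: "a \<le> c" "c < d" "\<And>s. c \<le> s \<Longrightarrow> s < d \<Longrightarrow> V s < 0" "d < b"
      using d by (auto simp: D_def)
    show ?thesis
    proof (rule tendsto_at_left_if_lipschitz[OF c(2), of U "C * (1 + C)"])
      fix s t assume "c \<le> s" "s \<le> t" "t < d"
      then show "norm (U t - U s) \<le> C * (1 + C) * (t - s)"
        using same_sign[of s t] c(1,4) c(3)[of s] c(3)[of t] by auto
    qed (use C in auto)
  qed
  then obtain L where L: "\<And>d. d \<in> D \<Longrightarrow> (U \<longlongrightarrow> L d) (at_left d)" by metis
  define j where "j d = U d - L d" for d
  \<comment> \<open>\<open>V\<close> jumps from \<open>- V d\<close> to \<open>V d\<close>, because its absolute value is continuous.\<close>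
  have jump: "norm (j d) \<le> 2 * C * V d" if d: "d \<in> D" for d
  proof -
    obtain c where c: "a \<le> c" "c < d" "\<And>s. c \<le> s \<Longrightarrow> s < d \<Longrightarrow> V s < 0" "d < b" "V d > 0"
      using d by (auto simp: D_def)
    have "norm (U d - L d) \<le> C * ((d - d) + (2 * V d + C * (d - d)))"
    proof (rule tendsto_le[OF trivial_limit_at_left_real])
      show "((\<lambda>t. C * ((d - t) + (2 * V d + C * (d - t)))) \<longlongrightarrow> C * ((d - d) + (2 * V d + C * (d - d)))) (at_left d)"
        by (intro tendsto_intros)
      show "((\<lambda>t. norm (U d - U t)) \<longlongrightarrow> norm (U d - L d)) (at_left d)"
        by (intro tendsto_intros L d)
      show "\<forall>\<^sub>F t in at_left d. norm (U d - U t) \<le> C * ((d - t) + (2 * V d + C * (d - t)))"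
        using eventually_at_left_real[OF c(2)]
      proof eventually_elim
        case (elim t)
        then have t: "a \<le> t" "t \<le> d" "V t < 0" using c by auto
        have "norm (U d - U t) \<le> C * ((d - t) + \<bar>V d - V t\<bar>)" using t c by (intro U) auto
        also have "\<dots> \<le> C * ((d - t) + (2 * V d + C * (d - t)))"
          using lip[OF t(1,2) c(4)] t c(5) C by (intro mult_left_mono add_mono) auto
        finally show ?case .
      qed
    qed
    then show ?thesis by (simp add: j_def algebra_simps)
  qed
  have from_zero: "V x \<le> C * \<bar>x - y\<bar>" if "a \<le> x" "x < b" "a \<le> y" "y < b" "V y = 0" for x y
    using lip[of x y] lip[of y x] that by (cases "x \<le> y") auto
  \<comment> \<open>Between two jumps \<open>V\<close> has to vanish, since it can only jump upwards.\<close>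
  have chain: "V d \<le> C * (d' - d)" if d: "d \<in> D" "d' \<in> D" "d < d'" for d d'
  proof -
    obtain c where c: "a \<le> c" "c < d'" "\<And>s. c \<le> s \<Longrightarrow> s < d' \<Longrightarrow> V s < 0" "d' < b"
      using d by (auto simp: D_def)
    define t where "t = (max c d + d') / 2"
    have t: "d < t" "t < d'" "V t < 0" using c(2) d(3) by (auto simp: t_def intro!: c(3))
    have "a \<le> d" "V d > 0" using d by (auto simp: D_def)
    then obtain y where y: "d \<le> y" "y \<le> t" "V y = 0"
      using up[of d t] t c by force
    then have "V d \<le> C * \<bar>d - y\<bar>" using t c \<open>a \<le> d\<close> by (intro from_zero) auto
    also have "\<dots> \<le> C * (d' - d)" using y t C by (intro mult_left_mono) auto
    finally show ?thesis .
  qed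
  \<comment> \<open>The chain is closed by the fictitious zero \<open>b + B / C\<close>, which lies far enough to the right
    for the bound \<open>B\<close> on \<open>V\<close>.\<close>
  have total: "(\<Sum>d\<in>F. norm (j d)) \<le> 2 * C * (C * (b - a) + B)" if F: "finite F" "F \<subseteq> D" for F
  proof -
    have "B \<ge> 0" using bound[of a] \<open>a < b\<close> by auto
    have "(\<Sum>d\<in>F. norm (j d)) \<le> (\<Sum>d\<in>F. 2 * C * V d)"
      using jump F by (intro sum_mono) auto
    also have "\<dots> = 2 * C * sum V F" by (simp add: sum_distrib_left)
    also have "sum V F \<le> C * ((b + B / C) - a)"
    proof (rule chain_sum_le[OF F(1) C0])
      show "a \<le> b + B / C" using \<open>a < b\<close> \<open>B \<ge> 0\<close> C by (simp add: add_increasing2)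
      show "V d \<le> C * (d' - d)" if "d \<in> F" "d' \<in> F" "d < d'" for d d'
        using chain that F by auto
      show "a \<le> d \<and> V d \<le> C * (b + B / C - d)" if "d \<in> F" for d
      proof -
        have d: "a < d" "d < b" using that F by (auto simp: D_def)
        have "V d \<le> C * (b - d) + B" using bound[of d] d C by (auto intro: add_increasing)
        also have "\<dots> = C * (b + B / C - d)" using C by (simp add: field_simps)
        finally show ?thesis using d by simp
      qed
    qed
    also have "C * ((b + B / C) - a) = C * (b - a) + B" using C by (simp add: field_simps)
    finally show ?thesis using C by simp
  qed
  note summ = norm_infsum_le_of_finite_sums[of D j, OF total]
  \<comment> \<open>Near a zero of \<open>V\<close> both the increment of \<open>U\<close> and its jumps are of the order of the step.\<close>
  have zero_case: "norm (U t - U s - infsum j (D \<inter> {s<..t})) \<le> M * (t - s)"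
    if st: "a \<le> s" "s < t" "t < b" and y: "s \<le> y" "y \<le> t" "V y = 0" for s t y
  proof -
    have "\<bar>V t\<bar> \<le> C * (t - y)" "\<bar>V s\<bar> \<le> C * (y - s)"
      using lip[of y t] lip[of s y] st y by auto
    then have "\<bar>V t - V s\<bar> \<le> C * (t - y) + C * (y - s)" by linarith
    then have V: "\<bar>V t - V s\<bar> \<le> C * (t - s)" by (simp add: algebra_simps)
    have "norm (U t - U s) \<le> C * ((t - s) + \<bar>V t - V s\<bar>)" using st by (intro U) auto
    also have "\<dots> \<le> C * ((t - s) + C * (t - s))" using V C by (intro mult_left_mono add_mono) auto
    finally have Ubound: "norm (U t - U s) \<le> C * (1 + C) * (t - s)" by (simp add: algebra_simps)
    have jumps: "norm (infsum j (D \<inter> {s<..t})) \<le> 4 * C\<^sup>2 * (t - s)"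
    proof (rule norm_infsum_le_of_finite_sums(2))
      fix F assume F: "finite F" "F \<subseteq> D \<inter> {s<..t}"
      have Fb: "a \<le> d \<and> d < b" if "d \<in> F" for d using that F st by auto
      let ?F1 = "{d\<in>F. d \<le> y}" and ?F2 = "{d\<in>F. y < d}"
      have "sum V ?F1 \<le> C * (y - s)"
      proof (rule chain_sum_le[OF _ C0])
        show "V d \<le> C * (d' - d)" if "d \<in> ?F1" "d' \<in> ?F1" "d < d'" for d d'
          using chain that F by auto
        show "s \<le> d \<and> V d \<le> C * (y - d)" if "d \<in> ?F1" for d
          using from_zero[of d y] that F Fb[of d] st y by auto
      qed (use F y in auto)
      \<comment> \<open>The jumps after \<open>y\<close> are chained up to the reflection of \<open>y\<close> in \<open>t\<close>.\<close>
      moreover have "sum V ?F2 \<le> C * ((t + (t - y)) - y)"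
      proof (rule chain_sum_le[OF _ C0])
        show "V d \<le> C * (d' - d)" if "d \<in> ?F2" "d' \<in> ?F2" "d < d'" for d d'
          using chain that F by auto
        show "y \<le> d \<and> V d \<le> C * (t + (t - y) - d)" if "d \<in> ?F2" for d
        proof -
          have d: "y < d" "d \<le> t" using that F by auto
          have "V d \<le> C * \<bar>d - y\<bar>" using that Fb[of d] st y by (intro from_zero) auto
          also have "\<dots> \<le> C * (t + (t - y) - d)" using d C by (intro mult_left_mono) auto
          finally show ?thesis using d by simp
        qed
      qed (use F y in auto)
      moreover have "sum V F = sum V ?F1 + sum V ?F2"
      proof -
        have "F = ?F1 \<union> ?F2" by auto
        then have "sum V F = sum V (?F1 \<union> ?F2)" by simp
        also have "\<dots> = sum V ?F1 + sum V ?F2" using F by (intro sum.union_disjoint) auto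
        finally show ?thesis .
      qed
      moreover have "C * (y - s) + C * ((t + (t - y)) - y) \<le> 2 * C * (t - s)"
        using mult_left_mono[OF y(1) C0] by (simp add: algebra_simps)
      ultimately have "sum V F \<le> 2 * C * (t - s)" by linarith
      then have "2 * C * sum V F \<le> 2 * C * (2 * C * (t - s))" using C by (intro mult_left_mono) auto
      moreover have "(\<Sum>d\<in>F. norm (j d)) \<le> (\<Sum>d\<in>F. 2 * C * V d)"
        using jump F by (intro sum_mono) auto
      ultimately show "(\<Sum>d\<in>F. norm (j d)) \<le> 4 * C\<^sup>2 * (t - s)"
        by (simp add: sum_distrib_left power2_eq_square)
    qed
    show ?thesis using norm_triangle_ineq4[of "U t - U s" "infsum j (D \<inter> {s<..t})"] Ubound jumps
      by (simp add: M_def distrib_right)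
  qed
  have M_ge: "C * (1 + C) * x \<le> M * x" if "x \<ge> 0" for x
    using that by (simp add: M_def distrib_right)
  \<comment> \<open>Without a zero there is at most one jump, from negative to positive values.\<close>
  have nonzero_case: "norm (U t - U s - infsum j (D \<inter> {s<..t})) \<le> M * (t - s)"
    if st: "a \<le> s" "s < t" "t < b" and nz: "\<And>y. s \<le> y \<Longrightarrow> y \<le> t \<Longrightarrow> V y \<noteq> 0" for s t
  proof -
    have upst: "V y > 0" if "s \<le> x" "x \<le> y" "y \<le> t" "V x > 0" for x y
      using up[of x y] that st nz by (cases "x = y") auto
    consider "V s > 0" | "V s < 0" "V t < 0" | "V s < 0" "V t > 0"
      using nz[of s] nz[of t] st by (auto simp: neq_iff)
    then show ?thesis
    proof cases
      case 1
      have "D \<inter> {s<..t} = {}"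
      proof -
        have False if d: "d \<in> D" "s < d" "d \<le> t" for d
        proof -
          obtain c where "c < d" "\<And>x. c \<le> x \<Longrightarrow> x < d \<Longrightarrow> V x < 0" using d by (auto simp: D_def)
          then have "V (max c s) < 0" using d by auto
          moreover have "V (max c s) > 0" using 1 \<open>c < d\<close> d by - (rule upst[of s "max c s"]; simp)
          ultimately show False by simp
        qed
        then show ?thesis by force
      qed
      moreover have "V t > 0" using upst[of s t] 1 st by auto
      ultimately show ?thesis using order_trans[OF same_sign[of s t] M_ge[of "t - s"]] 1 st by auto
    next
      case 2
      have "D \<inter> {s<..t} = {}"
      proof -
        have False if d: "d \<in> D" "s < d" "d \<le> t" for d
        proof -
          have "V d > 0" using d by (simp add: D_def)
          then have "V t > 0" using d upst[of d t] by simp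
          then show False using 2 by simp
        qed
        then show ?thesis by force
      qed
      then show ?thesis using order_trans[OF same_sign[of s t] M_ge[of "t - s"]] 2 st by auto
    next
      case 3
      obtain d where d: "s < d" "d \<le> t" "V d > 0" and before: "\<And>x. s \<le> x \<Longrightarrow> x < d \<Longrightarrow> V x < 0"
        using first_sign_change[of s t V] st 3 nz rc by auto
      have dD: "d \<in> D" using d(1) d(3) before st d(2) by (auto simp: D_def intro!: exI[of _ s])
      have uniq: "d' = d" if d': "d' \<in> D" "s < d'" "d' \<le> t" for d'
      proof -
        obtain c where c: "c < d'" "\<And>x. c \<le> x \<Longrightarrow> x < d' \<Longrightarrow> V x < 0" "V d' > 0" using d' by (auto simp: D_def)
        have "\<not> d' < d" using before[of d'] c(3) d' by auto
        moreover have "\<not> d < d'"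
        proof
          assume "d < d'"
          then have "V (max c d) < 0" using c by auto
          moreover have "V (max c d) > 0" using d(3) \<open>d < d'\<close> d(1) c d' by - (rule upst[of d "max c d"]; simp)
          ultimately show False by simp
        qed
        ultimately show ?thesis by simp
      qed
      have Dd: "D \<inter> {s<..t} = {d}"
      proof (intro equalityI subsetI)
        fix x assume "x \<in> D \<inter> {s<..t}"
        then show "x \<in> {d}" using uniq[of x] by simp
      next
        fix x assume "x \<in> {d}"
        then show "x \<in> D \<inter> {s<..t}" using dD d(1) d(2) by simp
      qed
      have right: "norm (U t - U d) \<le> C * (1 + C) * (t - d)"
        using same_sign[of d t] st d(1) d(2) d(3) 3 by auto
      have left: "norm (L d - U s) \<le> C * (1 + C) * (d - s)"
      proof (rule tendsto_le[OF trivial_limit_at_left_real])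
        show "((\<lambda>t. C * (1 + C) * (t - s)) \<longlongrightarrow> C * (1 + C) * (d - s)) (at_left d)"
          by (intro tendsto_intros)
        show "((\<lambda>t. norm (U t - U s)) \<longlongrightarrow> norm (L d - U s)) (at_left d)"
          by (intro tendsto_intros L dD)
        show "\<forall>\<^sub>F t in at_left d. norm (U t - U s) \<le> C * (1 + C) * (t - s)"
          using eventually_at_left_real[OF d(1)]
        proof eventually_elim
          case (elim x)
          then show ?case using same_sign[of s x] before[of x] 3 st d(2) by auto
        qed
      qed
      have "U t - U s - infsum j (D \<inter> {s<..t}) = (U t - U d) + (L d - U s)"
        by (simp add: Dd j_def)
      also have "norm \<dots> \<le> norm (U t - U d) + norm (L d - U s)" by (rule norm_triangle_ineq)
      also have "\<dots> \<le> C * (1 + C) * (t - s)" using right left by (simp add: algebra_simps)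
      also have "\<dots> \<le> M * (t - s)" using st by (intro M_ge) auto
      finally show ?thesis .
    qed
  qed
  have incr: "norm (U t - U s - infsum j (D \<inter> {s<..t})) \<le> M * (t - s)" if "a \<le> s" "s \<le> t" "t < b" for s t
  proof (cases "s = t")
    case False
    then have "s < t" using that by simp
    show ?thesis
    proof (cases "\<exists>y. s \<le> y \<and> y \<le> t \<and> V y = 0")
      case True
      then obtain y where "s \<le> y" "y \<le> t" "V y = 0" by blast
      then show ?thesis by (rule zero_case[OF that(1) \<open>s < t\<close> that(3)])
    next
      case False
      then show ?thesis by (intro nonzero_case[OF that(1) \<open>s < t\<close> that(3)]) blast
    qed
  qed simp
  define g where "g \<theta> = U \<theta> - saltus_function j D \<theta>" for \<theta>
  have "M-lipschitz_on {a..<b} g"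
  proof (rule lipschitz_onI)
    have g: "norm (g t - g s) \<le> M * (t - s)" if "a \<le> s" "s \<le> t" "t < b" for s t
    proof -
      have "g t - g s = U t - U s - (saltus_function j D t - saltus_function j D s)"
        by (simp add: g_def)
      then show ?thesis using incr[OF that] by (simp add: saltus_function_increment[OF summ(1) that(2)])
    qed
    fix s t assume "s \<in> {a..<b}" "t \<in> {a..<b}"
    then show "dist (g s) (g t) \<le> M * dist s t"
      using g[of s t] g[of t s] by (cases "s \<le> t") (auto simp: dist_norm norm_minus_commute)
  next
    show "0 \<le> M" using C by (simp add: M_def)
  qed
  moreover have "D \<subseteq> {a<..<b}" by (auto simp: D_def)
  moreover have "\<forall>\<theta>\<in>{a..<b}. U \<theta> = g \<theta> + saltus_function j D \<theta>" by (simp add: g_def)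
  ultimately show ?thesis unfolding lipschitz_plus_saltus_def M_def[symmetric] using total by blast
qed

section \<open>Gas states in the frame of a ray\<close>

text \<open>The velocity in the frame of the ray with angle \<open>\<theta>\<close>. The normal component is counted positively in
  the direction of decreasing angles, which gives the angular fluxes their signs.\<close>

definition radial_velocity :: "real \<Rightarrow> real^4 \<Rightarrow> real"
  where "radial_velocity \<theta> W = cos \<theta> * vel_x W + sin \<theta> * vel_y W"

definition normal_velocity :: "real \<Rightarrow> real^4 \<Rightarrow> real"
  where "normal_velocity \<theta> W = sin \<theta> * vel_x W - cos \<theta> * vel_y W"

definition mass_flux :: "real \<Rightarrow> real^4 \<Rightarrow> real"
  where "mass_flux \<theta> W = density W * normal_velocity \<theta> W"

text \<open>Normal momentum flux through the ray.\<close>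

definition impulse :: "real \<Rightarrow> real \<Rightarrow> real^4 \<Rightarrow> real"
  where "impulse \<gamma> \<theta> W = density W * (normal_velocity \<theta> W)\<^sup>2 + pressure \<gamma> W"

definition total_enthalpy :: "real \<Rightarrow> real^4 \<Rightarrow> real"
  where "total_enthalpy \<gamma> W = (energy W + pressure \<gamma> W) / density W"

text \<open>This is \<open>\<rho> (N\<^sup>2 - c\<^sup>2)\<close>: positive where the flow crosses the ray supersonically. Unlike
  \<open>N - c\<^sup>2 / N\<close> it stays bounded where the mass flux vanishes.\<close>

definition sonic_defect :: "real \<Rightarrow> real \<Rightarrow> real^4 \<Rightarrow> real"
  where "sonic_defect \<gamma> \<theta> W = density W * (normal_velocity \<theta> W)\<^sup>2 - \<gamma> * pressure \<gamma> W"

lemma velocity_components: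
  "vel_x W = cos \<theta> * radial_velocity \<theta> W + sin \<theta> * normal_velocity \<theta> W"
  "vel_y W = sin \<theta> * radial_velocity \<theta> W - cos \<theta> * normal_velocity \<theta> W"
proof -
  show "vel_x W = cos \<theta> * radial_velocity \<theta> W + sin \<theta> * normal_velocity \<theta> W"
    "vel_y W = sin \<theta> * radial_velocity \<theta> W - cos \<theta> * normal_velocity \<theta> W"
    unfolding radial_velocity_def normal_velocity_def using sin_cos_squared_add3[of \<theta>] by algebra+
qed

lemma speed_square: "(vel_x W)\<^sup>2 + (vel_y W)\<^sup>2 = (radial_velocity \<theta> W)\<^sup>2 + (normal_velocity \<theta> W)\<^sup>2"
proof -
  show ?thesis unfolding radial_velocity_def normal_velocity_def using sin_cos_squared_add3[of \<theta>] by algebra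
qed

lemma abs_mult_diff_le:
  fixes x x' y y' :: real
  assumes "\<bar>x - x'\<bar> \<le> a" "\<bar>y - y'\<bar> \<le> b" "\<bar>x\<bar> \<le> A" "\<bar>y'\<bar> \<le> B"
  shows "\<bar>x * y - x' * y'\<bar> \<le> A * b + B * a"
proof -
  have "x * y - x' * y' = x * (y - y') + y' * (x - x')" by (simp add: algebra_simps)
  then have "\<bar>x * y - x' * y'\<bar> \<le> \<bar>x\<bar> * \<bar>y - y'\<bar> + \<bar>y'\<bar> * \<bar>x - x'\<bar>"
    by (metis abs_mult abs_triangle_ineq)
  also have "\<dots> \<le> A * b + B * a"
    using assms by (intro add_mono mult_mono) (auto intro: order_trans[OF abs_ge_zero])
  finally show ?thesis .
qed

lemma abs_cos_sin_diff_le: "\<bar>cos x - cos y\<bar> \<le> \<bar>x - y\<bar>" "\<bar>sin x - sin y\<bar> \<le> \<bar>x - (y::real)\<bar>"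
proof -
  have *: "\<bar>cos x - cos y\<bar> \<le> 1 * \<bar>x - y\<bar>"
    using field_differentiable_bound[of "UNIV::real set" cos "\<lambda>x. - sin x" 1 x y]
    by (auto intro!: derivative_eq_intros simp: abs_sin_le_one)
  have **: "\<bar>sin x - sin y\<bar> \<le> 1 * \<bar>x - y\<bar>"
    using field_differentiable_bound[of "UNIV::real set" sin "\<lambda>x. cos x" 1 x y]
    by (auto intro!: derivative_eq_intros simp: abs_cos_le_one)
  show "\<bar>cos x - cos y\<bar> \<le> \<bar>x - y\<bar>" "\<bar>sin x - sin y\<bar> \<le> \<bar>x - y\<bar>" using * ** by auto
qed

locale gas_phase_space =
  fixes \<gamma> K :: real
  assumes gamma: "\<gamma> > 1" and K: "K > 1"
begin

lemma phase_spaceD: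
  assumes "W \<in> phase_space K"
  shows "density W > 0" "density W \<ge> inverse K" "density W \<le> K" "pressure \<gamma> W > 0"
    "internal_energy W \<ge> inverse K" "internal_energy W \<le> K" "\<bar>W $ i\<bar> \<le> K"
proof -
  have Kp: "inverse K > 0" using K by simp
  show "density W \<ge> inverse K" "density W \<le> K" "internal_energy W \<ge> inverse K" "internal_energy W \<le> K"
    using assms by (auto simp: phase_space_def)
  then have pos: "density W > 0" "internal_energy W > 0" using Kp by linarith+
  then show "density W > 0" "pressure \<gamma> W > 0" using gamma by (auto simp: pressure_def)
  show "\<bar>W $ i\<bar> \<le> K" using assms component_le_norm_cart[of W i] by (auto simp: phase_space_def)
qed

lemma pressure_le:
  assumes "W \<in> phase_space K"
  shows "pressure \<gamma> W \<le> (\<gamma> - 1) * K\<^sup>2"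
proof -
  note W = phase_spaceD[OF assms]
  have "density W * internal_energy W \<le> K * K"
    using W K by (intro mult_mono) (auto intro: order_trans[of _ "inverse K"])
  then have "(\<gamma> - 1) * (density W * internal_energy W) \<le> (\<gamma> - 1) * (K * K)"
    using gamma by (intro mult_left_mono) auto
  then show ?thesis by (simp add: pressure_def power2_eq_square mult.assoc)
qed

lemma quotient_by_density_le:
  assumes "W \<in> phase_space K" "\<bar>x\<bar> \<le> y"
  shows "\<bar>x / density W\<bar> \<le> K * y"
proof -
  note W = phase_spaceD[OF assms(1)]
  have "inverse (density W) \<le> K" using le_imp_inverse_le[OF W(2)] K by simp
  then have "\<bar>x\<bar> * inverse (density W) \<le> y * K"
    using assms(2) W(1) by (intro mult_mono) auto
  then show ?thesis using W(1) by (simp add: divide_inverse abs_mult mult.commute)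
qed

lemma momentum_components:
  assumes "W \<in> phase_space K"
  shows "W $ 2 = density W * vel_x W" "W $ 3 = density W * vel_y W"
    "W $ 2 = cos \<theta> * (density W * radial_velocity \<theta> W) + sin \<theta> * mass_flux \<theta> W"
    "W $ 3 = sin \<theta> * (density W * radial_velocity \<theta> W) - cos \<theta> * mass_flux \<theta> W"
proof -
  show mom: "W $ 2 = density W * vel_x W" "W $ 3 = density W * vel_y W"
    using phase_spaceD(1)[OF assms] by (auto simp: vel_x_def vel_y_def density_def)
  show "W $ 2 = cos \<theta> * (density W * radial_velocity \<theta> W) + sin \<theta> * mass_flux \<theta> W"
    "W $ 3 = sin \<theta> * (density W * radial_velocity \<theta> W) - cos \<theta> * mass_flux \<theta> W"
    unfolding mom velocity_components[of W \<theta>] by (simp_all add: mass_flux_def algebra_simps)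
qed

lemma velocity_bounds:
  assumes "W \<in> phase_space K"
  shows "\<bar>density W * radial_velocity \<theta> W\<bar> \<le> 2 * K" "\<bar>density W * normal_velocity \<theta> W\<bar> \<le> 2 * K"
    "\<bar>radial_velocity \<theta> W\<bar> \<le> 2 * K\<^sup>2" "\<bar>normal_velocity \<theta> W\<bar> \<le> 2 * K\<^sup>2"
proof -
  note W = phase_spaceD[OF assms]
  have c: "\<bar>cos \<theta> * x\<bar> \<le> K" "\<bar>sin \<theta> * x\<bar> \<le> K" if "\<bar>x\<bar> \<le> K" for x
    using mult_mono[OF abs_cos_le_one[of \<theta>] that] mult_mono[OF abs_sin_le_one[of \<theta>] that] K
    by (auto simp: abs_mult)
  have eq: "density W * radial_velocity \<theta> W = cos \<theta> * W $ 2 + sin \<theta> * W $ 3"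
    "density W * normal_velocity \<theta> W = sin \<theta> * W $ 2 - cos \<theta> * W $ 3"
    unfolding momentum_components(1,2)[OF assms] by (simp_all add: radial_velocity_def normal_velocity_def algebra_simps)
  show r: "\<bar>density W * radial_velocity \<theta> W\<bar> \<le> 2 * K"
    unfolding eq using c(1)[OF W(7)[of 2]] c(2)[OF W(7)[of 3]] by linarith
  show n: "\<bar>density W * normal_velocity \<theta> W\<bar> \<le> 2 * K"
    unfolding eq using c(2)[OF W(7)[of 2]] c(1)[OF W(7)[of 3]] by linarith
  show "\<bar>radial_velocity \<theta> W\<bar> \<le> 2 * K\<^sup>2" "\<bar>normal_velocity \<theta> W\<bar> \<le> 2 * K\<^sup>2"
    using quotient_by_density_le[OF assms r] quotient_by_density_le[OF assms n] W(1)
    by (auto simp: power2_eq_square mult_ac)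
qed

lemma energy_eq:
  assumes "W \<in> phase_space K"
  shows "energy W + pressure \<gamma> W = density W * ((radial_velocity \<theta> W)\<^sup>2 + (normal_velocity \<theta> W)\<^sup>2) / 2
      + \<gamma> / (\<gamma> - 1) * pressure \<gamma> W"
proof -
  note W = phase_spaceD[OF assms]
  have "energy W = density W * (internal_energy W + ((vel_x W)\<^sup>2 + (vel_y W)\<^sup>2) / 2)"
    using W(1) by (simp add: internal_energy_def)
  moreover have "\<gamma> / (\<gamma> - 1) * pressure \<gamma> W = \<gamma> * density W * internal_energy W"
    using gamma by (simp add: pressure_def)
  moreover have "pressure \<gamma> W = (\<gamma> - 1) * density W * internal_energy W" by (simp add: pressure_def)
  moreover have "E + p = r * q / 2 + kp" if "E = r * (e + q / 2)" "kp = g * r * e" "p = (g - 1) * r * e"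
    for E p kp r e q g :: real
    using that by (simp add: algebra_simps)
  ultimately show ?thesis unfolding speed_square[of W \<theta>] by blast
qed

text \<open>Bernoulli's relation with the radial kinetic energy split off.\<close>

lemma enthalpy_eq:
  assumes "W \<in> phase_space K"
  shows "density W * (total_enthalpy \<gamma> W - (radial_velocity \<theta> W)\<^sup>2 / 2)
    = density W * (normal_velocity \<theta> W)\<^sup>2 / 2 + \<gamma> / (\<gamma> - 1) * pressure \<gamma> W"
proof -
  have "density W * total_enthalpy \<gamma> W = energy W + pressure \<gamma> W"
    using phase_spaceD(1)[OF assms] by (simp add: total_enthalpy_def)
  then have "density W * (total_enthalpy \<gamma> W - (radial_velocity \<theta> W)\<^sup>2 / 2)
      = energy W + pressure \<gamma> W - density W * (radial_velocity \<theta> W)\<^sup>2 / 2"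
    by (simp add: right_diff_distrib)
  then show ?thesis unfolding energy_eq[OF assms, of \<theta>] by (simp add: distrib_left add_divide_distrib)
qed

lemma enthalpy_bounds:
  assumes "W \<in> phase_space K"
  shows "inverse K \<le> total_enthalpy \<gamma> W - (radial_velocity \<theta> W)\<^sup>2 / 2"
    "\<bar>total_enthalpy \<gamma> W\<bar> \<le> K * (K + (\<gamma> - 1) * K\<^sup>2)"
proof -
  note W = phase_spaceD[OF assms]
  have "density W * (total_enthalpy \<gamma> W - (radial_velocity \<theta> W)\<^sup>2 / 2)
     = density W * ((normal_velocity \<theta> W)\<^sup>2 / 2 + \<gamma> * internal_energy W)"
    using gamma unfolding enthalpy_eq[OF assms] by (simp add: pressure_def field_simps)
  then have "total_enthalpy \<gamma> W - (radial_velocity \<theta> W)\<^sup>2 / 2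
      = (normal_velocity \<theta> W)\<^sup>2 / 2 + \<gamma> * internal_energy W"
    using W(1) by simp
  moreover have "1 * inverse K \<le> \<gamma> * internal_energy W"
    using gamma W(5) K by (intro mult_mono) auto
  moreover have "0 \<le> (normal_velocity \<theta> W)\<^sup>2 / 2" by simp
  ultimately show "inverse K \<le> total_enthalpy \<gamma> W - (radial_velocity \<theta> W)\<^sup>2 / 2" by linarith
  have "\<bar>energy W + pressure \<gamma> W\<bar> \<le> K + (\<gamma> - 1) * K\<^sup>2"
    using W(7)[of 4] pressure_le[OF assms] W(4) unfolding energy_def by linarith
  then show "\<bar>total_enthalpy \<gamma> W\<bar> \<le> K * (K + (\<gamma> - 1) * K\<^sup>2)"
    unfolding total_enthalpy_def by (rule quotient_by_density_le[OF assms])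
qed

text \<open>Closeness of the quantities that vary in a Lipschitz way along the flow, together with closeness of
  the sonic defect, forces closeness of states; the enthalpy is constant between contact
  discontinuities. The constants are the Lipschitz constants of these quantities.\<close>

definition controls_states :: "real \<Rightarrow> bool"
  where "controls_states C \<longleftrightarrow> C > 0 \<and> (\<forall>W W' \<theta> \<theta>' \<delta>.
      W \<in> phase_space K \<longrightarrow> W' \<in> phase_space K \<longrightarrow> \<bar>\<theta> - \<theta>'\<bar> \<le> \<delta> \<longrightarrow>
      \<bar>radial_velocity \<theta> W - radial_velocity \<theta>' W'\<bar> \<le> 2 * K\<^sup>2 * \<delta> \<longrightarrow>
      total_enthalpy \<gamma> W = total_enthalpy \<gamma> W' \<longrightarrow>
      \<bar>mass_flux \<theta> W - mass_flux \<theta>' W'\<bar> \<le> 2 * K * \<delta> \<longrightarrow>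
      \<bar>impulse \<gamma> \<theta> W - impulse \<gamma> \<theta>' W'\<bar> \<le> 8 * K ^ 3 * \<delta> \<longrightarrow>
      \<bar>sonic_defect \<gamma> \<theta> W - sonic_defect \<gamma> \<theta>' W'\<bar> \<le> \<delta> \<longrightarrow>
      norm (W - W') \<le> C * \<delta>)"

text \<open>Impulse and sonic defect determine \<open>p\<close> and \<open>\<rho> N\<^sup>2\<close>, the enthalpy relation then determines \<open>\<rho>\<close>, and
  the momentum is recovered from \<open>\<rho> L\<close> and the mass flux. Each step is Lipschitz on the phase space, and no
  step divides by the mass flux, so the constant does not degenerate near contact discontinuities.\<close>

lemma ex_controls_states: "\<exists>C. controls_states C"
proof -
  define k where "k = \<gamma> / (\<gamma> - 1)"
  define c1 where "c1 = 8 * K ^ 3 + 1"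
  define c2 where "c2 = 8 * K ^ 3 + c1"
  define c3 where "c3 = c1 + k * c2"
  define c4 where "c4 = K * (c3 + K * (4 * K ^ 4))"
  define c5 where "c5 = K * (2 * K\<^sup>2) + 2 * K\<^sup>2 * c4"
  define c6 where "c6 = c5 + 6 * K"
  define h where "h = K * (K + (\<gamma> - 1) * K\<^sup>2)"
  define C where "C = c4 + c6 + c6 + (h * c4 + c2)"
  have "k > 0" "h > 0" using gamma K by (auto simp: k_def h_def intro!: add_pos_pos mult_pos_pos)
  moreover have c1: "c1 > 0" using K by (simp add: c1_def add_pos_pos)
  moreover have c2: "c2 > 0" using K c1 by (simp add: c2_def add_pos_pos)
  moreover have c3: "c3 > 0" using c1 c2 \<open>k > 0\<close> by (simp add: c3_def add_pos_pos)
  moreover have c4: "c4 > 0" using K c3 by (simp add: c4_def add_pos_pos)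
  moreover have c5: "c5 > 0" using K c4 by (simp add: c5_def add_pos_pos)
  moreover have "c6 > 0" using K c5 by (simp add: c6_def add_pos_pos)
  ultimately have pos: "k > 0" "c1 > 0" "c2 > 0" "c3 > 0" "c4 > 0" "c5 > 0" "c6 > 0" "h > 0" by auto
  show ?thesis
    unfolding controls_states_def
  proof (intro exI[of _ C] conjI allI impI)
    show "C > 0" using pos by (simp add: C_def add_pos_pos)
    fix W W' :: "real^4" and \<theta> \<theta>' \<delta> :: real
    assume W: "W \<in> phase_space K" and W': "W' \<in> phase_space K" and th: "\<bar>\<theta> - \<theta>'\<bar> \<le> \<delta>"
    define \<rho> \<rho>' where "\<rho> = density W" "\<rho>' = density W'"
    define p p' where "p = pressure \<gamma> W" "p' = pressure \<gamma> W'"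
    define L L' where "L = radial_velocity \<theta> W" "L' = radial_velocity \<theta>' W'"
    define N N' where "N = normal_velocity \<theta> W" "N' = normal_velocity \<theta>' W'"
    define H where "H = total_enthalpy \<gamma> W"
    define m m' where "m = \<rho> * N" "m' = \<rho>' * N'"
    define x x' where "x = \<rho> * N\<^sup>2" "x' = \<rho>' * N'\<^sup>2"
    note defs = \<rho>_\<rho>'_def p_p'_def L_L'_def N_N'_def
    assume "\<bar>radial_velocity \<theta> W - radial_velocity \<theta>' W'\<bar> \<le> 2 * K\<^sup>2 * \<delta>"
      and H_eq: "total_enthalpy \<gamma> W = total_enthalpy \<gamma> W'"
      and "\<bar>mass_flux \<theta> W - mass_flux \<theta>' W'\<bar> \<le> 2 * K * \<delta>"
      and "\<bar>impulse \<gamma> \<theta> W - impulse \<gamma> \<theta>' W'\<bar> \<le> 8 * K ^ 3 * \<delta>"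
      and "\<bar>sonic_defect \<gamma> \<theta> W - sonic_defect \<gamma> \<theta>' W'\<bar> \<le> \<delta>"
    then have dL: "\<bar>L - L'\<bar> \<le> 2 * K\<^sup>2 * \<delta>" and dm: "\<bar>m - m'\<bar> \<le> 2 * K * \<delta>"
      and dP: "\<bar>(x + p) - (x' + p')\<bar> \<le> 8 * K ^ 3 * \<delta>"
      and dV: "\<bar>(x - \<gamma> * p) - (x' - \<gamma> * p')\<bar> \<le> \<delta>"
      by (simp_all add: defs m_m'_def x_x'_def mass_flux_def impulse_def sonic_defect_def)
    note PW = phase_spaceD[OF W, folded defs] and PW' = phase_spaceD[OF W', folded defs]
    note VW = velocity_bounds[OF W, of \<theta>, folded defs] and VW' = velocity_bounds[OF W', of \<theta>', folded defs]
    have d0: "\<delta> \<ge> 0" using th by simp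
    \<comment> \<open>Impulse and sonic defect are independent linear combinations of \<open>x = \<rho> N\<^sup>2\<close> and \<open>p\<close>.\<close>
    have dx: "\<bar>x - x'\<bar> \<le> c1 * \<delta>"
    proof -
      have "(\<gamma> + 1) * (x - x') = \<gamma> * ((x + p) - (x' + p')) + ((x - \<gamma> * p) - (x' - \<gamma> * p'))"
        by (simp add: algebra_simps)
      then have "\<bar>(\<gamma> + 1) * (x - x')\<bar> \<le> \<bar>\<gamma> * ((x + p) - (x' + p'))\<bar> + \<bar>(x - \<gamma> * p) - (x' - \<gamma> * p')\<bar>"
        by (metis abs_triangle_ineq)
      also have "\<dots> \<le> \<gamma> * (8 * K ^ 3 * \<delta>) + \<delta>"
        using dP dV gamma by (intro add_mono) (auto simp: abs_mult)
      also have "\<dots> \<le> (\<gamma> + 1) * (c1 * \<delta>)"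
      proof -
        have "0 \<le> 8 * K ^ 3 * \<delta>" "0 \<le> \<gamma> * \<delta>" using K d0 gamma by auto
        then show ?thesis by (simp add: c1_def algebra_simps)
      qed
      finally show ?thesis using gamma by (simp add: abs_mult)
    qed
    have dp: "\<bar>p - p'\<bar> \<le> c2 * \<delta>"
      using dP dx by (simp add: c2_def distrib_right)
    have dQ: "\<bar>(x / 2 + k * p) - (x' / 2 + k * p')\<bar> \<le> c3 * \<delta>"
    proof -
      have "(x / 2 + k * p) - (x' / 2 + k * p') = (x - x') / 2 + k * (p - p')"
        by (simp add: algebra_simps diff_divide_distrib)
      then have "\<bar>(x / 2 + k * p) - (x' / 2 + k * p')\<bar> \<le> \<bar>(x - x') / 2\<bar> + \<bar>k * (p - p')\<bar>"
        by (metis abs_triangle_ineq)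
      also have "\<dots> \<le> c1 * \<delta> + k * (c2 * \<delta>)"
        using dx dp pos by (intro add_mono) (auto simp: abs_mult)
      finally show ?thesis by (simp add: c3_def algebra_simps)
    qed
    have dG: "\<bar>(H - L\<^sup>2 / 2) - (H - L'\<^sup>2 / 2)\<bar> \<le> 4 * K ^ 4 * \<delta>"
    proof -
      have "\<bar>L * L - L' * L'\<bar> \<le> (2 * K\<^sup>2) * (2 * K\<^sup>2 * \<delta>) + (2 * K\<^sup>2) * (2 * K\<^sup>2 * \<delta>)"
        by (rule abs_mult_diff_le[OF dL dL VW(3) VW'(3)])
      also have "\<dots> = 2 * (4 * K ^ 4 * \<delta>)" by (simp add: power2_eq_square power4_eq_xxxx)
      finally show ?thesis by (simp add: power2_eq_square)
    qed
    \<comment> \<open>The enthalpy relation is then linear in \<open>\<rho>\<close>, with a factor bounded away from zero.\<close>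
    have dr: "\<bar>\<rho> - \<rho>'\<bar> \<le> c4 * \<delta>"
    proof -
      have G: "\<rho> * (H - L\<^sup>2 / 2) = x / 2 + k * p" "\<rho>' * (H - L'\<^sup>2 / 2) = x' / 2 + k * p'"
        using enthalpy_eq[OF W, of \<theta>] enthalpy_eq[OF W', of \<theta>'] H_eq
        by (simp_all add: defs x_x'_def H_def k_def)
      have G1: "inverse K \<le> H - L\<^sup>2 / 2"
        using enthalpy_bounds(1)[OF W, of \<theta>] by (simp add: defs H_def)
      have "\<bar>\<rho> - \<rho>'\<bar> * inverse K \<le> \<bar>\<rho> - \<rho>'\<bar> * (H - L\<^sup>2 / 2)"
        using G1 by (intro mult_left_mono) auto
      also have "\<dots> = \<bar>(\<rho> - \<rho>') * (H - L\<^sup>2 / 2)\<bar>"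
      proof -
        have "0 \<le> H - L\<^sup>2 / 2" using G1 K by (meson inverse_nonnegative_iff_nonnegative less_imp_le order_trans zero_le_one)
        then show ?thesis by (simp only: abs_mult abs_of_nonneg)
      qed
      also have "(\<rho> - \<rho>') * (H - L\<^sup>2 / 2) = ((x / 2 + k * p) - (x' / 2 + k * p'))
          - \<rho>' * ((H - L\<^sup>2 / 2) - (H - L'\<^sup>2 / 2))"
        unfolding G[symmetric] by (simp add: algebra_simps diff_divide_distrib)
      also have "\<bar>\<dots>\<bar> \<le> \<bar>(x / 2 + k * p) - (x' / 2 + k * p')\<bar> + \<bar>\<rho>' * ((H - L\<^sup>2 / 2) - (H - L'\<^sup>2 / 2))\<bar>"
        by (rule abs_triangle_ineq4)
      also have "\<dots> \<le> c3 * \<delta> + K * (4 * K ^ 4 * \<delta>)"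
        unfolding abs_mult[of \<rho>'] using dQ dG PW'(1,3) by (intro add_mono mult_mono) auto
      finally have "\<bar>\<rho> - \<rho>'\<bar> * inverse K * K \<le> (c3 * \<delta> + K * (4 * K ^ 4 * \<delta>)) * K"
        using K by (intro mult_right_mono) auto
      moreover have "\<bar>\<rho> - \<rho>'\<bar> * inverse K * K = \<bar>\<rho> - \<rho>'\<bar>" using K by simp
      moreover have "(c3 * \<delta> + K * (4 * K ^ 4 * \<delta>)) * K = c4 * \<delta>" by (simp add: c4_def algebra_simps)
      ultimately show ?thesis by simp
    qed
    have drL: "\<bar>\<rho> * L - \<rho>' * L'\<bar> \<le> c5 * \<delta>"
    proof -
      have "\<bar>\<rho> * L - \<rho>' * L'\<bar> \<le> K * (2 * K\<^sup>2 * \<delta>) + 2 * K\<^sup>2 * (c4 * \<delta>)"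
        using PW(1,3) by (intro abs_mult_diff_le dr dL VW') auto
      then show ?thesis by (simp add: c5_def algebra_simps)
    qed
    have trig: "\<bar>cos \<theta> - cos \<theta>'\<bar> \<le> \<delta>" "\<bar>sin \<theta> - sin \<theta>'\<bar> \<le> \<delta>"
      using abs_cos_sin_diff_le[of \<theta> \<theta>'] th by linarith+
    note mW = momentum_components(3,4)[OF W, of \<theta>] and mW' = momentum_components(3,4)[OF W', of \<theta>']
    have b: "\<bar>\<rho>' * L'\<bar> \<le> 2 * K" "\<bar>m'\<bar> \<le> 2 * K" using VW' by (simp_all add: m_m'_def)
    have cL: "\<bar>cos \<theta> * (\<rho> * L) - cos \<theta>' * (\<rho>' * L')\<bar> \<le> 1 * (c5 * \<delta>) + 2 * K * \<delta>"
      "\<bar>sin \<theta> * (\<rho> * L) - sin \<theta>' * (\<rho>' * L')\<bar> \<le> 1 * (c5 * \<delta>) + 2 * K * \<delta>"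
      by (intro abs_mult_diff_le trig drL b abs_cos_le_one abs_sin_le_one)+
    have cm: "\<bar>cos \<theta> * m - cos \<theta>' * m'\<bar> \<le> 1 * (2 * K * \<delta>) + 2 * K * \<delta>"
      "\<bar>sin \<theta> * m - sin \<theta>' * m'\<bar> \<le> 1 * (2 * K * \<delta>) + 2 * K * \<delta>"
      by (intro abs_mult_diff_le trig dm b abs_cos_le_one abs_sin_le_one)+
    have c6: "c6 * \<delta> = c5 * \<delta> + 6 * (K * \<delta>)" by (simp add: c6_def algebra_simps)
    have d2: "\<bar>W $ 2 - W' $ 2\<bar> \<le> c6 * \<delta>"
      using cL(1) cm(2) mW(1) mW'(1) c6 by (simp add: defs m_m'_def mass_flux_def)
    have d3: "\<bar>W $ 3 - W' $ 3\<bar> \<le> c6 * \<delta>"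
      using cL(2) cm(1) mW(2) mW'(2) c6 by (simp add: defs m_m'_def mass_flux_def)
    have d4: "\<bar>W $ 4 - W' $ 4\<bar> \<le> (h * c4 + c2) * \<delta>"
    proof -
      have "W $ 4 = \<rho> * total_enthalpy \<gamma> W - p" "W' $ 4 = \<rho>' * total_enthalpy \<gamma> W' - p'"
        using PW(1) PW'(1) by (simp_all add: defs total_enthalpy_def energy_def)
      then have "W $ 4 = \<rho> * H - p" "W' $ 4 = \<rho>' * H - p'" using H_eq by (simp_all add: H_def)
      then have "W $ 4 - W' $ 4 = H * (\<rho> - \<rho>') - (p - p')" by (simp add: algebra_simps)
      then have "\<bar>W $ 4 - W' $ 4\<bar> \<le> \<bar>H\<bar> * \<bar>\<rho> - \<rho>'\<bar> + \<bar>p - p'\<bar>"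
        by (metis abs_mult abs_triangle_ineq4)
      also have "\<dots> \<le> h * (c4 * \<delta>) + c2 * \<delta>"
        using enthalpy_bounds(2)[OF W] dr dp pos by (intro add_mono mult_mono) (auto simp: H_def h_def)
      finally show ?thesis by (simp add: algebra_simps)
    qed
    have "norm (W - W') \<le> (\<Sum>i\<in>UNIV. \<bar>(W - W') $ i\<bar>)" by (rule norm_le_l1_cart)
    also have "\<dots> = \<bar>\<rho> - \<rho>'\<bar> + \<bar>W $ 2 - W' $ 2\<bar> + \<bar>W $ 3 - W' $ 3\<bar> + \<bar>W $ 4 - W' $ 4\<bar>"
      by (simp add: sum_4 defs density_def)
    also have "\<dots> \<le> c4 * \<delta> + c6 * \<delta> + c6 * \<delta> + (h * c4 + c2) * \<delta>"
      by (intro add_mono dr d2 d3 d4)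
    finally show "norm (W - W') \<le> C * \<delta>" by (simp add: C_def algebra_simps)
  qed
qed

end

section \<open>Entropy growth across shocks\<close>

text \<open>The pressure ratio on the Hugoniot curve exceeds the one on the isentrope, for every compression
  ratio \<open>x > 1\<close> below the limiting one.\<close>

lemma shock_adiabat_gap_pos:
  fixes \<gamma> x :: real
  assumes "\<gamma> > 1" "x > 1" and pos: "(\<gamma> + 1) - (\<gamma> - 1) * x > 0"
  shows "\<gamma> * ln x < ln ((\<gamma> + 1) * x - (\<gamma> - 1)) - ln ((\<gamma> + 1) - (\<gamma> - 1) * x)"
proof -
  define f where "f x = ln ((\<gamma> + 1) * x - (\<gamma> - 1)) - ln ((\<gamma> + 1) - (\<gamma> - 1) * x) - \<gamma> * ln x" for x
  define f' where "f' x = (\<gamma> + 1) / ((\<gamma> + 1) * x - (\<gamma> - 1)) + (\<gamma> - 1) / ((\<gamma> + 1) - (\<gamma> - 1) * x) - \<gamma> / x" for x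
  have AB: "(\<gamma> + 1) * y - (\<gamma> - 1) > 0" "(\<gamma> + 1) - (\<gamma> - 1) * y > 0" if "1 \<le> y" "y \<le> x" for y
  proof -
    have "(\<gamma> + 1) * 1 \<le> (\<gamma> + 1) * y" using that assms by (intro mult_left_mono) auto
    then show "(\<gamma> + 1) * y - (\<gamma> - 1) > 0" by simp
    have "(\<gamma> - 1) * y \<le> (\<gamma> - 1) * x" using that assms by (intro mult_left_mono) auto
    then show "(\<gamma> + 1) - (\<gamma> - 1) * y > 0" using pos by simp
  qed
  have der: "DERIV f y :> f' y" if "1 \<le> y" "y \<le> x" for y
    unfolding f_def[abs_def] f'_def using AB[OF that] that
    by (auto intro!: derivative_eq_intros simp: divide_inverse algebra_simps)
  \<comment> \<open>The gap vanishes at \<open>x = 1\<close>, and its derivative is a positive multiple of \<open>(z - 1)\<^sup>2\<close>.\<close>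
  obtain z where z: "1 < z" "z < x" "f x - f 1 = (x - 1) * f' z"
    using MVT2[of 1 x f f'] der assms(2) by auto
  define A B where "A = (\<gamma> + 1) * z - (\<gamma> - 1)" "B = (\<gamma> + 1) - (\<gamma> - 1) * z"
  have ABz: "A > 0" "B > 0" using AB[of z] z by (auto simp: A_B_def)
  have "f' z = (\<gamma> + 1) / A + (\<gamma> - 1) / B - \<gamma> / z" by (simp only: f'_def A_B_def)
  also have "\<dots> = ((\<gamma> + 1) * B * z + (\<gamma> - 1) * A * z - \<gamma> * (A * B)) / (A * B * z)"
    using ABz z(1) by (simp add: field_simps)
  also have "(\<gamma> + 1) * B * z + (\<gamma> - 1) * A * z - \<gamma> * (A * B) = \<gamma> * ((\<gamma>\<^sup>2 - 1) * (z - 1)\<^sup>2)"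
    unfolding A_B_def by (simp add: power2_eq_square algebra_simps)
  also have "\<dots> / (A * B * z) > 0"
    using ABz z assms(1) by (intro divide_pos_pos mult_pos_pos) (auto simp: power2_eq_square less_1_mult)
  finally have "f x - f 1 > 0" using z assms(2) by simp
  then show ?thesis by (simp add: f_def)
qed

text \<open>Two states with the same fluxes on different sides of the sonic line are ordered: the one with
  supersonic normal velocity has the lower density, so passing to the other one is a compression,
  and the entropy rises along the Hugoniot curve.\<close>

lemma entropy_increases_across_shock:
  fixes \<gamma> \<rho>1 \<rho>2 :: real
  assumes "\<gamma> > 1" and pos: "\<rho>1 > 0" "\<rho>2 > 0" "p1 > 0" "p2 > 0"
    and mass: "\<rho>1 * N1 = \<rho>2 * N2" and "N1 \<noteq> 0"
    and momentum: "\<rho>1 * N1\<^sup>2 + p1 = \<rho>2 * N2\<^sup>2 + p2"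
    and bernoulli: "N1\<^sup>2 / 2 + \<gamma> / (\<gamma> - 1) * p1 / \<rho>1 = N2\<^sup>2 / 2 + \<gamma> / (\<gamma> - 1) * p2 / \<rho>2"
    and super: "\<rho>1 * N1\<^sup>2 - \<gamma> * p1 > 0" and sub: "\<rho>2 * N2\<^sup>2 - \<gamma> * p2 < 0"
  shows "ln p1 - \<gamma> * ln \<rho>1 < ln p2 - \<gamma> * ln \<rho>2"
proof -
  define m where "m = \<rho>1 * N1"
  have N: "N1 = m / \<rho>1" "N2 = m / \<rho>2" using pos by (simp add: m_def, simp add: m_def mass)
  have "m \<noteq> 0" using pos \<open>N1 \<noteq> 0\<close> by (simp add: m_def)
  have x: "\<rho>1 * N1\<^sup>2 = m\<^sup>2 / \<rho>1" "\<rho>2 * N2\<^sup>2 = m\<^sup>2 / \<rho>2"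
    using pos by (simp_all add: N power2_eq_square)
  have "(\<gamma> + 1) * (\<rho>2 * N2\<^sup>2) < (\<gamma> + 1) * (\<rho>1 * N1\<^sup>2)"
  proof -
    have e1: "(\<gamma> + 1) * (\<rho>1 * N1\<^sup>2) = \<gamma> * (\<rho>1 * N1\<^sup>2 + p1) + (\<rho>1 * N1\<^sup>2 - \<gamma> * p1)" by (simp add: algebra_simps)
    have e2: "(\<gamma> + 1) * (\<rho>2 * N2\<^sup>2) = \<gamma> * (\<rho>2 * N2\<^sup>2 + p2) + (\<rho>2 * N2\<^sup>2 - \<gamma> * p2)" by (simp add: algebra_simps)
    show ?thesis unfolding e1 e2 using super sub momentum by simp
  qed
  then have "(\<gamma> + 1) * (m\<^sup>2 / \<rho>2) < (\<gamma> + 1) * (m\<^sup>2 / \<rho>1)" unfolding x .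
  then have "m\<^sup>2 / \<rho>2 < m\<^sup>2 / \<rho>1" by (rule mult_left_less_imp_less) (use assms(1) in auto)
  then have "\<rho>1 < \<rho>2" using pos \<open>m \<noteq> 0\<close> by (simp add: divide_less_eq less_divide_eq field_simps mult_less_cancel_left_pos)
  define r where "r = \<rho>2 / \<rho>1"
  have "r > 1" using \<open>\<rho>1 < \<rho>2\<close> pos by (simp add: r_def)
  have r2: "\<rho>2 = r * \<rho>1" using pos by (simp add: r_def)
  have dp: "p2 - p1 = m\<^sup>2 / \<rho>1 - m\<^sup>2 / \<rho>2" using momentum x by linarith
  \<comment> \<open>the Hugoniot relation between the pressures, in terms of the compression ratio\<close>
  have hug: "p2 * ((\<gamma> + 1) - (\<gamma> - 1) * r) = p1 * ((\<gamma> + 1) * r - (\<gamma> - 1))"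
  proof -
    have "\<gamma> / (\<gamma> - 1) * (p2 / \<rho>2 - p1 / \<rho>1) = (m\<^sup>2 / \<rho>1\<^sup>2 - m\<^sup>2 / \<rho>2\<^sup>2) / 2"
      using bernoulli by (simp add: N power_divide algebra_simps diff_divide_distrib)
    also have "\<dots> = (p2 - p1) * (1 / \<rho>1 + 1 / \<rho>2) / 2"
      unfolding dp using pos by (simp add: field_simps power2_eq_square)
    finally have "\<gamma> * (p2 / \<rho>2 - p1 / \<rho>1) = (\<gamma> - 1) * ((p2 - p1) * (1 / \<rho>1 + 1 / \<rho>2) / 2)"
      using assms(1) by (simp add: field_simps)
    note finally_eq = this
    have quot: "p2 / \<rho>2 - p1 / \<rho>1 = (p2 - p1 * r) / (r * \<rho>1)" "1 / \<rho>1 + 1 / \<rho>2 = (r + 1) / (r * \<rho>1)"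
      unfolding r2 using pos \<open>r > 1\<close> by (simp_all add: field_simps)
    have clear: "2 * \<gamma> * X = (\<gamma> - 1) * (Y * Z)"
      if "\<gamma> * (X / q) = (\<gamma> - 1) * (Y * (Z / q) / 2)" "q > 0" for X Y Z q :: real
      using that by (simp add: field_simps)
    have "2 * \<gamma> * (p2 - p1 * r) = (\<gamma> - 1) * ((p2 - p1) * (r + 1))"
      by (rule clear[OF finally_eq[unfolded quot]]) (use pos \<open>r > 1\<close> in auto)
    then show ?thesis by (simp add: algebra_simps)
  qed
  have Apos: "(\<gamma> + 1) * r - (\<gamma> - 1) > 0"
  proof -
    have "(\<gamma> + 1) * 1 < (\<gamma> + 1) * r" using \<open>r > 1\<close> assms(1) by (intro mult_strict_left_mono) auto
    then show ?thesis by simp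
  qed
  have Bpos: "(\<gamma> + 1) - (\<gamma> - 1) * r > 0"
    using hug Apos pos by (metis mult_pos_pos zero_less_mult_pos)
  have "ln p2 + ln ((\<gamma> + 1) - (\<gamma> - 1) * r) = ln p1 + ln ((\<gamma> + 1) * r - (\<gamma> - 1))"
    using hug pos Apos Bpos by (metis ln_mult_pos)
  moreover have "ln \<rho>2 = ln r + ln \<rho>1" using r2 pos \<open>r > 1\<close> by (simp add: ln_mult_pos)
  ultimately show ?thesis using shock_adiabat_gap_pos[OF assms(1) \<open>r > 1\<close> Bpos]
    by (simp add: algebra_simps)
qed

section \<open>Conservation laws along the angle\<close>

lemma bounded_measurable_set_integrable:
  fixes f :: "real \<Rightarrow> 'b::euclidean_space"
  assumes "f \<in> borel_measurable lebesgue" "\<And>x. norm (f x) \<le> B"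
  shows "set_integrable lebesgue {s..t} f"
  unfolding set_integrable_def
proof (rule integrableI_bounded_set_indicator)
  show "emeasure lebesgue {s..t} < \<infinity>" by (cases "s \<le> t") auto
  show "AE x in lebesgue. x \<in> {s..t} \<longrightarrow> norm (f x) \<le> B" using assms(2) by auto
qed (use assms in auto)

text \<open>Right continuity of the integrand makes the indefinite integral differentiable from the right at
  every point, not just almost everywhere. All later differential identities are of this kind.\<close>

lemma
  fixes A R :: "real \<Rightarrow> 'b::euclidean_space"
  assumes meas: "R \<in> borel_measurable lebesgue" and bound: "\<And>x. norm (R x) \<le> B"
    and int: "\<And>s t. s < t \<Longrightarrow> A t - A s = (LINT \<theta>:{s..t}|lebesgue. R \<theta>)"
    and rc: "(R \<longlongrightarrow> R x) (at_right x)"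
  shows indefinite_integral_right_derivative: "(A has_vector_derivative R x) (at_right x)"
    and indefinite_integral_isCont: "isCont A x"
proof -
  have integrable: "R integrable_on {s..t}" for s t
    using bounded_measurable_set_integrable[OF meas bound] by (rule set_lebesgue_integral_eq_integral(1))
  have A: "A t = A s + integral {s..t} R" if "s \<le> t" for s t
  proof (cases "s = t")
    case False
    then have "A t - A s = integral {s..t} R"
      using int[of s t] set_lebesgue_integral_eq_integral(2)[OF bounded_measurable_set_integrable[OF meas bound]] that
      by auto
    then show ?thesis by (simp add: algebra_simps)
  qed simp
  have nhd: "at x within {x..x+1} = at_right x"
    by (rule at_within_nhd[of _ "{..<x+1}"]) auto
  have "((\<lambda>u. integral {x..u} R) has_vector_derivative R x) (at x within ({x..x+1} - {}))"
  proof (rule integral_has_vector_derivative_continuous_at[OF integrable])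
    show "continuous (at x within {x..x + 1} - {}) R"
      using rc by (simp add: continuous_within nhd)
  qed auto
  then have "((\<lambda>u. A x + integral {x..u} R) has_vector_derivative 0 + R x) (at x within {x..x+1})"
    by (intro has_vector_derivative_add has_vector_derivative_const) simp
  then have "(A has_vector_derivative 0 + R x) (at x within {x..x+1})"
  proof (rule has_vector_derivative_transform_within[of _ _ _ _ 1])
    show "A x + integral {x..u} R = A u" if "u \<in> {x..x+1}" for u
      using that by (intro A[symmetric]) simp
  qed auto
  then show "(A has_vector_derivative R x) (at_right x)" by (simp add: nhd)
  have "continuous_on {x-1..x+1} (\<lambda>u. A (x-1) + integral {x-1..u} R)"
    by (intro continuous_intros indefinite_integral_continuous_1 integrable)
  then have "continuous_on {x-1..x+1} A"
    by (rule continuous_on_eq) (rule A[symmetric], simp)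
  then show "isCont A x" by (rule continuous_on_interior) auto
qed

lemma vector_4:
  "(vector [x, y, z, w] :: ('a::zero)^4) $ 1 = x"
  "(vector [x, y, z, w] :: ('a::zero)^4) $ 2 = y"
  "(vector [x, y, z, w] :: ('a::zero)^4) $ 3 = z"
  "(vector [x, y, z, w] :: ('a::zero)^4) $ 4 = w"
  unfolding vector_def by simp_all

lemma flux_x_nth:
  "flux_x \<gamma> W $ 1 = density W * vel_x W"
  "flux_x \<gamma> W $ 2 = density W * (vel_x W)\<^sup>2 + pressure \<gamma> W"
  "flux_x \<gamma> W $ 3 = density W * vel_x W * vel_y W"
  "flux_x \<gamma> W $ 4 = vel_x W * (energy W + pressure \<gamma> W)"
  by (simp_all add: flux_x_def vector_4)

lemma flux_y_nth:
  "flux_y \<gamma> W $ 1 = density W * vel_y W"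
  "flux_y \<gamma> W $ 2 = density W * vel_x W * vel_y W"
  "flux_y \<gamma> W $ 3 = density W * (vel_y W)\<^sup>2 + pressure \<gamma> W"
  "flux_y \<gamma> W $ 4 = vel_y W * (energy W + pressure \<gamma> W)"
  by (simp_all add: flux_y_def vector_4)

lemma tendsto_state_functions:
  fixes g :: "'a \<Rightarrow> real^4"
  assumes "(g \<longlongrightarrow> W) F" "density W \<noteq> 0"
  shows "((\<lambda>x. density (g x)) \<longlongrightarrow> density W) F" "((\<lambda>x. vel_x (g x)) \<longlongrightarrow> vel_x W) F"
    "((\<lambda>x. vel_y (g x)) \<longlongrightarrow> vel_y W) F" "((\<lambda>x. energy (g x)) \<longlongrightarrow> energy W) F"
    "((\<lambda>x. internal_energy (g x)) \<longlongrightarrow> internal_energy W) F"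
    "((\<lambda>x. pressure \<gamma> (g x)) \<longlongrightarrow> pressure \<gamma> W) F"
    "((\<lambda>x. total_enthalpy \<gamma> (g x)) \<longlongrightarrow> total_enthalpy \<gamma> W) F"
  using assms unfolding density_def vel_x_def vel_y_def energy_def internal_energy_def pressure_def total_enthalpy_def
  by (auto intro!: tendsto_intros)

lemma tendsto_polar_functions:
  fixes g :: "real \<Rightarrow> real^4" and h :: "real \<Rightarrow> real"
  assumes "(g \<longlongrightarrow> W) F" "density W \<noteq> 0" "(h \<longlongrightarrow> \<theta>) F"
  shows "((\<lambda>x. radial_velocity (h x) (g x)) \<longlongrightarrow> radial_velocity \<theta> W) F"
    "((\<lambda>x. normal_velocity (h x) (g x)) \<longlongrightarrow> normal_velocity \<theta> W) F"
    "((\<lambda>x. mass_flux (h x) (g x)) \<longlongrightarrow> mass_flux \<theta> W) F"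
    "((\<lambda>x. impulse \<gamma> (h x) (g x)) \<longlongrightarrow> impulse \<gamma> \<theta> W) F"
    "((\<lambda>x. sonic_defect \<gamma> (h x) (g x)) \<longlongrightarrow> sonic_defect \<gamma> \<theta> W) F"
  unfolding radial_velocity_def normal_velocity_def mass_flux_def impulse_def sonic_defect_def
  by (intro tendsto_intros tendsto_state_functions[OF assms(1,2)] assms(3))+

text \<open>The identities behind the rotation of the momentum balance into the frame of the ray: the normal and
  radial momentum fluxes, followed by their derivatives with respect to the angle, where \<open>M\<close> is the
  mass flux, \<open>P\<close> the pressure and \<open>l\<close> the radial velocity.\<close>

lemma rotated_flux_identities:
  fixes c s M u v P r l :: real
  shows "s * (M * u + s * P) - c * (M * v - c * P) = M * (s * u - c * v) + (c * c + s * s) * P"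
    "c * (M * u + s * P) + s * (M * v - c * P) = M * (c * u + s * v)"
    "(c * (M * u + s * P) + (l * (r * u) + c * P) * s) - (- s * (M * v - c * P) + (l * (r * v) + s * P) * c)
      = M * (c * u + s * v) + r * (s * u - c * v) * l"
    "(- s * (M * u + s * P) + (l * (r * u) + c * P) * c) + (c * (M * v - c * P) + (l * (r * v) + s * P) * s)
      = r * l * (c * u + s * v) - M * (s * u - c * v)"
  by (simp_all add: algebra_simps)

lemma borel_measurable_vec_componentwise:
  fixes f :: "'a \<Rightarrow> real^'n"
  assumes "\<And>i. (\<lambda>x. f x $ i) \<in> borel_measurable M"
  shows "f \<in> borel_measurable M"
proof (rule borel_measurable_euclidean_space[THEN iffD2], rule ballI)
  fix b :: "real^'n" assume "b \<in> Basis"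
  then obtain i where "b = axis i 1" unfolding Basis_vec_def Basis_real_def by blast
  then have "(\<lambda>x. f x \<bullet> b) = (\<lambda>x. f x $ i)" by (simp add: inner_axis)
  then show "(\<lambda>x. f x \<bullet> b) \<in> borel_measurable M" using assms[of i] by simp
qed

locale selfsimilar_flow = gas_phase_space +
  fixes c\<^sub>v S\<^sub>0 :: real and U :: "real \<Rightarrow> real^4"
  assumes entropy_factor: "c\<^sub>v > 0"
    and measurable: "U \<in> borel_measurable lebesgue"
    and in_phase_space: "U \<theta> \<in> phase_space K"
    and version: "integrated_version \<gamma> c\<^sub>v S\<^sub>0 U"
    and rc: "right_continuous U"
    and no_stagnation: "no_stagnation_points U"
begin

abbreviation "\<rho> \<theta> \<equiv> density (U \<theta>)"
abbreviation "p \<theta> \<equiv> pressure \<gamma> (U \<theta>)"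
abbreviation "L \<theta> \<equiv> radial_velocity \<theta> (U \<theta>)"
abbreviation "N \<theta> \<equiv> normal_velocity \<theta> (U \<theta>)"
abbreviation "m \<theta> \<equiv> mass_flux \<theta> (U \<theta>)"
abbreviation "I \<theta> \<equiv> impulse \<gamma> \<theta> (U \<theta>)"
abbreviation "H \<theta> \<equiv> total_enthalpy \<gamma> (U \<theta>)"
abbreviation "V \<theta> \<equiv> sonic_defect \<gamma> \<theta> (U \<theta>)"

abbreviation "angular_flux \<equiv> angular_part (flux_x \<gamma>) (flux_y \<gamma>) U"
abbreviation "radial_flux \<equiv> radial_part (flux_x \<gamma>) (flux_y \<gamma>) U"

lemmas state = phase_spaceD[OF in_phase_space]

lemma U_right: "(U \<longlongrightarrow> U \<theta>) (at_right \<theta>)"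
  using rc by (simp add: right_continuous_def continuous_within)

lemma density_nonzero [simp]: "\<rho> \<theta> \<noteq> 0"
  using state(1)[of \<theta>] by simp

lemmas state_right = tendsto_state_functions[OF U_right density_nonzero]
  tendsto_polar_functions[OF U_right density_nonzero tendsto_ident_at]

lemma radial_flux_nth:
  "radial_flux t $ 1 = \<rho> t * L t"
    "radial_flux t $ 2 = L t * U t $ 2 + cos t * p t"
    "radial_flux t $ 3 = L t * U t $ 3 + sin t * p t"
    "radial_flux t $ 4 = L t * (energy (U t) + p t)"
proof -
  note mom = momentum_components(1,2)[OF in_phase_space, of t]
  show "radial_flux t $ 1 = \<rho> t * L t"
    "radial_flux t $ 2 = L t * U t $ 2 + cos t * p t"
    "radial_flux t $ 3 = L t * U t $ 3 + sin t * p t"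
    "radial_flux t $ 4 = L t * (energy (U t) + p t)"
    unfolding radial_part_def mom
    by (simp_all add: flux_x_nth flux_y_nth radial_velocity_def algebra_simps power2_eq_square)
qed

lemma angular_flux_nth:
  "angular_flux t $ 1 = m t"
    "angular_flux t $ 2 = m t * vel_x (U t) + sin t * p t"
    "angular_flux t $ 3 = m t * vel_y (U t) - cos t * p t"
    "angular_flux t $ 4 = m t * H t"
proof -
  have "m t * H t = N t * (energy (U t) + p t)"
    by (simp add: mass_flux_def total_enthalpy_def)
  then show "angular_flux t $ 4 = m t * H t"
    by (simp add: angular_part_def flux_x_nth flux_y_nth normal_velocity_def algebra_simps)
  show "angular_flux t $ 1 = m t"
    "angular_flux t $ 2 = m t * vel_x (U t) + sin t * p t"
    "angular_flux t $ 3 = m t * vel_y (U t) - cos t * p t"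
    unfolding angular_part_def
    by (simp_all add: flux_x_nth flux_y_nth mass_flux_def normal_velocity_def algebra_simps power2_eq_square)
qed

lemma radial_flux_measurable: "radial_flux \<in> borel_measurable lebesgue"
proof (rule borel_measurable_vec_componentwise)
  fix i :: 4
  have nth: "(\<lambda>\<theta>. U \<theta> $ j) \<in> borel_measurable lebesgue" for j
    by (rule measurable_compose[OF measurable borel_measurable_continuous_onI]) (intro continuous_intros)
  have trig: "(cos :: real \<Rightarrow> real) \<in> borel_measurable lebesgue" "(sin :: real \<Rightarrow> real) \<in> borel_measurable lebesgue"
    by (intro measurable_completion borel_measurable_continuous_onI continuous_intros; simp)+
  have "\<forall>i. (\<lambda>\<theta>. radial_flux \<theta> $ i) \<in> borel_measurable lebesgue"
    unfolding forall_4 radial_flux_nth unfolding radial_velocity_def pressure_def internal_energy_def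
      vel_x_def vel_y_def density_def energy_def
    by (intro conjI borel_measurable_add borel_measurable_diff borel_measurable_times borel_measurable_divide
        borel_measurable_power borel_measurable_const nth trig)
  then show "(\<lambda>\<theta>. radial_flux \<theta> $ i) \<in> borel_measurable lebesgue" by blast
qed

lemma radial_flux_bounded:
  "norm (radial_flux t) \<le> 2 * K + 3 * (2 * K\<^sup>2 * (K + (\<gamma> - 1) * K\<^sup>2) + (\<gamma> - 1) * K\<^sup>2)"
proof -
  let ?R = "radial_flux t"
  let ?b = "(\<gamma> - 1) * K\<^sup>2"
  have b0: "0 \<le> ?b" using gamma by simp
  have p: "\<bar>p t\<bar> \<le> ?b" using pressure_le[OF in_phase_space, of t] state(4)[of t] by simp
  have L: "\<bar>L t\<bar> \<le> 2 * K\<^sup>2" using velocity_bounds(3)[OF in_phase_space] .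
  have prod: "\<bar>L t * x\<bar> \<le> 2 * K\<^sup>2 * (K + ?b)" if "\<bar>x\<bar> \<le> K + ?b" for x
    unfolding abs_mult using L that by (intro mult_mono) auto
  have trig: "\<bar>cos t * p t\<bar> \<le> ?b" "\<bar>sin t * p t\<bar> \<le> ?b"
    using mult_mono[OF abs_cos_le_one[of t] p] mult_mono[OF abs_sin_le_one[of t] p] by (auto simp: abs_mult)
  have "\<bar>?R $ 1\<bar> \<le> 2 * K" unfolding radial_flux_nth by (rule velocity_bounds(1)[OF in_phase_space])
  moreover have "\<bar>?R $ 2\<bar> \<le> 2 * K\<^sup>2 * (K + ?b) + ?b"
    unfolding radial_flux_nth using prod[of "U t $ 2"] state(7)[of t 2] trig(1) b0 by linarith
  moreover have "\<bar>?R $ 3\<bar> \<le> 2 * K\<^sup>2 * (K + ?b) + ?b"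
    unfolding radial_flux_nth using prod[of "U t $ 3"] state(7)[of t 3] trig(2) b0 by linarith
  moreover have "\<bar>?R $ 4\<bar> \<le> 2 * K\<^sup>2 * (K + ?b) + ?b"
    unfolding radial_flux_nth using prod[of "energy (U t) + p t"] state(7)[of t 4] p b0
    unfolding energy_def by linarith
  moreover have "norm ?R \<le> (\<Sum>i\<in>UNIV. \<bar>?R $ i\<bar>)" by (rule norm_le_l1_cart)
  ultimately show ?thesis by (simp add: sum_4)
qed

lemma radial_flux_right:
  "(radial_flux \<longlongrightarrow> radial_flux \<theta>) (at_right \<theta>)"
proof (rule vec_tendstoI)
  fix i
  have nth: "((\<lambda>x. U x $ j) \<longlongrightarrow> U \<theta> $ j) (at_right \<theta>)" for j
    by (intro tendsto_intros U_right)
  have "\<forall>i. ((\<lambda>x. radial_flux x $ i) \<longlongrightarrow> radial_flux \<theta> $ i) (at_right \<theta>)"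
    unfolding forall_4 radial_flux_nth by (intro conjI tendsto_intros state_right nth)
  then show "((\<lambda>x. radial_flux x $ i) \<longlongrightarrow> radial_flux \<theta> $ i) (at_right \<theta>)"
    by blast
qed

lemma flux_balance:
  "s < t \<Longrightarrow> angular_flux t - angular_flux s
    = (LINT \<theta>:{s..t}|lebesgue. radial_flux \<theta>)"
  by (rule version[unfolded integrated_version_def, THEN spec, THEN spec, THEN mp, THEN conjunct1])

lemma angular_flux_derivative:
  "((\<lambda>x. angular_flux x $ i) has_real_derivative
    radial_flux \<theta> $ i) (at_right \<theta>)"
  unfolding has_real_derivative_iff_has_vector_derivative
  by (rule bounded_linear.has_vector_derivative[OF bounded_linear_vec_nth])
    (rule indefinite_integral_right_derivative[OF radial_flux_measurable radial_flux_bounded flux_balance radial_flux_right])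

lemma angular_flux_isCont:
  "isCont (\<lambda>x. angular_flux x $ i) \<theta>"
  by (rule bounded_linear.isCont[OF bounded_linear_vec_nth])
    (rule indefinite_integral_isCont[OF radial_flux_measurable radial_flux_bounded flux_balance radial_flux_right])

lemma momentum_combinations:
  "I t = sin t * angular_flux t $ 2 - cos t * angular_flux t $ 3"
  "m t * L t = cos t * angular_flux t $ 2 + sin t * angular_flux t $ 3"
proof -
  show "I t = sin t * angular_flux t $ 2 - cos t * angular_flux t $ 3"
    unfolding angular_flux_nth rotated_flux_identities sin_cos_squared_add3
    by (simp add: impulse_def mass_flux_def normal_velocity_def power2_eq_square)
  show "m t * L t = cos t * angular_flux t $ 2 + sin t * angular_flux t $ 3"
    unfolding angular_flux_nth rotated_flux_identities by (simp add: radial_velocity_def)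
qed

text \<open>The conservation laws in the frame of the ray: mass, normal and radial momentum, and energy.\<close>

lemma flux_derivatives:
  "(m has_real_derivative \<rho> t * L t) (at_right t)"
  "(I has_real_derivative 2 * m t * L t) (at_right t)"
  "((\<lambda>x. m x * L x) has_real_derivative \<rho> t * (L t)\<^sup>2 - \<rho> t * (N t)\<^sup>2) (at_right t)"
  "((\<lambda>x. m x * H x) has_real_derivative \<rho> t * L t * H t) (at_right t)"
proof -
  note mom = momentum_components(1,2)[OF in_phase_space, of t]
  show "(m has_real_derivative \<rho> t * L t) (at_right t)"
    using angular_flux_derivative[of 1 t] by (simp add: radial_flux_nth angular_flux_nth)
  have "\<rho> t * L t * H t = L t * (energy (U t) + p t)" by (simp add: total_enthalpy_def)
  then show "((\<lambda>x. m x * H x) has_real_derivative \<rho> t * L t * H t) (at_right t)"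
    using angular_flux_derivative[of 4 t] unfolding radial_flux_nth angular_flux_nth by (simp only:)
  have sinD: "(sin has_real_derivative cos t) (at_right t)" "(cos has_real_derivative - sin t) (at_right t)"
    by (auto intro!: derivative_eq_intros)
  have "((\<lambda>x. sin x * angular_flux x $ 2 - cos x * angular_flux x $ 3) has_real_derivative
      (cos t * angular_flux t $ 2 + radial_flux t $ 2 * sin t) - (- sin t * angular_flux t $ 3 + radial_flux t $ 3 * cos t)) (at_right t)"
    by (intro DERIV_diff DERIV_mult sinD angular_flux_derivative)
  moreover have "(cos t * angular_flux t $ 2 + radial_flux t $ 2 * sin t) - (- sin t * angular_flux t $ 3 + radial_flux t $ 3 * cos t)
      = 2 * m t * L t"
    unfolding angular_flux_nth radial_flux_nth mom rotated_flux_identities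
    by (simp add: mass_flux_def normal_velocity_def[symmetric] radial_velocity_def[symmetric])
  ultimately show "(I has_real_derivative 2 * m t * L t) (at_right t)"
    by (simp only: momentum_combinations(1)[abs_def])
  have "((\<lambda>x. cos x * angular_flux x $ 2 + sin x * angular_flux x $ 3) has_real_derivative
      (- sin t * angular_flux t $ 2 + radial_flux t $ 2 * cos t) + (cos t * angular_flux t $ 3 + radial_flux t $ 3 * sin t)) (at_right t)"
    by (intro DERIV_add DERIV_mult sinD angular_flux_derivative)
  moreover have "(- sin t * angular_flux t $ 2 + radial_flux t $ 2 * cos t) + (cos t * angular_flux t $ 3 + radial_flux t $ 3 * sin t)
      = \<rho> t * (L t)\<^sup>2 - \<rho> t * (N t)\<^sup>2"
    unfolding angular_flux_nth radial_flux_nth mom rotated_flux_identities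
    by (simp add: mass_flux_def normal_velocity_def[symmetric] radial_velocity_def[symmetric] power2_eq_square)
  ultimately show "((\<lambda>x. m x * L x) has_real_derivative \<rho> t * (L t)\<^sup>2 - \<rho> t * (N t)\<^sup>2) (at_right t)"
    by (simp only: momentum_combinations(2)[abs_def])
qed

lemma flux_isCont:
  "isCont m t" "isCont I t" "isCont (\<lambda>x. m x * L x) t" "isCont (\<lambda>x. m x * H x) t"
proof -
  note c = angular_flux_isCont[where \<theta> = t]
  show "isCont m t" using c[where i = 1] by (simp add: angular_flux_nth)
  show "isCont (\<lambda>x. m x * H x) t" using c[where i = 4] by (simp add: angular_flux_nth)
  show "isCont I t" "isCont (\<lambda>x. m x * L x) t"
    unfolding momentum_combinations by (intro continuous_intros c)+
qed

lemma mass_flux_continuous_on: "continuous_on S m"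
  by (intro continuous_at_imp_continuous_on ballI flux_isCont)

end

section \<open>Sectors without contact discontinuities\<close>

lemma continuous_on_piece:
  fixes f :: "real \<Rightarrow> 'b::topological_space"
  assumes "\<And>x. a < x \<Longrightarrow> x < b \<Longrightarrow> isCont f x" "(f \<longlongrightarrow> f a) (at_right a)" "a \<le> s" "t < b"
  shows "continuous_on {s..t} f"
  unfolding continuous_on_def
proof
  fix x assume x: "x \<in> {s..t}"
  show "(f \<longlongrightarrow> f x) (at x within {s..t})"
  proof (cases "a < x")
    case True
    then have "(f \<longlongrightarrow> f x) (at x)" using assms(1)[of x] x assms(4) by (auto simp: isCont_def)
    then show ?thesis by (rule tendsto_within_subset) simp
  next
    case False
    then have "x = a" "s = a" using x assms(3) by auto
    have "at a within {a..t} \<le> at_right a"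
      unfolding at_within_def by (intro inf_mono order_refl) auto
    then have "(f \<longlongrightarrow> f a) (at a within {a..t})"
      using assms(2) by (rule tendsto_mono)
    then show ?thesis using \<open>x = a\<close> \<open>s = a\<close> by simp
  qed
qed

context selfsimilar_flow
begin

lemma enthalpy_split:
  obtains q where "(\<gamma> - 1) * q = \<gamma> * p t" "\<rho> t * H t = \<rho> t * ((L t)\<^sup>2 + (N t)\<^sup>2) / 2 + q"
  using that[of "\<gamma> / (\<gamma> - 1) * p t"] gamma energy_eq[OF in_phase_space, of t t]
  by (simp add: total_enthalpy_def)

text \<open>Up to a constant factor this is the discriminant of the quadratic equation for the normal velocity
  at given fluxes: the two roots are the two sides of a shock. As a polynomial in the
  conserved fluxes it has no discontinuities.\<close>

lemma sonic_defect_square: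
  "(V t)\<^sup>2 = \<gamma>\<^sup>2 * (I t)\<^sup>2 - 2 * (\<gamma>\<^sup>2 - 1) * (m t * (m t * H t) - (m t * L t)\<^sup>2 / 2)"
proof -
  obtain q where q: "(\<gamma> - 1) * q = \<gamma> * p t"
    and H: "\<rho> t * H t = \<rho> t * ((L t)\<^sup>2 + (N t)\<^sup>2) / 2 + q"
    by (rule enthalpy_split)
  define x where "x = \<rho> t * (N t)\<^sup>2"
  have "m t * (m t * H t) = x * (\<rho> t * H t)"
    by (simp add: mass_flux_def x_def power2_eq_square)
  also have "\<dots> = (m t * L t)\<^sup>2 / 2 + x\<^sup>2 / 2 + x * q"
    unfolding H by (simp add: mass_flux_def x_def power2_eq_square algebra_simps add_divide_distrib)
  finally have e: "m t * (m t * H t) - (m t * L t)\<^sup>2 / 2 = x\<^sup>2 / 2 + x * q" by simp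
  have "2 * (\<gamma>\<^sup>2 - 1) * (x\<^sup>2 / 2 + x * q) = (\<gamma>\<^sup>2 - 1) * x\<^sup>2 + 2 * (\<gamma> + 1) * x * ((\<gamma> - 1) * q)"
    by (simp add: power2_eq_square algebra_simps)
  then show ?thesis
    unfolding e q sonic_defect_def impulse_def x_def[symmetric]
    by (simp add: power2_eq_square algebra_simps)
qed

text \<open>The derivative contains \<open>V\<close> as a factor. So away from shocks either the sonic defect vanishes
  (simple wave) or it moves at a bounded rate.\<close>

lemma sonic_defect_square_derivative:
  "((\<lambda>x. (V x)\<^sup>2) has_real_derivative 4 * m t * L t * V t) (at_right t)"
proof -
  obtain q where q: "(\<gamma> - 1) * q = \<gamma> * p t"
    and H: "\<rho> t * H t = \<rho> t * ((L t)\<^sup>2 + (N t)\<^sup>2) / 2 + q"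
    by (rule enthalpy_split)
  define x where "x = \<rho> t * (N t)\<^sup>2"
  have "((\<lambda>x. \<gamma>\<^sup>2 * (I x)\<^sup>2 - 2 * (\<gamma>\<^sup>2 - 1) * (m x * (m x * H x) - (m x * L x)\<^sup>2 / 2)) has_real_derivative
      \<gamma>\<^sup>2 * (2 * I t * (2 * m t * L t)) - 2 * (\<gamma>\<^sup>2 - 1) *
      (\<rho> t * L t * (m t * H t) + \<rho> t * L t * H t * m t - m t * L t * (\<rho> t * (L t)\<^sup>2 - \<rho> t * (N t)\<^sup>2)))
      (at_right t)"
    by (rule derivative_eq_intros flux_derivatives refl | simp)+
  also have "\<gamma>\<^sup>2 * (2 * I t * (2 * m t * L t)) - 2 * (\<gamma>\<^sup>2 - 1) *
      (\<rho> t * L t * (m t * H t) + \<rho> t * L t * H t * m t - m t * L t * (\<rho> t * (L t)\<^sup>2 - \<rho> t * (N t)\<^sup>2))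
      = m t * L t * (4 * \<gamma>\<^sup>2 * I t - 2 * (\<gamma>\<^sup>2 - 1) * (2 * (\<rho> t * H t) - \<rho> t * (L t)\<^sup>2 + \<rho> t * (N t)\<^sup>2))"
    by (simp add: algebra_simps)
  also have "2 * (\<rho> t * H t) - \<rho> t * (L t)\<^sup>2 + \<rho> t * (N t)\<^sup>2 = 2 * x + 2 * q"
    unfolding H x_def by (simp add: algebra_simps)
  also have "4 * \<gamma>\<^sup>2 * I t - 2 * (\<gamma>\<^sup>2 - 1) * (2 * x + 2 * q)
      = 4 * \<gamma>\<^sup>2 * I t - 4 * (\<gamma>\<^sup>2 - 1) * x - 4 * (\<gamma> + 1) * ((\<gamma> - 1) * q)"
    by (simp add: power2_eq_square algebra_simps)
  also have "\<dots> = 4 * V t"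
    unfolding q sonic_defect_def impulse_def x_def[symmetric] by (simp add: power2_eq_square algebra_simps)
  finally show ?thesis unfolding sonic_defect_square by (simp add: mult_ac)
qed

lemma mass_flux_radial_le: "\<bar>m t * L t\<bar> \<le> 4 * K ^ 3"
proof -
  have "\<bar>m t\<bar> * \<bar>L t\<bar> \<le> (2 * K) * (2 * K\<^sup>2)"
    unfolding mass_flux_def using velocity_bounds[OF in_phase_space] K by (intro mult_mono) auto
  then show ?thesis by (simp add: abs_mult power2_eq_square power3_eq_cube)
qed

text \<open>From \<open>(V\<^sup>2)' = 4 m L V\<close> one reads off \<open>\<bar>V\<bar>' \<le> 2 \<bar>m L\<bar>\<close>, also at zeros of \<open>V\<close>. The estimate holds across
  shocks and contact discontinuities, because only continuous quantities enter \<open>V\<^sup>2\<close>.\<close>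

lemma abs_sonic_defect_lipschitz:
  assumes "s \<le> t"
  shows "\<bar>\<bar>V t\<bar> - \<bar>V s\<bar>\<bar> \<le> 8 * K ^ 3 * (t - s)"
proof -
  \<comment> \<open>The regularised root is differentiable also where \<open>V\<close> vanishes.\<close>
  have reg: "\<bar>sqrt ((V t)\<^sup>2 + e) - sqrt ((V s)\<^sup>2 + e)\<bar> \<le> 8 * K ^ 3 * (t - s)" if "e > 0" for e
  proof (rule abs_increment_le_of_right_derivative_le[OF _ assms, of "\<lambda>x. sqrt ((V x)\<^sup>2 + e)"])
    show "continuous_on {s..t} (\<lambda>x. sqrt ((V x)\<^sup>2 + e))"
    proof (intro continuous_at_imp_continuous_on ballI)
      fix x
      have comp: "isCont (\<lambda>x. sqrt (\<gamma>\<^sup>2 * (f x)\<^sup>2 - 2 * (\<gamma>\<^sup>2 - 1) * (g x * h x - (k x)\<^sup>2 / 2) + e)) x"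
        if "isCont f x" "isCont g x" "isCont h x" "isCont k x" for f g h k :: "real \<Rightarrow> real"
        by (intro continuous_intros that) auto
      show "isCont (\<lambda>x. sqrt ((V x)\<^sup>2 + e)) x"
        unfolding sonic_defect_square by (rule comp[OF flux_isCont(2,1,4,3)])
    qed
    fix x
    have pos: "(V x)\<^sup>2 + e > 0" using that by (simp add: add_nonneg_pos)
    have shifted: "((\<lambda>x. (V x)\<^sup>2 + e) has_real_derivative 4 * m x * L x * V x + 0) (at_right x)"
      by (intro DERIV_add sonic_defect_square_derivative DERIV_const)
    have "((\<lambda>x. sqrt ((V x)\<^sup>2 + e)) has_real_derivative inverse (sqrt ((V x)\<^sup>2 + e)) / 2 * (4 * m x * L x * V x)) (at_right x)"
      using DERIV_chain2[where f = sqrt and g = "\<lambda>x. (V x)\<^sup>2 + e" and x = x and s = "{x<..}", OF DERIV_real_sqrt[OF pos] shifted]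
      by simp
    moreover have "\<bar>inverse (sqrt ((V x)\<^sup>2 + e)) / 2 * (4 * m x * L x * V x)\<bar> \<le> 8 * K ^ 3"
    proof -
      have s: "sqrt ((V x)\<^sup>2 + e) > 0" using pos by simp
      have "\<bar>V x\<bar> \<le> sqrt ((V x)\<^sup>2 + e)" using that by (intro real_le_rsqrt) simp
      then have "\<bar>V x\<bar> / sqrt ((V x)\<^sup>2 + e) \<le> 1" using s by simp
      then have "\<bar>m x * L x\<bar> * (\<bar>V x\<bar> / sqrt ((V x)\<^sup>2 + e)) \<le> 4 * K ^ 3 * 1"
        using mass_flux_radial_le[of x] K s by (intro mult_mono) auto
      note bound = this
      have "\<bar>inverse r / 2 * (4 * a * b * v)\<bar> = 2 * (\<bar>a * b\<bar> * (\<bar>v\<bar> / r))" if "r > 0" for r a b v :: real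
        using that by (simp add: abs_mult inverse_eq_divide)
      from this[OF s, of "m x" "L x" "V x"] bound show ?thesis by linarith
    qed
    ultimately show "\<exists>y. \<bar>y\<bar> \<le> 8 * K ^ 3 \<and> ((\<lambda>x. sqrt ((V x)\<^sup>2 + e)) has_real_derivative y) (at_right x)"
      by blast
  qed
  have "\<bar>sqrt ((V t)\<^sup>2 + 0) - sqrt ((V s)\<^sup>2 + 0)\<bar> \<le> 8 * K ^ 3 * (t - s)"
  proof (rule tendsto_upperbound)
    show "((\<lambda>e. \<bar>sqrt ((V t)\<^sup>2 + e) - sqrt ((V s)\<^sup>2 + e)\<bar>) \<longlongrightarrow> \<bar>sqrt ((V t)\<^sup>2 + 0) - sqrt ((V s)\<^sup>2 + 0)\<bar>) (at_right 0)"
      by (intro tendsto_intros)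
    show "\<forall>\<^sub>F e in at_right 0. \<bar>sqrt ((V t)\<^sup>2 + e) - sqrt ((V s)\<^sup>2 + e)\<bar> \<le> 8 * K ^ 3 * (t - s)"
      using eventually_at_right_less[of 0] by eventually_elim (rule reg)
  qed simp
  then show ?thesis by simp
qed

text \<open>Between zeros of the mass flux the radial velocity and the enthalpy are quotients of continuous
  fluxes, so they are continuous even across shocks.\<close>

lemma piece_derivatives:
  assumes nz: "\<And>x. a < x \<Longrightarrow> x < b \<Longrightarrow> m x \<noteq> 0" and x: "a < x" "x < b"
  shows "isCont L x" "isCont H x"
    "(L has_real_derivative - N x) (at_right x)" "(H has_real_derivative 0) (at_right x)"
proof -
  have ev: "\<forall>\<^sub>F y in at x. y \<in> {a<..<b}" using x by (intro eventually_at_in_open') auto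
  have L_eq: "L y = (m y * L y) / m y" and H_eq: "H y = (m y * H y) / m y" if "y \<in> {a<..<b}" for y
    using nz[of y] that by auto
  have "((\<lambda>y. (m y * L y) / m y) \<longlongrightarrow> (m x * L x) / m x) (at x)" "((\<lambda>y. (m y * H y) / m y) \<longlongrightarrow> (m x * H x) / m x) (at x)"
    by (intro tendsto_divide flux_isCont[unfolded isCont_def] nz[OF x])+
  moreover have "\<forall>\<^sub>F y in at x. (m y * L y) / m y = L y" "\<forall>\<^sub>F y in at x. (m y * H y) / m y = H y"
    using ev by (auto elim!: eventually_mono simp: nz)
  ultimately show "isCont L x" "isCont H x"
    using nz[OF x] unfolding isCont_def by (auto dest: Lim_transform_eventually)
  have evr: "\<forall>\<^sub>F y in at_right x. y \<in> {x<..<b}" using x by (intro eventually_at_right_real)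
  have mx: "m x = \<rho> x * N x" by (simp add: mass_flux_def)
  have "((\<lambda>y. (m y * L y) / m y) has_real_derivative
      ((\<rho> x * (L x)\<^sup>2 - \<rho> x * (N x)\<^sup>2) * m x - (m x * L x) * (\<rho> x * L x)) / (m x * m x)) (at_right x)"
    by (intro DERIV_divide flux_derivatives nz[OF x])
  also have "((\<rho> x * (L x)\<^sup>2 - \<rho> x * (N x)\<^sup>2) * m x - (m x * L x) * (\<rho> x * L x)) / (m x * m x) = - N x"
  proof -
    have "(\<rho> x * (L x)\<^sup>2 - \<rho> x * (N x)\<^sup>2) * m x - (m x * L x) * (\<rho> x * L x) = - N x * (m x * m x)"
      unfolding mx by (simp add: power2_eq_square algebra_simps)
    then show ?thesis using nz[OF x] by simp
  qed
  finally show "(L has_real_derivative - N x) (at_right x)"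
  proof (rule has_field_derivative_cong_eventually[THEN iffD1, rotated 2])
    show "\<forall>\<^sub>F y in at_right x. (m y * L y) / m y = L y"
      using evr x by (auto elim!: eventually_mono simp: nz)
  qed (use nz[OF x] in simp)
  have "((\<lambda>y. (m y * H y) / m y) has_real_derivative
      ((\<rho> x * L x * H x) * m x - (m x * H x) * (\<rho> x * L x)) / (m x * m x)) (at_right x)"
    by (intro DERIV_divide flux_derivatives nz[OF x])
  also have "((\<rho> x * L x * H x) * m x - (m x * H x) * (\<rho> x * L x)) / (m x * m x) = 0" by simp
  finally show "(H has_real_derivative 0) (at_right x)"
  proof (rule has_field_derivative_cong_eventually[THEN iffD1, rotated 2])
    show "\<forall>\<^sub>F y in at_right x. (m y * H y) / m y = H y"
      using evr x by (auto elim!: eventually_mono simp: nz)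
  qed (use nz[OF x] in simp)
qed

lemma piece_continuous_on:
  assumes nz: "\<And>x. a < x \<Longrightarrow> x < b \<Longrightarrow> m x \<noteq> 0" and "a \<le> s" "t < b"
  shows "continuous_on {s..t} L" "continuous_on {s..t} H"
  using assms(2,3) by (auto intro!: continuous_on_piece[of a b] piece_derivatives[OF nz] state_right)

lemma piece_state_controlled:
  assumes C: "controls_states C"
    and nz: "\<And>x. a < x \<Longrightarrow> x < b \<Longrightarrow> m x \<noteq> 0" and st: "a \<le> s" "s \<le> t" "t < b"
  shows "norm (U t - U s) \<le> C * ((t - s) + \<bar>V t - V s\<bar>)"
proof -
  let ?\<delta> = "(t - s) + \<bar>V t - V s\<bar>"
  have d: "c * (t - s) \<le> c * ?\<delta>" if "c \<ge> 0" for c using that by (intro mult_left_mono) auto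
  have K0: "K \<ge> 0" using K by simp
  have "\<bar>L t - L s\<bar> \<le> 2 * K\<^sup>2 * (t - s)"
  proof (rule abs_increment_le_of_right_derivative_le[OF piece_continuous_on(1)[OF nz st(1,3)] st(2)])
    fix x assume "s < x" "x < t"
    then have x: "a < x" "x < b" using st by auto
    show "\<exists>y. \<bar>y\<bar> \<le> 2 * K\<^sup>2 \<and> (L has_real_derivative y) (at_right x)"
      using piece_derivatives(3)[OF nz x] velocity_bounds(4)[OF in_phase_space, of x x]
      by (intro exI[of _ "- N x"]) auto
  qed auto
  then have dL: "\<bar>L t - L s\<bar> \<le> 2 * K\<^sup>2 * ?\<delta>" using d[of "2 * K\<^sup>2"] by auto
  have "\<bar>H t - H s\<bar> \<le> 0 * (t - s)"
  proof (rule abs_increment_le_of_right_derivative_le[OF piece_continuous_on(2)[OF nz st(1,3)] st(2)])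
    fix x assume "s < x" "x < t"
    then have x: "a < x" "x < b" using st by auto
    show "\<exists>y. \<bar>y\<bar> \<le> 0 \<and> (H has_real_derivative y) (at_right x)"
      using piece_derivatives(4)[OF nz x] by (intro exI[of _ 0]) auto
  qed auto
  then have dH: "H t = H s" by simp
  have "\<bar>m t - m s\<bar> \<le> 2 * K * (t - s)"
  proof (rule abs_increment_le_of_right_derivative_le[OF _ st(2)])
    show "continuous_on {s..t} m" by (rule mass_flux_continuous_on)
    show "\<exists>y. \<bar>y\<bar> \<le> 2 * K \<and> (m has_real_derivative y) (at_right x)" for x
      using flux_derivatives(1)[of x] velocity_bounds(1)[OF in_phase_space, of x x] by blast
  qed
  then have dm: "\<bar>m t - m s\<bar> \<le> 2 * K * ?\<delta>" using d[of "2 * K"] K0 by auto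
  have "\<bar>I t - I s\<bar> \<le> 8 * K ^ 3 * (t - s)"
  proof (rule abs_increment_le_of_right_derivative_le[OF _ st(2)])
    show "continuous_on {s..t} I" by (intro continuous_at_imp_continuous_on ballI flux_isCont)
    show "\<exists>y. \<bar>y\<bar> \<le> 8 * K ^ 3 \<and> (I has_real_derivative y) (at_right x)" for x
      using flux_derivatives(2)[of x] mass_flux_radial_le[of x]
      by (intro exI[of _ "2 * m x * L x"]) (auto simp: abs_mult)
  qed
  then have dI: "\<bar>I t - I s\<bar> \<le> 8 * K ^ 3 * ?\<delta>" using d[of "8 * K ^ 3"] K0 by auto
  show ?thesis
    using C[unfolded controls_states_def, THEN conjunct2, rule_format,
        OF in_phase_space in_phase_space _ dL dH dm dI] st by simp
qed

lemma sonic_defect_bounded: "\<bar>V \<theta>\<bar> \<le> 4 * K ^ 3 + \<gamma> * ((\<gamma> - 1) * K\<^sup>2)"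
proof -
  have "\<rho> \<theta> * (N \<theta>)\<^sup>2 = (\<rho> \<theta> * N \<theta>) * N \<theta>" by (simp add: power2_eq_square)
  then have "\<bar>\<rho> \<theta> * (N \<theta>)\<^sup>2\<bar> = \<bar>\<rho> \<theta> * N \<theta>\<bar> * \<bar>N \<theta>\<bar>" by (simp only: abs_mult)
  also have "\<dots> \<le> (2 * K) * (2 * K\<^sup>2)"
    using velocity_bounds[OF in_phase_space] K by (intro mult_mono) auto
  finally have "\<bar>\<rho> \<theta> * (N \<theta>)\<^sup>2\<bar> \<le> 4 * K ^ 3" by (simp add: power2_eq_square power3_eq_cube)
  moreover have "\<bar>\<gamma> * p \<theta>\<bar> \<le> \<gamma> * ((\<gamma> - 1) * K\<^sup>2)"
    using pressure_le[OF in_phase_space, of \<theta>] state(4)[of \<theta>] gamma by (simp add: abs_mult)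
  ultimately show ?thesis unfolding sonic_defect_def by linarith
qed

end

section \<open>Entropy condition and admissible jumps\<close>

context gas_phase_space
begin

text \<open>Left limits of the flow are again states, although the flow need not attain them.\<close>

lemma closed_phase_space:
  assumes "(g \<longlongrightarrow> W) F" "F \<noteq> bot" "\<And>x. g x \<in> phase_space K"
  shows "W \<in> phase_space K"
proof -
  have nth: "((\<lambda>x. g x $ i) \<longlongrightarrow> W $ i) F" for i by (intro tendsto_intros assms)
  have d: "((\<lambda>x. density (g x)) \<longlongrightarrow> density W) F" unfolding density_def by (rule nth)
  have ge: "inverse K \<le> density W"
    using phase_spaceD(2)[OF assms(3)] by (intro tendsto_lowerbound[OF d _ assms(2)]) auto
  have "inverse K > 0" using K by simp
  then have "density W \<noteq> 0" using ge by linarith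
  note lim = tendsto_state_functions[OF assms(1) this]
  have "density W \<le> K"
    using phase_spaceD(3)[OF assms(3)] by (intro tendsto_upperbound[OF d _ assms(2)]) auto
  moreover have "inverse K \<le> internal_energy W"
    using phase_spaceD(5)[OF assms(3)] by (intro tendsto_lowerbound[OF lim(5) _ assms(2)]) auto
  moreover have "internal_energy W \<le> K"
    using phase_spaceD(6)[OF assms(3)] by (intro tendsto_upperbound[OF lim(5) _ assms(2)]) auto
  moreover have "norm W \<le> K"
  proof (rule tendsto_upperbound[OF tendsto_norm[OF assms(1)] _ assms(2)])
    show "\<forall>\<^sub>F x in F. norm (g x) \<le> K" using assms(3) by (auto simp: phase_space_def)
  qed
  ultimately show ?thesis using ge by (simp add: phase_space_def)
qed

lemma entropy_eq:
  assumes "W \<in> phase_space K"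
  shows "entropy \<gamma> c S W = c * (ln (pressure \<gamma> W) - \<gamma> * ln (density W)) + S"
  using phase_spaceD[OF assms] by (simp add: entropy_def ln_mult ln_powr)

lemma entropy_bounded:
  assumes "W \<in> phase_space K"
  shows "\<bar>entropy \<gamma> c S W\<bar> \<le> \<bar>c\<bar> * (\<bar>ln (\<gamma> - 1)\<bar> + 2 * ln K + \<gamma> * ln K) + \<bar>S\<bar>"
proof -
  note W = phase_spaceD[OF assms]
  have Kp: "inverse K > 0" using K by simp
  have ln_le: "\<bar>ln x\<bar> \<le> ln K" if "inverse K \<le> x" "x \<le> K" for x
  proof -
    have "x > 0" using that Kp by linarith
    have "ln (inverse K) \<le> ln x" using that(1) Kp \<open>x > 0\<close> by (subst ln_le_cancel_iff)
    moreover have "ln x \<le> ln K" using that(2) \<open>x > 0\<close> by simp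
    ultimately show ?thesis using K by (simp add: ln_inverse)
  qed
  have "internal_energy W > 0" using W(5) Kp by linarith
  then have "ln (pressure \<gamma> W) = ln (\<gamma> - 1) + ln (density W) + ln (internal_energy W)"
    using W(1) gamma by (simp add: pressure_def ln_mult)
  then have "\<bar>ln (pressure \<gamma> W) - \<gamma> * ln (density W)\<bar>
      \<le> \<bar>ln (\<gamma> - 1)\<bar> + \<bar>ln (density W)\<bar> + \<bar>ln (internal_energy W)\<bar> + \<bar>\<gamma> * ln (density W)\<bar>"
    by linarith
  also have "\<dots> \<le> \<bar>ln (\<gamma> - 1)\<bar> + 2 * ln K + \<gamma> * ln K"
  proof -
    have "\<bar>\<gamma> * ln (density W)\<bar> \<le> \<gamma> * ln K" using ln_le[OF W(2,3)] gamma by (simp add: abs_mult)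
    then show ?thesis using ln_le[OF W(2,3)] ln_le[OF W(5,6)] by linarith
  qed
  finally have "\<bar>c\<bar> * \<bar>ln (pressure \<gamma> W) - \<gamma> * ln (density W)\<bar> \<le> \<bar>c\<bar> * (\<bar>ln (\<gamma> - 1)\<bar> + 2 * ln K + \<gamma> * ln K)"
    by (intro mult_left_mono) auto
  then show ?thesis unfolding entropy_eq[OF assms]
    using abs_triangle_ineq[of "c * (ln (pressure \<gamma> W) - \<gamma> * ln (density W))" S] by (simp add: abs_mult)
qed

end

text \<open>If the function is not integrable, its integral is zero by convention, so the bound holds anyway.\<close>

lemma set_integral_le_of_bounded:
  fixes f :: "real \<Rightarrow> real"
  assumes "\<And>x. \<bar>f x\<bar> \<le> B" "s \<le> t"
  shows "(LINT x:{s..t}|lebesgue. f x) \<le> B * (t - s)"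
proof (cases "integrable lebesgue (\<lambda>x. indicator {s..t} x *\<^sub>R f x)")
  case True
  have B: "B \<ge> 0" using assms(1)[of 0] by simp
  have "(LINT x:{s..t}|lebesgue. f x) \<le> (\<integral>x. indicator {s..t} x *\<^sub>R B \<partial>lebesgue)"
    unfolding set_lebesgue_integral_def
  proof (rule integral_mono[OF True])
    show "integrable lebesgue (\<lambda>x. indicator {s..t} x *\<^sub>R B)"
      by (rule integrableI_bounded_set_indicator[where B = B]) (use assms(2) B in auto)
    show "indicator {s..t} x *\<^sub>R f x \<le> indicator {s..t} x *\<^sub>R B" for x
      using assms(1)[of x] by (auto simp: indicator_def)
  qed
  also have "\<dots> = B * (t - s)" using assms(2) by simp
  finally show ?thesis .
next
  case False
  have "B \<ge> 0" using assms(1)[of 0] by simp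
  then show ?thesis using False assms(2)
    by (simp add: set_lebesgue_integral_def not_integrable_integral_eq)
qed

context selfsimilar_flow
begin

abbreviation "Entropy W \<equiv> entropy \<gamma> c\<^sub>v S\<^sub>0 W"

lemmas left_limit_in_phase_space = closed_phase_space[OF _ trivial_limit_at_left_real in_phase_space]

lemma entropy_balance:
  "\<exists>B. \<forall>s t. s < t \<longrightarrow> m t * Entropy (U t) - m s * Entropy (U s) \<le> B * (t - s)"
proof -
  have ang: "angular_part (entropy_flux_x \<gamma> c\<^sub>v S\<^sub>0) (entropy_flux_y \<gamma> c\<^sub>v S\<^sub>0) U x = m x * Entropy (U x)" for x
    by (simp add: angular_part_def entropy_flux_x_def entropy_flux_y_def mass_flux_def normal_velocity_def algebra_simps)
  have rad: "radial_part (entropy_flux_x \<gamma> c\<^sub>v S\<^sub>0) (entropy_flux_y \<gamma> c\<^sub>v S\<^sub>0) U x = (\<rho> x * L x) * Entropy (U x)" for x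
    by (simp add: radial_part_def entropy_flux_x_def entropy_flux_y_def radial_velocity_def algebra_simps)
  define B where "B = 2 * K * (\<bar>c\<^sub>v\<bar> * (\<bar>ln (\<gamma> - 1)\<bar> + 2 * ln K + \<gamma> * ln K) + \<bar>S\<^sub>0\<bar>)"
  have bound: "\<bar>(\<rho> \<theta> * L \<theta>) * Entropy (U \<theta>)\<bar> \<le> B" for \<theta>
    unfolding B_def abs_mult[of "\<rho> \<theta> * L \<theta>"]
    using velocity_bounds(1)[OF in_phase_space] entropy_bounded[OF in_phase_space] K
    by (intro mult_mono) auto
  have "m t * Entropy (U t) - m s * Entropy (U s) \<le> B * (t - s)" if "s < t" for s t
    using version[unfolded integrated_version_def, THEN spec, THEN spec, THEN mp, THEN conjunct2, OF that]
      set_integral_le_of_bounded[where f = "\<lambda>\<theta>. (\<rho> \<theta> * L \<theta>) * Entropy (U \<theta>)", OF bound, of s t] that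
    unfolding ang rad by linarith
  then show ?thesis by blast
qed

lemma entropy_jump_sign:
  assumes W: "(U \<longlongrightarrow> W) (at_left d)"
  shows "m d * (Entropy (U d) - Entropy W) \<le> 0"
proof -
  note Wp = left_limit_in_phase_space[OF W]
  note Wpos = phase_spaceD[OF Wp]
  obtain B where B: "\<And>s t. s < t \<Longrightarrow> m t * Entropy (U t) - m s * Entropy (U s) \<le> B * (t - s)"
    using entropy_balance by auto
  have dn: "density W \<noteq> 0" using Wpos(1) by simp
  note lim = tendsto_state_functions[OF W dn] tendsto_polar_functions[OF W dn tendsto_ident_at]
  have lim_S: "((\<lambda>x. Entropy (U x)) \<longlongrightarrow> Entropy W) (at_left d)"
    unfolding entropy_eq[OF in_phase_space] entropy_eq[OF Wp]
    using Wpos by (intro tendsto_intros lim) auto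
  have lim_m: "(m \<longlongrightarrow> m d) (at_left d)"
    using flux_isCont(1)[of d] unfolding isCont_def by (rule tendsto_within_subset) simp
  have "m d * Entropy (U d) - m d * Entropy W \<le> B * (d - d)"
  proof (rule tendsto_le[OF trivial_limit_at_left_real])
    show "((\<lambda>x. m d * Entropy (U d) - m x * Entropy (U x)) \<longlongrightarrow> m d * Entropy (U d) - m d * Entropy W) (at_left d)"
      by (intro tendsto_intros lim_m lim_S)
    show "((\<lambda>x. B * (d - x)) \<longlongrightarrow> B * (d - d)) (at_left d)" by (intro tendsto_intros)
    show "\<forall>\<^sub>F x in at_left d. m d * Entropy (U d) - m x * Entropy (U x) \<le> B * (d - x)"
      using eventually_at_left_real[of "d - 1" d, simplified] by eventually_elim (simp add: B)
  qed
  then show ?thesis by (simp add: right_diff_distrib)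
qed

text \<open>The Rankine--Hugoniot conditions: continuity of the fluxes transfers to the left limit.\<close>

lemma limit_fluxes:
  assumes W: "(U \<longlongrightarrow> W) (at_left d)" and "m d \<noteq> 0"
  shows "mass_flux d W = m d" "impulse \<gamma> d W = I d" "radial_velocity d W = L d" "total_enthalpy \<gamma> W = H d"
proof -
  note Wp = left_limit_in_phase_space[OF W]
  have dn: "density W \<noteq> 0" using phase_spaceD(1)[OF Wp] by simp
  note lim = tendsto_state_functions[OF W dn] tendsto_polar_functions[OF W dn tendsto_ident_at]
  have left: "(f \<longlongrightarrow> f d) (at_left d)" if "isCont f d" for f :: "real \<Rightarrow> real"
    using that unfolding isCont_def by (rule tendsto_within_subset) simp
  note uniq = tendsto_unique[OF trivial_limit_at_left_real]
  show md: "mass_flux d W = m d" by (rule uniq[OF lim(10) left[OF flux_isCont(1)]])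
  show "impulse \<gamma> d W = I d" by (rule uniq[OF lim(11) left[OF flux_isCont(2)]])
  have "mass_flux d W * radial_velocity d W = m d * L d"
    by (rule uniq[OF tendsto_mult[OF lim(10,8)] left[OF flux_isCont(3)]])
  then show "radial_velocity d W = L d" using md assms(2) by simp
  have "mass_flux d W * total_enthalpy \<gamma> W = m d * H d"
    by (rule uniq[OF tendsto_mult[OF lim(10,7)] left[OF flux_isCont(4)]])
  then show "total_enthalpy \<gamma> W = H d" using md assms(2) by simp
qed

lemma entropy_lt_across_shock:
  assumes W: "W \<in> phase_space K" "W' \<in> phase_space K"
    and eq: "mass_flux d W = mass_flux d W'" "impulse \<gamma> d W = impulse \<gamma> d W'"
      "radial_velocity d W = radial_velocity d W'" "total_enthalpy \<gamma> W = total_enthalpy \<gamma> W'"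
    and "mass_flux d W \<noteq> 0" "sonic_defect \<gamma> d W > 0" "sonic_defect \<gamma> d W' < 0"
  shows "Entropy W < Entropy W'"
proof -
  note pW = phase_spaceD[OF W(1)] and pW' = phase_spaceD[OF W(2)]
  have bern: "(normal_velocity d Z)\<^sup>2 / 2 + \<gamma> / (\<gamma> - 1) * pressure \<gamma> Z / density Z
      = total_enthalpy \<gamma> Z - (radial_velocity d Z)\<^sup>2 / 2" if "Z \<in> phase_space K" for Z
  proof -
    have r: "density Z > 0" using phase_spaceD(1)[OF that] .
    have "total_enthalpy \<gamma> Z - (radial_velocity d Z)\<^sup>2 / 2
        = (density Z * (normal_velocity d Z)\<^sup>2 / 2 + \<gamma> / (\<gamma> - 1) * pressure \<gamma> Z) / density Z"
      unfolding enthalpy_eq[OF that, symmetric] using r by simp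
    also have "\<dots> = (normal_velocity d Z)\<^sup>2 / 2 + \<gamma> / (\<gamma> - 1) * pressure \<gamma> Z / density Z"
      unfolding add_divide_distrib using r by simp
    finally show ?thesis by simp
  qed
  have "ln (pressure \<gamma> W) - \<gamma> * ln (density W) < ln (pressure \<gamma> W') - \<gamma> * ln (density W')"
  proof (rule entropy_increases_across_shock[OF gamma pW(1) pW'(1) pW(4) pW'(4)])
    show "(normal_velocity d W)\<^sup>2 / 2 + \<gamma> / (\<gamma> - 1) * pressure \<gamma> W / density W
      = (normal_velocity d W')\<^sup>2 / 2 + \<gamma> / (\<gamma> - 1) * pressure \<gamma> W' / density W'"
      unfolding bern[OF W(1)] bern[OF W(2)] using eq by simp
  qed (use assms(3-) in \<open>auto simp: mass_flux_def impulse_def sonic_defect_def\<close>)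
  then show ?thesis using entropy_factor by (simp add: entropy_eq[OF W(1)] entropy_eq[OF W(2)])
qed

text \<open>The fluid crosses the ray from larger to smaller angles if \<open>m > 0\<close>, and the other way round
  otherwise; in both cases the jump excluded here would let the entropy decrease along the motion.\<close>

lemma no_reverse_shock:
  assumes W: "(U \<longlongrightarrow> W) (at_left d)" and md: "m d \<noteq> 0"
    and "m d * sonic_defect \<gamma> d W > 0" "m d * V d < 0"
  shows False
proof -
  note Wp = left_limit_in_phase_space[OF W]
  note eq = limit_fluxes[OF W md] and S = entropy_jump_sign[OF W]
  show False
  proof (cases "m d > 0")
    case True
    then have "sonic_defect \<gamma> d W > 0" "V d < 0" using assms(3,4) by (auto simp: zero_less_mult_iff mult_less_0_iff)
    then have "Entropy W < Entropy (U d)"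
      using eq md by (intro entropy_lt_across_shock[OF Wp in_phase_space, of d]) auto
    then have "m d * (Entropy (U d) - Entropy W) > 0" using True by simp
    then show False using S by linarith
  next
    case False
    then have mneg: "m d < 0" using md by simp
    then have "sonic_defect \<gamma> d W < 0" "V d > 0" using assms(3,4) by (auto simp: zero_less_mult_iff mult_less_0_iff)
    then have "Entropy (U d) < Entropy W"
      using eq md by (intro entropy_lt_across_shock[OF in_phase_space Wp, of _ d]) auto
    then have "m d * (Entropy (U d) - Entropy W) > 0" using mneg by (simp add: mult_neg_neg)
    then show False using S by linarith
  qed
qed

text \<open>The sign of the sonic defect, oriented by the sign \<open>\<sigma>\<close> of the mass flux, cannot change from positive to
  negative without a sonic point, since that would have to be a reverse shock.\<close>

lemma sonic_defect_jumps_up: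
  assumes C: "controls_states C" and nz: "\<And>x. a < x \<Longrightarrow> x < b \<Longrightarrow> m x \<noteq> 0"
    and \<sigma>: "\<bar>\<sigma>\<bar> = 1" "\<And>x. a < x \<Longrightarrow> x < b \<Longrightarrow> \<sigma> * m x > 0"
    and st: "a \<le> s" "s < t" "t < b" and V: "\<And>x. s \<le> x \<Longrightarrow> x \<le> t \<Longrightarrow> V x \<noteq> 0" and pos: "\<sigma> * V s > 0"
  shows "\<sigma> * V t > 0"
proof (rule ccontr)
  assume "\<not> \<sigma> * V t > 0"
  moreover have snz: "\<sigma> * V x \<noteq> 0" if "s \<le> x" "x \<le> t" for x using V[OF that] \<sigma>(1) by auto
  ultimately have neg: "\<sigma> * V t < 0" using st by (metis less_imp_le linorder_neqE_linordered_idom order_refl)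
  obtain d where "s < d" and d_le_t: "d \<le> t" and Vd: "\<sigma> * V d < 0" and before: "\<And>x. s \<le> x \<Longrightarrow> x < d \<Longrightarrow> \<sigma> * V x > 0"
  proof (rule first_sign_change[of s t "\<lambda>x. - (\<sigma> * V x)"])
    show "((\<lambda>x. - (\<sigma> * V x)) \<longlongrightarrow> - (\<sigma> * V x)) (at_right x)" for x
      by (intro tendsto_intros state_right)
  qed (use st pos neg snz in auto)
  have ad: "a < d" "d < b" using \<open>s < d\<close> st d_le_t by auto
  have C0: "C > 0" using C by (simp add: controls_states_def)
  \<comment> \<open>Before \<open>d\<close> the sign of \<open>V\<close> is fixed, so \<open>V\<close> and with it \<open>U\<close> are Lipschitz up to \<open>d\<close>.\<close>
  obtain W where W: "(U \<longlongrightarrow> W) (at_left d)"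
  proof (rule tendsto_at_left_if_lipschitz[OF \<open>s < d\<close>, of U "C * (1 + 8 * K ^ 3)"])
    fix x y assume xy: "s \<le> x" "x \<le> y" "y < d"
    have "\<bar>V y - V x\<bar> = \<bar>\<sigma> * V y - \<sigma> * V x\<bar>"
      using \<sigma>(1) by (simp add: right_diff_distrib[symmetric] abs_mult)
    also have "\<dots> = \<bar>\<bar>\<sigma> * V y\<bar> - \<bar>\<sigma> * V x\<bar>\<bar>" using before[of x] before[of y] xy by simp
    also have "\<dots> = \<bar>\<bar>V y\<bar> - \<bar>V x\<bar>\<bar>" using \<sigma>(1) by (simp add: abs_mult)
    also have "\<dots> \<le> 8 * K ^ 3 * (y - x)" using xy by (intro abs_sonic_defect_lipschitz)
    finally have "C * ((y - x) + \<bar>V y - V x\<bar>) \<le> C * ((y - x) + 8 * K ^ 3 * (y - x))"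
      using C0 by (intro mult_left_mono add_left_mono) auto
    moreover have "norm (U y - U x) \<le> C * ((y - x) + \<bar>V y - V x\<bar>)"
      using xy st ad by (intro piece_state_controlled[OF C nz]) auto
    ultimately have "norm (U y - U x) \<le> C * ((y - x) + 8 * K ^ 3 * (y - x))" by linarith
    then show "norm (U y - U x) \<le> C * (1 + 8 * K ^ 3) * (y - x)" by (simp add: algebra_simps)
  qed (use C0 K in auto)
  note Wp = left_limit_in_phase_space[OF W]
  have dn: "density W \<noteq> 0" using phase_spaceD(1)[OF Wp] by simp
  have lim: "(V \<longlongrightarrow> sonic_defect \<gamma> d W) (at_left d)"
    by (rule tendsto_polar_functions[OF W dn tendsto_ident_at])
  have evl: "\<forall>\<^sub>F x in at_left d. x \<in> {s<..<d}" using \<open>s < d\<close> by (rule eventually_at_left_real)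
  have "\<sigma> * sonic_defect \<gamma> d W \<ge> 0"
  proof (rule tendsto_lowerbound[OF tendsto_mult[OF tendsto_const lim] _ trivial_limit_at_left_real])
    show "\<forall>\<^sub>F x in at_left d. 0 \<le> \<sigma> * V x"
      using evl by eventually_elim (use before in \<open>auto intro: less_imp_le\<close>)
  qed
  moreover have "\<bar>V d\<bar> - \<bar>sonic_defect \<gamma> d W\<bar> \<le> 8 * K ^ 3 * (d - d)"
  proof (rule tendsto_le[OF trivial_limit_at_left_real])
    show "((\<lambda>x. \<bar>V d\<bar> - \<bar>V x\<bar>) \<longlongrightarrow> \<bar>V d\<bar> - \<bar>sonic_defect \<gamma> d W\<bar>) (at_left d)" by (intro tendsto_intros lim)
    show "((\<lambda>x. 8 * K ^ 3 * (d - x)) \<longlongrightarrow> 8 * K ^ 3 * (d - d)) (at_left d)" by (intro tendsto_intros)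
    show "\<forall>\<^sub>F x in at_left d. \<bar>V d\<bar> - \<bar>V x\<bar> \<le> 8 * K ^ 3 * (d - x)"
      using evl
    proof eventually_elim
      case (elim x)
      then show ?case using abs_sonic_defect_lipschitz[of x d] by auto
    qed
  qed
  ultimately have sW: "\<sigma> * sonic_defect \<gamma> d W > 0" using Vd \<sigma>(1) by (auto simp: less_le)
  have ss: "\<sigma> * \<sigma> = 1" using \<sigma>(1) by (metis abs_mult_self_eq mult_1)
  have sm: "\<sigma> * m d > 0" by (rule \<sigma>(2)[OF ad])
  have prod: "m d * x = (\<sigma> * m d) * (\<sigma> * x)" for x using ss by (simp add: mult_ac)
  have "m d * sonic_defect \<gamma> d W > 0" "m d * V d < 0"
    unfolding prod[of "sonic_defect \<gamma> d W"] prod[of "V d"] using sm sW Vd by (auto simp: mult_pos_neg)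
  then show False using no_reverse_shock[OF W nz[OF ad]] by blast
qed

end

section \<open>Contact discontinuities and the global decomposition\<close>

context selfsimilar_flow
begin

lemma mass_flux_sign:
  assumes "a < b" and nz: "\<And>x. a < x \<Longrightarrow> x < b \<Longrightarrow> m x \<noteq> 0"
  obtains \<sigma> where "\<bar>\<sigma>\<bar> = 1" "\<And>x. a < x \<Longrightarrow> x < b \<Longrightarrow> \<sigma> * m x > 0"
proof -
  define c where "c = (a + b) / 2"
  have c: "a < c" "c < b" using \<open>a < b\<close> by (auto simp: c_def)
  have same: "sgn (m x) = sgn (m c)" if "a < x" "x < b" for x
  proof (rule ccontr)
    assume ne: "sgn (m x) \<noteq> sgn (m c)"
    define s t where "s = min x c" "t = max x c"
    have st: "s \<le> t" "a < s" "t < b" using that c by (auto simp: s_t_def)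
    have "m s \<le> 0 \<and> 0 \<le> m t \<or> m t \<le> 0 \<and> 0 \<le> m s"
      using ne nz[OF that] nz[OF c] by (auto simp: s_t_def sgn_if min_def max_def split: if_splits)
    then obtain z where "s \<le> z" "z \<le> t" "m z = 0"
      using IVT[of m s 0 t] IVT2[of m t 0 s] st flux_isCont(1) by blast
    then show False using nz[of z] st by auto
  qed
  show thesis
  proof (rule that[of "sgn (m c)"])
    show "\<bar>sgn (m c)\<bar> = 1" using nz[OF c] by (simp add: abs_sgn_eq)
    show "sgn (m c) * m x > 0" if "a < x" "x < b" for x
      using nz[OF that] unfolding same[OF that, symmetric] by (simp add: sgn_if)
  qed
qed

text \<open>The equations \<open>m' = \<rho> L\<close> and \<open>L' = - m / \<rho>\<close> describe a rotation of \<open>(L, m)\<close> at a speed bounded by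
  \<open>K\<close>; a nonzero velocity along the ray at angle \<open>a\<close> therefore forbids another zero of \<open>m\<close> for
  some time. The bound depends on \<open>K\<close> only, however small the velocity is, because the
  system is homogeneous in \<open>(L, m)\<close>.
  This is where the absence of stagnation points enters.\<close>

lemma mass_flux_zero_gap:
  assumes ma: "m a = 0" and z: "a < z" "z < a + 1 / K"
  shows "m z \<noteq> 0"
proof
  assume mz: "m z = 0"
  have Na: "N a = 0" using ma state(1)[of a] by (simp add: mass_flux_def)
  have La: "L a \<noteq> 0"
  proof
    assume "L a = 0"
    then have "vel_x (U a) = 0" "vel_y (U a) = 0"
      using velocity_components[of "U a" a] Na by auto
    then show False using no_stagnation by (auto simp: no_stagnation_points_def)
  qed
  define \<sigma> where "\<sigma> = sgn (L a)"
  define l where "l = \<bar>L a\<bar>"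
  have l: "l > 0" "\<sigma> * L a = l" using La by (auto simp: l_def \<sigma>_def sgn_if)
  have "((\<lambda>x. \<sigma> * m x) has_real_derivative \<sigma> * (\<rho> a * L a)) (at_right a)"
    by (intro DERIV_cmult flux_derivatives)
  moreover have "\<sigma> * (\<rho> a * L a) > 0"
  proof -
    have eq: "\<sigma> * (\<rho> a * L a) = \<rho> a * (\<sigma> * L a)" by (rule mult.left_commute)
    show ?thesis unfolding eq l(2) using l(1) state(1)[of a] by simp
  qed
  ultimately obtain e where e: "e > 0" "\<And>h. h > 0 \<Longrightarrow> h < e \<Longrightarrow> 0 < \<sigma> * m (a + h)"
    using has_real_derivative_pos_inc_right[of "\<lambda>x. \<sigma> * m x" _ a "{a<..}"] ma by auto
  have near: "\<sigma> * m x > 0" if "a < x" "x < a + e" for x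
    using e(2)[of "x - a"] that by simp
  \<comment> \<open>Up to the first return \<open>b\<close> of the mass flux to zero, \<open>L\<close> moves away from its initial size \<open>l\<close>
    by at most \<open>l (K (b - a))\<^sup>2\<close>, so it keeps its sign and the mass flux is still monotone.\<close>
  define Z where "Z = {x\<in>{a + e / 2..z}. \<sigma> * m x \<le> 0}"
  define b where "b = Inf Z"
  have ez: "a + e \<le> z" using near[of z] mz z by force
  then have zZ: "z \<in> Z" using e(1) mz by (auto simp: Z_def)
  have "closed Z" unfolding Z_def
    by (intro continuous_on_closed_Collect_le continuous_intros mass_flux_continuous_on) 
  moreover have bdd: "bdd_below Z" by (auto simp: Z_def intro!: bdd_belowI[of _ "a + e / 2"])
  ultimately have bZ: "b \<in> Z" unfolding b_def using zZ by (intro closed_contains_Inf) auto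
  have b: "a < b" "b < a + 1 / K" "\<sigma> * m b \<le> 0" using bZ e(1) z by (auto simp: Z_def)
  have pos: "\<sigma> * m x > 0" if "a < x" "x < b" for x
  proof (cases "x < a + e")
    case True
    then show ?thesis using near that by simp
  next
    case False
    have "x \<notin> Z" using cInf_lower[OF _ bdd, of x] that unfolding b_def by force
    then show ?thesis using False that bZ e(1) by (auto simp: Z_def)
  qed
  have nz: "m x \<noteq> 0" if "a < x" "x < b" for x using pos[OF that] by auto
  have \<sigma>N: "\<sigma> * N x = \<sigma> * m x / \<rho> x" for x by (simp add: mass_flux_def)
  have \<sigma>L: "((\<lambda>y. \<sigma> * L y) has_real_derivative - (\<sigma> * N x)) (at_right x)" if "a < x" "x < b" for x
    using DERIV_cmult[OF piece_derivatives(3)[OF nz that], of \<sigma>] by simp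
  have cL: "continuous_on {a..x} (\<lambda>y. \<sigma> * L y)" if "x < b" for x
    by (intro continuous_intros piece_continuous_on(1)[OF nz _ that]) auto
  have L_le: "\<sigma> * L x \<le> l" if "a \<le> x" "x < b" for x
  proof -
    have "\<sigma> * L x - \<sigma> * L a \<le> 0 * (x - a)"
    proof (rule increment_le_of_right_derivative_le[OF cL[OF that(2)] that(1)])
      fix y assume y: "a < y" "y < x"
      then have "\<sigma> * N y \<ge> 0" unfolding \<sigma>N using pos[of y] state(1)[of y] that by simp
      then show "\<exists>D\<le>0. ((\<lambda>y. \<sigma> * L y) has_real_derivative D) (at_right y)"
        using \<sigma>L[of y] y that by (intro exI[of _ "- (\<sigma> * N y)"]) auto
    qed
    then show ?thesis using l by simp
  qed
  have m_le: "\<sigma> * m x \<le> K * l * (x - a)" if "a \<le> x" "x < b" for x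
  proof -
    have "\<sigma> * m x - \<sigma> * m a \<le> K * l * (x - a)"
    proof (rule increment_le_of_right_derivative_le[OF _ that(1)])
      show "continuous_on {a..x} (\<lambda>y. \<sigma> * m y)" by (intro continuous_intros mass_flux_continuous_on)
      fix y assume y: "a < y" "y < x"
      have "\<rho> y * (\<sigma> * L y) \<le> \<rho> y * l" using L_le[of y] y that state(1)[of y] by (intro mult_left_mono) auto
      also have "\<dots> \<le> K * l" using state(3)[of y] l by (intro mult_right_mono) auto
      finally show "\<exists>D\<le>K * l. ((\<lambda>y. \<sigma> * m y) has_real_derivative D) (at_right y)"
        using DERIV_cmult[OF flux_derivatives(1)[of y], of \<sigma>] by (auto simp: mult_ac)
    qed
    then show ?thesis using ma by simp
  qed
  define w where "w = b - a"
  have w: "w > 0" "K * w < 1" using b K by (auto simp: w_def field_simps)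
  have L_pos: "\<sigma> * L x \<ge> 0" if "a \<le> x" "x < b" for x
  proof -
    have "- (\<sigma> * L x) - - (\<sigma> * L a) \<le> (K\<^sup>2 * l * w) * (x - a)"
    proof (rule increment_le_of_right_derivative_le[OF _ that(1), of "\<lambda>y. - (\<sigma> * L y)"])
      show "continuous_on {a..x} (\<lambda>y. - (\<sigma> * L y))" by (intro continuous_intros cL that)
      fix y assume y: "a < y" "y < x"
      have "K * l * (y - a) \<le> K * l * w" using K l y that by (intro mult_left_mono) (auto simp: w_def)
      then have "\<sigma> * m y \<le> K * l * w" using m_le[of y] y that by simp
      moreover have "0 < \<sigma> * m y" using pos[of y] y that by auto
      ultimately have "\<bar>\<sigma> * m y / \<rho> y\<bar> \<le> K * (K * l * w)"
        by (intro quotient_by_density_le in_phase_space) auto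
      then have "\<sigma> * m y / \<rho> y \<le> K * (K * l * w)" by (rule order_trans[OF abs_ge_self])
      then have "\<sigma> * N y \<le> K\<^sup>2 * l * w" unfolding \<sigma>N by (simp add: power2_eq_square mult_ac)
      then show "\<exists>D\<le>K\<^sup>2 * l * w. ((\<lambda>y. - (\<sigma> * L y)) has_real_derivative D) (at_right y)"
        using DERIV_minus[OF \<sigma>L[of y]] y that by (intro exI[of _ "\<sigma> * N y"]) auto
    qed
    also have "(K\<^sup>2 * l * w) * (x - a) \<le> (K\<^sup>2 * l * w) * w"
      using that K l w by (intro mult_left_mono) (auto simp: w_def)
    also have "\<dots> = l * ((K * w) * (K * w))" by (simp add: power2_eq_square mult_ac)
    also have "\<dots> \<le> l * (1 * 1)" using w K l by (intro mult_left_mono mult_mono) auto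
    finally show ?thesis using l by simp
  qed
  define c where "c = (a + b) / 2"
  have c: "a < c" "c < b" using b by (auto simp: c_def)
  have "- (\<sigma> * m b) - - (\<sigma> * m c) \<le> 0 * (b - c)"
  proof (rule increment_le_of_right_derivative_le[of c b "\<lambda>y. - (\<sigma> * m y)"])
    show "continuous_on {c..b} (\<lambda>y. - (\<sigma> * m y))" by (intro continuous_intros mass_flux_continuous_on)
    fix y assume y: "c < y" "y < b"
    have "\<rho> y * (\<sigma> * L y) \<ge> 0" using L_pos[of y] y c state(1)[of y] by simp
    then show "\<exists>D\<le>0. ((\<lambda>y. - (\<sigma> * m y)) has_real_derivative D) (at_right y)"
      using DERIV_minus[OF DERIV_cmult[OF flux_derivatives(1)[of y], of \<sigma>]]
      by (intro exI[of _ "- (\<sigma> * (\<rho> y * L y))"]) (auto simp: mult_ac)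
  qed (use c in auto)
  then show False using pos[OF c] b(3) by simp
qed

lemma first_zero_of_mass_flux:
  assumes "c \<le> y" "m y = 0"
  obtains z where "c \<le> z" "z \<le> y" "m z = 0" "\<And>x. c \<le> x \<Longrightarrow> x < z \<Longrightarrow> m x \<noteq> 0"
proof -
  define Z where "Z = {x\<in>{c..y}. m x = 0}"
  have "closed Z" unfolding Z_def by (intro continuous_closed_preimage_constant mass_flux_continuous_on) auto
  moreover have bdd: "bdd_below Z" by (auto simp: Z_def intro!: bdd_belowI[of _ c])
  moreover have "y \<in> Z" using assms by (auto simp: Z_def)
  ultimately have "Inf Z \<in> Z" by (intro closed_contains_Inf) auto
  moreover have "m x \<noteq> 0" if "c \<le> x" "x < Inf Z" for x
    using cInf_lower[OF _ bdd, of x] that \<open>Inf Z \<in> Z\<close> by (force simp: Z_def)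
  ultimately show thesis by (intro that[of "Inf Z"]) (auto simp: Z_def)
qed

lemma piece_lipschitz_plus_saltus:
  assumes C: "controls_states C" and C': "C \<le> C'" "8 * K ^ 3 \<le> C'"
    and B: "4 * K ^ 3 + \<gamma> * ((\<gamma> - 1) * K\<^sup>2) \<le> B"
    and "a < b" and nz: "\<And>x. a < x \<Longrightarrow> x < b \<Longrightarrow> m x \<noteq> 0"
  shows "lipschitz_plus_saltus (C' * (1 + C') + 4 * C'\<^sup>2) (2 * C' * (C' * (b - a) + B)) U a b"
proof -
  obtain \<sigma> where \<sigma>: "\<bar>\<sigma>\<bar> = 1" "\<And>x. a < x \<Longrightarrow> x < b \<Longrightarrow> \<sigma> * m x > 0"
    using mass_flux_sign[OF \<open>a < b\<close> nz] by blast
  have abs: "\<bar>\<sigma> * x\<bar> = \<bar>x\<bar>" for x using \<sigma>(1) by (simp add: abs_mult)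
  have "C' > 0" using C C'(1) by (simp add: controls_states_def)
  then show ?thesis
  proof (rule lipschitz_plus_saltus_if_upward_jumps[where V = "\<lambda>x. \<sigma> * V x", OF _ \<open>a < b\<close>])
    fix s t assume st: "a \<le> s" "s \<le> t" "t < b"
    have "norm (U t - U s) \<le> C * ((t - s) + \<bar>V t - V s\<bar>)"
      by (rule piece_state_controlled[OF C nz st])
    also have "\<dots> \<le> C' * ((t - s) + \<bar>V t - V s\<bar>)" using C'(1) st by (intro mult_right_mono) auto
    also have "\<bar>V t - V s\<bar> = \<bar>\<sigma> * V t - \<sigma> * V s\<bar>"
      using abs[of "V t - V s"] by (simp add: right_diff_distrib)
    finally show "norm (U t - U s) \<le> C' * ((t - s) + \<bar>\<sigma> * V t - \<sigma> * V s\<bar>)" .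
    have "\<bar>\<bar>V t\<bar> - \<bar>V s\<bar>\<bar> \<le> 8 * K ^ 3 * (t - s)" by (rule abs_sonic_defect_lipschitz[OF st(2)])
    also have "\<dots> \<le> C' * (t - s)" using C'(2) st by (intro mult_right_mono) auto
    finally show "\<bar>\<bar>\<sigma> * V t\<bar> - \<bar>\<sigma> * V s\<bar>\<bar> \<le> C' * (t - s)" unfolding abs .
  next
    fix s t assume "a \<le> s" "s < t" "t < b" "\<And>x. s \<le> x \<Longrightarrow> x \<le> t \<Longrightarrow> \<sigma> * V x \<noteq> 0" "\<sigma> * V s > 0"
    then show "\<sigma> * V t > 0"
      by (intro sonic_defect_jumps_up[OF C nz \<sigma>, of a b s t]) auto
  next
    fix x
    show "\<bar>\<sigma> * V x\<bar> \<le> B" unfolding abs using sonic_defect_bounded[of x] B by linarith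
    show "((\<lambda>x. \<sigma> * V x) \<longlongrightarrow> \<sigma> * V x) (at_right x)" by (intro tendsto_intros state_right)
  qed
qed

text \<open>The zeros of the mass flux are at least \<open>1 / K\<close> apart, so \<open>n\<close> counts the sectors needed to reach \<open>b\<close>.\<close>

lemma lipschitz_plus_saltus_from_zero:
  assumes piece: "\<And>a b. a < b \<Longrightarrow> b \<le> a + T \<Longrightarrow> (\<And>x. a < x \<Longrightarrow> x < b \<Longrightarrow> m x \<noteq> 0) \<Longrightarrow>
      lipschitz_plus_saltus M N1 U a b"
    and M: "M \<ge> 0" and N1: "N1 \<ge> 0"
    and ma: "m a = 0" and ab: "a < b" "b \<le> a + T" "b \<le> a + of_nat n / K"
  shows "lipschitz_plus_saltus M (N1 + of_nat n * (2 * N1 + 2 * K + M * T)) U a b"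
  using ma ab
proof (induction n arbitrary: a)
  case 0
  then show ?case by simp
next
  case (Suc n)
  let ?G = "2 * N1 + 2 * K + M * T"
  have T: "T > 0" using Suc.prems by linarith
  have G: "?G \<ge> 0" using M N1 K T by simp
  have bnd: "norm (U x) \<le> K" for x using in_phase_space[of x] by (simp add: phase_space_def)
  show ?case
  proof (cases "\<exists>y. a < y \<and> y < b \<and> m y = 0")
    case False
    then have "lipschitz_plus_saltus M N1 U a b"
      using Suc.prems by (intro piece) auto
    moreover have "0 \<le> of_nat (Suc n) * ?G" using G by (intro mult_nonneg_nonneg) auto
    ultimately show ?thesis by (elim lipschitz_plus_saltus_mono) auto
  next
    case True
    then obtain y where y: "a < y" "y < b" "m y = 0" by blast
    have "a + 1 / K \<le> y" using mass_flux_zero_gap[OF Suc.prems(1) y(1)] y(3) by force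
    then obtain z where z: "a + 1 / K \<le> z" "z \<le> y" "m z = 0" "\<And>x. a + 1 / K \<le> x \<Longrightarrow> x < z \<Longrightarrow> m x \<noteq> 0"
      using first_zero_of_mass_flux[OF _ y(3)] by blast
    have az: "a < z" "z < b" using z y K by (auto intro: less_le_trans[of _ "a + 1 / K"])
    have nz: "m x \<noteq> 0" if "a < x" "x < z" for x
      using mass_flux_zero_gap[OF Suc.prems(1) that(1)] z(4)[of x] that by force
    have left: "lipschitz_plus_saltus M N1 U a z"
      using az Suc.prems nz by (intro piece) auto
    have right: "lipschitz_plus_saltus M (N1 + of_nat n * ?G) U z b"
      using z az Suc.prems by (intro Suc.IH) (auto simp: add_divide_distrib)
    have "lipschitz_plus_saltus M (2 * N1 + (N1 + of_nat n * ?G) + 2 * K + M * (z - a)) U a b"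
      by (rule lipschitz_plus_saltus_glue[OF left right az bnd])
    moreover have "M * (z - a) \<le> M * T" using az Suc.prems M by (intro mult_left_mono) auto
    ultimately show ?thesis
      by (elim lipschitz_plus_saltus_mono) (auto simp: algebra_simps)
  qed
qed

text \<open>The first sector need not start at a zero of the mass flux.\<close>

lemma lipschitz_plus_saltus_on_period:
  assumes piece: "\<And>a b. a < b \<Longrightarrow> b \<le> a + T \<Longrightarrow> (\<And>x. a < x \<Longrightarrow> x < b \<Longrightarrow> m x \<noteq> 0) \<Longrightarrow>
      lipschitz_plus_saltus M N1 U a b"
    and M: "M \<ge> 0" and N1: "N1 \<ge> 0" and T: "T > 0" "T \<le> of_nat n / K"
  shows "lipschitz_plus_saltus M (N1 + of_nat (Suc n) * (2 * N1 + 2 * K + M * T)) U 0 T"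
proof -
  let ?G = "2 * N1 + 2 * K + M * T"
  have G: "?G \<ge> 0" using M N1 K T by simp
  have bnd: "norm (U x) \<le> K" for x using in_phase_space[of x] by (simp add: phase_space_def)
  note from_zero = lipschitz_plus_saltus_from_zero[OF piece M N1]
  consider "m 0 = 0" | "\<And>x. 0 < x \<Longrightarrow> x < T \<Longrightarrow> m x \<noteq> 0" | y where "m 0 \<noteq> 0" "0 < y" "y < T" "m y = 0"
    by blast
  then show ?thesis
  proof cases
    case 1
    have "lipschitz_plus_saltus M (N1 + of_nat n * ?G) U 0 T"
      by (rule from_zero) (use 1 T in auto)
    then show ?thesis using G by (elim lipschitz_plus_saltus_mono) (auto simp: algebra_simps)
  next
    case 2
    then have "lipschitz_plus_saltus M N1 U 0 T" using T by (intro piece) auto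
    moreover have "0 \<le> of_nat (Suc n) * ?G" using G by (intro mult_nonneg_nonneg) auto
    ultimately show ?thesis by (elim lipschitz_plus_saltus_mono) auto
  next
    case 3
    obtain z where z: "0 \<le> z" "z \<le> y" "m z = 0" "\<And>x. 0 \<le> x \<Longrightarrow> x < z \<Longrightarrow> m x \<noteq> 0"
      using first_zero_of_mass_flux[of 0 y] 3 by auto
    then have z0: "0 < z" "z < T" using 3 by (auto simp: less_le)
    have left: "lipschitz_plus_saltus M N1 U 0 z" using z z0 by (intro piece) auto
    have right: "lipschitz_plus_saltus M (N1 + of_nat n * ?G) U z T"
      by (rule from_zero) (use z z0 T in auto)
    have "lipschitz_plus_saltus M (2 * N1 + (N1 + of_nat n * ?G) + 2 * K + M * (z - 0)) U 0 T"
      by (rule lipschitz_plus_saltus_glue[OF left right z0 bnd])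
    moreover have "M * (z - 0) \<le> M * T" using z0 M by (intro mult_left_mono) auto
    ultimately show ?thesis
      by (elim lipschitz_plus_saltus_mono) (auto simp: algebra_simps)
  qed
qed

end

theorem theorem6:
  fixes \<gamma> K :: real
  assumes "\<gamma> > 1" and "K > 1"
  shows "\<exists>M>0. \<forall>(c\<^sub>v::real) (S\<^sub>0::real) (U :: real \<Rightarrow> real^4).
    c\<^sub>v > 0 \<and>
    steady_selfsimilar_entropy_solution \<gamma> K c\<^sub>v S\<^sub>0 U \<and>
    integrated_version \<gamma> c\<^sub>v S\<^sub>0 U \<and>
    right_continuous U \<and>
    no_stagnation_points U \<longrightarrow>
      bounded_variation_on {0..<2 * pi} U \<and>
      (\<exists>U\<^sub>L U\<^sub>S.
        (\<forall>\<theta>\<in>{0..<2 * pi}. U \<theta> = U\<^sub>L \<theta> + U\<^sub>S \<theta>) \<and>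
        M-lipschitz_on {0..<2 * pi} U\<^sub>L \<and>
        saltus_on {0..<2 * pi} U\<^sub>S \<and>
        bounded_variation_on {0..<2 * pi} U\<^sub>S \<and>
        total_variation {0..<2 * pi} U\<^sub>S \<le> ennreal M) \<and>
      special_bounded_variation_on {0..<2 * pi} U \<and>
      (\<forall>U\<^sub>a U\<^sub>j U\<^sub>c. bv_decomposition {0..<2 * pi} U U\<^sub>a U\<^sub>j U\<^sub>c \<longrightarrow>
        (\<exists>L. L-lipschitz_on {0..<2 * pi} U\<^sub>a))"
proof -
  interpret gas_phase_space \<gamma> K by unfold_locales (use assms in auto)
  obtain C where C: "controls_states C" using ex_controls_states by blast
  define C' where "C' = max C (8 * K ^ 3)"
  define B where "B = 4 * K ^ 3 + \<gamma> * ((\<gamma> - 1) * K\<^sup>2)"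
  define M where "M = C' * (1 + C') + 4 * C'\<^sup>2"
  define N1 where "N1 = 2 * C' * (C' * (2 * pi) + B)"
  define n where "n = nat \<lceil>2 * pi * K\<rceil>"
  define N where "N = N1 + of_nat (Suc n) * (2 * N1 + 2 * K + M * (2 * pi))"
  have C': "C' > 0" "C \<le> C'" "8 * K ^ 3 \<le> C'" using C by (auto simp: C'_def controls_states_def)
  have B0: "B \<ge> 0" using assms by (simp add: B_def)
  have M0: "M \<ge> 0" using C' by (simp add: M_def)
  have N10: "N1 \<ge> 0" using C' B0 by (simp add: N1_def)
  have n: "2 * pi \<le> of_nat n / K"
    using assms(2) real_nat_ceiling_ge[of "2 * pi * K"] by (simp add: n_def pos_le_divide_eq)
  have pos: "0 < max 1 (max M N)" by simp
  show ?thesis (is "\<exists>M>0. \<forall>c S U. ?flow c S U \<longrightarrow> ?bounds M U")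
  proof (intro exI[of _ "max 1 (max M N)"] conjI[OF pos] allI impI)
    fix c\<^sub>v S\<^sub>0 :: real and U :: "real \<Rightarrow> real^4"
    assume U: "?flow c\<^sub>v S\<^sub>0 U"
    interpret selfsimilar_flow \<gamma> K c\<^sub>v S\<^sub>0 U
      by unfold_locales (use U in \<open>auto simp: steady_selfsimilar_entropy_solution_def\<close>)
    have piece: "lipschitz_plus_saltus M N1 U a b"
      if "a < b" "b \<le> a + 2 * pi" "\<And>x. a < x \<Longrightarrow> x < b \<Longrightarrow> mass_flux x (U x) \<noteq> 0" for a b
    proof -
      have "lipschitz_plus_saltus M (2 * C' * (C' * (b - a) + B)) U a b"
        unfolding M_def by (rule piece_lipschitz_plus_saltus[OF C C'(2,3) _ that(1,3)]) (simp add: B_def)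
      moreover have "2 * C' * (C' * (b - a) + B) \<le> N1"
        unfolding N1_def using that C' by (intro mult_left_mono add_right_mono) auto
      ultimately show ?thesis by (elim lipschitz_plus_saltus_mono) auto
    qed
    have "lipschitz_plus_saltus M N U 0 (2 * pi)"
      unfolding N_def by (rule lipschitz_plus_saltus_on_period[OF piece M0 N10 _ n]) auto
    moreover have "0 < 2 * pi" "M \<le> max 1 (max M N)" "N \<le> max 1 (max M N)" by auto
    ultimately show "?bounds (max 1 (max M N)) U" by (rule lipschitz_plus_saltus_consequences)
  qed
qed

end
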